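(* The following hold for families of languages generated by external contextual grammars: Equalities: $\mathcal{EC}(\mathit{REG})=\mathcal{EC}(\mathit{UF})=\mathcal{EC}(\mathit{LCOM})=\mathcal{EC}(\mathit{RCOM})=\mathcal{EC}(\mathit{2COM})$. Proper inclusions: $\mathcal{EC}(\mathit{FIN})\subset\mathcal{EC}(\mathit{MON})$, $\mathcal{EC}(\mathit{MON})\subset\mathcal{EC}(\mathit{NIL})$, $\mathcal{EC}(\mathit{MON})\subset\mathcal{EC}(\mathit{COMB})$, $\mathcal{EC}(\mathit{MON})\subset\mathcal{EC}(\mathit{INF})$, $\mathcal{EC}(\mathit{MON})\subset\mathcal{EC}(\mathit{STAR})$, $\mathcal{EC}(\mathit{COMB})\subset\mathcal{EC}(\mathit{DEF})$, $\mathcal{EC}(\mathit{NIL})\subset\mathcal{EC}(\mathit{DEF})$, $\mathcal{EC}(\mathit{NIL})\subset\mathcal{EC}(\mathit{COMM})$, $\mathcal{EC}(\mathit{DEF})\subset\mathcal{EC}(\mathit{ORD})$, $\mathcal{EC}(\mathit{DEF})\subset\mathcal{EC}(\mathit{SYDEF})$, $\mathcal{EC}(\mathit{ORD})\subset\mathcal{EC}(\mathit{NC})$, $\mathcal{EC}(\mathit{NC})\subset\mathcal{EC}(\mathit{PS})$, $\mathcal{EC}(\mathit{SYDEF})\subset\mathcal{EC}(\mathit{PS})$, $\mathcal{EC}(\mathit{INF})\subset\mathcal{EC}(\mathit{SUF})$, $\mathcal{EC}(\mathit{INF})\subset\mathcal{EC}(\mathit{PRE})$, $\mathcal{EC}(\mathit{SUF})\subset\mathcal{EC}(\mathit{PS})$,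 $\mathcal{EC}(\mathit{PRE})\subset\mathcal{EC}(\mathit{PS})$, $\mathcal{EC}(\mathit{PS})\subset\mathcal{EC}(\mathit{REG})$, $\mathcal{EC}(\mathit{STAR})\subset\mathcal{EC}(\mathit{REG})$, $\mathcal{EC}(\mathit{COMM})\subset\mathcal{EC}(\mathit{CIRC})$, $\mathcal{EC}(\mathit{CIRC})\subset\mathcal{EC}(\mathit{REG})$. Furthermore, consider the directed graph whose nodes are the families $\mathcal{EC}(\mathcal F)$ for $\mathcal F\in\{\mathit{FIN},\mathit{MON},\mathit{COMB},\mathit{NIL},\mathit{DEF},\mathit{ORD},\mathit{SYDEF},\mathit{INF},\mathit{SUF},\mathit{PRE},\mathit{COMM},\mathit{STAR},\mathit{NC},\mathit{PS},\mathit{CIRC},\mathit{REG}\}$ and which has an edge $X\to Y$ for each proper inclusion $X\subset Y$ listed above. If $X$ and $Y$ are two distinct nodes such that there is no directed path from $X$ to $Y$ and none from $Y$ to $X$, then $X$ and $Y$ are incomparable, i.e. $X\not\subseteq Y$ and $Y\not\subseteq X$.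
   Context: An alphabet is a non-empty finite set; $\lambda$ is the empty word; $\subset$ denotes proper inclusion. Contextual grammars. Let $\mathcal F$ be a family of languages. A contextual grammar with selection in $\mathcal F$ is a triple $G=(V,\mathcal S,A)$ where $V$ is an alphabet, $A\subset V^*$ is a finite set of axioms, and $\mathcal S$ is a finite set of selection pairs $(S,C)$, where the selection language $S$ is a language in $\mathcal F$ with respect to some alphabet $U\subseteq V$, and $C\subset V^*\times V^*$ is a finite set of contexts $(u,v)$ with $uv\neq\lambda$. External derivation: $x\Longrightarrow_{\mathrm{ex}}y$ iff there are $(S,C)\in\mathcal S$ and $(u,v)\in C$ with $x\in S$ and $y=uxv$. The externally generated language is $L_{\mathrm{ex}}(G)=\{z: x\Longrightarrow_{\mathrm{ex}}^* z\text{ for some }x\in A\}$. $\mathcal{EC}(\mathcal F)$ is the family of all languages generated externally by contextual grammars with selection in $\mathcal F$. Families. $\mathit{REG}$ is the family of regular languages, $\mathit{FIN}$ the family of finite languages. Each property below is a property of a regular language $L\subseteq V^*$ with respect to an alphabet $V$, and the abbreviation denotes the family of all regular languages having the property: - $\mathit{MON}$: $L=V^*$. - $\mathit{NIL}$: $L$ or $V^*\setminus L$ is finite. - $\mathit{COMB}$: $L=V^*X$ for some $X\subseteq V$. - $\mathit{DEF}$: $L=A\cup V^*B$ for finite $A,B\subseteq V^*$. - $\mathit{SYDEF}$: $L=EV^*H$ for regular languages $E,H$. - $\mathit{INF}$ (infix-closed): $xyz\in L$ implies $y\in L$, for all $x,y,z\in V^*$. - $\mathit{PRE}$ (prefix-closed):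 $xy\in L$ implies $x\in L$, for all $x,y\in V^*$. - $\mathit{SUF}$ (suffix-closed): $xy\in L$ implies $y\in L$, for all $x,y\in V^*$. - $\mathit{ORD}$: $L$ is accepted by a deterministic finite automaton $(V,Z,z_0,F,\delta)$ such that $Z$ carries a total order $\preceq$ for which $z\preceq z'$ implies $\delta(z,a)\preceq\delta(z',a)$ for every $a\in V$. - $\mathit{COMM}$: $L$ contains with each word all permutations of it. - $\mathit{CIRC}$: $L$ contains with each word all circular shifts of it. - $\mathit{NC}$ (non-counting): there is $k\ge 1$ such that for all $x,y,z\in V^*$: $xy^kz\in L$ iff $xy^{k+1}z\in L$. - $\mathit{PS}$ (power-separating): there is $m\ge1$ such that for every $x\in V^*$, with $J_x^m=\{x^n: n\ge m\}$, either $J_x^m\cap L=\emptyset$ or $J_x^m\subseteq L$. - $\mathit{UF}$ (union-free): $L$ is described by a regular expression built only by concatenation and Kleene closure. - $\mathit{STAR}$: $L=H^*$ for some regular $H\subseteq V^*$. - $\mathit{LCOM}$: $L=EG^*$ for some regular $E$ and regular $G\notin\{\emptyset,\{\lambda\}\}$. - $\mathit{RCOM}$: $L=G^*H$ for some regular $H$ and regular $G\notin\{\emptyset,\{\lambda\}\}$. - $\mathit{2COM}$: $L=EG^*H$ for regular $E,H$ and regular $G\notin\{\emptyset,\{\lambda\}\}$. *)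

theory Defs
  imports "HOL-Library.Infinite_Typeclass" "HOL-Library.Multiset"
begin

section \<open>Alphabets, words, languages\<close>

definition alphabet :: "'a set \<Rightarrow> bool" where
  "alphabet V \<longleftrightarrow> finite V \<and> V \<noteq> {}"

definition conc :: "'a list set \<Rightarrow> 'a list set \<Rightarrow> 'a list set"  (infixr \<open>\<cdot>\<close> 75) where
  "K \<cdot> L = {x @ y | x y. x \<in> K \<and> y \<in> L}"

definition kstar :: "'a list set \<Rightarrow> 'a list set" where
  "kstar L = concat ` lists L"

definition wpow :: "'a list \<Rightarrow> nat \<Rightarrow> 'a list" where
  "wpow w n = concat (replicate n w)"

text \<open>The empty word needs no constructor of its own: it is described by \<open>Star Zero\<close>,
  which is also union-free.\<close>

datatype (atoms: 'a) rexp =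
    Zero
  | Atom 'a
  | Union "'a rexp" "'a rexp"
  | Times "'a rexp" "'a rexp"
  | Star "'a rexp"

fun lang :: "'a rexp \<Rightarrow> 'a list set" where
  "lang Zero = {}"
| "lang (Atom a) = {[a]}"
| "lang (Union r s) = lang r \<union> lang s"
| "lang (Times r s) = lang r \<cdot> lang s"
| "lang (Star r) = kstar (lang r)"

fun union_free :: "'a rexp \<Rightarrow> bool" where
  "union_free Zero \<longleftrightarrow> True"
| "union_free (Atom a) \<longleftrightarrow> True"
| "union_free (Union r s) \<longleftrightarrow> False"
| "union_free (Times r s) \<longleftrightarrow> union_free r \<and> union_free s"
| "union_free (Star r) \<longleftrightarrow> union_free r"

definition regular :: "'a set \<Rightarrow> 'a list set \<Rightarrow> bool" where
  "regular V L \<longleftrightarrow> (\<exists>r. atoms r \<subseteq> V \<and> lang r = L)"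

text \<open>Deterministic finite automata; since state sets are finite, it is no restriction
  to take the states from \<open>nat\<close>.  The order in an ordered automaton is an arbitrary
  total order on the states, not the one of \<open>nat\<close>.\<close>

definition dfa :: "'a set \<Rightarrow> nat set \<Rightarrow> nat \<Rightarrow> nat set \<Rightarrow> (nat \<Rightarrow> 'a \<Rightarrow> nat) \<Rightarrow> bool" where
  "dfa V Z z\<^sub>0 F \<delta> \<longleftrightarrow>
     finite Z \<and> z\<^sub>0 \<in> Z \<and> F \<subseteq> Z \<and> (\<forall>z\<in>Z. \<forall>a\<in>V. \<delta> z a \<in> Z)"

definition accepted :: "'a set \<Rightarrow> nat \<Rightarrow> nat set \<Rightarrow> (nat \<Rightarrow> 'a \<Rightarrow> nat) \<Rightarrow> 'a list set" where
  "accepted V z\<^sub>0 F \<delta> = {w \<in> lists V. foldl \<delta> z\<^sub>0 w \<in> F}"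

definition ordered :: "'a set \<Rightarrow> 'a list set \<Rightarrow> bool" where
  "ordered V L \<longleftrightarrow>
     (\<exists>Z z\<^sub>0 F \<delta> r. dfa V Z z\<^sub>0 F \<delta> \<and> L = accepted V z\<^sub>0 F \<delta> \<and> linear_order_on Z r \<and>
        (\<forall>z z'. (z, z') \<in> r \<longrightarrow> (\<forall>a\<in>V. (\<delta> z a, \<delta> z' a) \<in> r)))"


section \<open>Families of selection languages\<close>

text \<open>A family assigns to every alphabet \<open>V\<close> the languages that belong to the family
  with respect to \<open>V\<close>.\<close>

type_synonym 'a family = "'a set \<Rightarrow> 'a list set set"

datatype family_name =
    F_REG | F_FIN | F_MON | F_NIL | F_COMB | F_DEF | F_SYDEF | F_INF | F_PRE | F_SUF
  | F_ORD | F_COMM | F_CIRC | F_NC | F_PS | F_UF | F_STAR | F_LCOM | F_RCOM | F_2COM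

fun fam :: "family_name \<Rightarrow> 'a family" where
  "fam F_REG V = {L. regular V L}"
| "fam F_FIN V = {L. L \<subseteq> lists V \<and> finite L}"
| "fam F_MON V = {L. regular V L \<and> L = lists V}"
| "fam F_NIL V = {L. regular V L \<and> (finite L \<or> finite (lists V - L))}"
| "fam F_COMB V = {L. regular V L \<and> (\<exists>X \<subseteq> V. L = lists V \<cdot> {[a] | a. a \<in> X})}"
| "fam F_DEF V = {L. regular V L \<and>
     (\<exists>A B. finite A \<and> A \<subseteq> lists V \<and> finite B \<and> B \<subseteq> lists V \<and> L = A \<union> lists V \<cdot> B)}"
| "fam F_SYDEF V = {L. regular V L \<and>
     (\<exists>E H. regular V E \<and> regular V H \<and> L = E \<cdot> lists V \<cdot> H)}"
| "fam F_INF V = {L. regular V L \<and>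
     (\<forall>x\<in>lists V. \<forall>y\<in>lists V. \<forall>z\<in>lists V. x @ y @ z \<in> L \<longrightarrow> y \<in> L)}"
| "fam F_PRE V = {L. regular V L \<and>
     (\<forall>x\<in>lists V. \<forall>y\<in>lists V. x @ y \<in> L \<longrightarrow> x \<in> L)}"
| "fam F_SUF V = {L. regular V L \<and>
     (\<forall>x\<in>lists V. \<forall>y\<in>lists V. x @ y \<in> L \<longrightarrow> y \<in> L)}"
| "fam F_ORD V = {L. regular V L \<and> ordered V L}"
| "fam F_COMM V = {L. regular V L \<and> (\<forall>x\<in>L. \<forall>y. mset y = mset x \<longrightarrow> y \<in> L)}"
| "fam F_CIRC V = {L. regular V L \<and> (\<forall>x y. x @ y \<in> L \<longrightarrow> y @ x \<in> L)}"
| "fam F_NC V = {L. regular V L \<and>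
     (\<exists>k\<ge>1. \<forall>x\<in>lists V. \<forall>y\<in>lists V. \<forall>z\<in>lists V.
        x @ wpow y k @ z \<in> L \<longleftrightarrow> x @ wpow y (k + 1) @ z \<in> L)}"
| "fam F_PS V = {L. regular V L \<and>
     (\<exists>m\<ge>1. \<forall>x\<in>lists V.
        {wpow x n | n. n \<ge> m} \<inter> L = {} \<or> {wpow x n | n. n \<ge> m} \<subseteq> L)}"
| "fam F_UF V = {L. \<exists>r. atoms r \<subseteq> V \<and> union_free r \<and> lang r = L}"
| "fam F_STAR V = {L. regular V L \<and> (\<exists>H. regular V H \<and> L = kstar H)}"
| "fam F_LCOM V = {L. regular V L \<and>
     (\<exists>E G. regular V E \<and> regular V G \<and> G \<notin> {{}, {[]}} \<and> L = E \<cdot> kstar G)}"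
| "fam F_RCOM V = {L. regular V L \<and>
     (\<exists>G H. regular V G \<and> regular V H \<and> G \<notin> {{}, {[]}} \<and> L = kstar G \<cdot> H)}"
| "fam F_2COM V = {L. regular V L \<and>
     (\<exists>E G H. regular V E \<and> regular V G \<and> regular V H \<and> G \<notin> {{}, {[]}} \<and>
        L = E \<cdot> kstar G \<cdot> H)}"


section \<open>External contextual grammars\<close>

record 'a cgrammar =
  alph :: "'a set"
  selection :: "('a list set \<times> ('a list \<times> 'a list) set) set"
  axms :: "'a list set"

definition contextual_grammar :: "'a family \<Rightarrow> 'a cgrammar \<Rightarrow> bool" where
  "contextual_grammar \<F> G \<longleftrightarrow>
     alphabet (alph G) \<and>
     finite (axms G) \<and> axms G \<subseteq> lists (alph G) \<and>
     finite (selection G) \<and>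
     (\<forall>(S, C) \<in> selection G.
        (\<exists>U. alphabet U \<and> U \<subseteq> alph G \<and> S \<in> \<F> U) \<and>
        finite C \<and> C \<subseteq> lists (alph G) \<times> lists (alph G) \<and> (\<forall>(u, v) \<in> C. u @ v \<noteq> []))"

definition derives_ex :: "'a cgrammar \<Rightarrow> 'a list \<Rightarrow> 'a list \<Rightarrow> bool" where
  "derives_ex G x y \<longleftrightarrow>
     (\<exists>(S, C) \<in> selection G. \<exists>(u, v) \<in> C. x \<in> S \<and> y = u @ x @ v)"

definition L_ex :: "'a cgrammar \<Rightarrow> 'a list set" where
  "L_ex G = {z. \<exists>x \<in> axms G. (derives_ex G)\<^sup>*\<^sup>* x z}"

definition EC :: "'a family \<Rightarrow> 'a list set set" where
  "EC \<F> = {L_ex G | G. contextual_grammar \<F> G}"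


section \<open>The hierarchy\<close>

definition proper_inclusions :: "(family_name \<times> family_name) set" where
  "proper_inclusions =
    {(F_FIN, F_MON),
     (F_MON, F_NIL), (F_MON, F_COMB), (F_MON, F_INF), (F_MON, F_STAR),
     (F_COMB, F_DEF), (F_NIL, F_DEF), (F_NIL, F_COMM),
     (F_DEF, F_ORD), (F_DEF, F_SYDEF),
     (F_ORD, F_NC), (F_NC, F_PS), (F_SYDEF, F_PS),
     (F_INF, F_SUF), (F_INF, F_PRE), (F_SUF, F_PS), (F_PRE, F_PS),
     (F_PS, F_REG), (F_STAR, F_REG), (F_COMM, F_CIRC), (F_CIRC, F_REG)}"

text \<open>The graph is taken on the names of the families, so that its nodes are distinct
  by construction and do not collapse should two of the generated families coincide.\<close>

definition hierarchy_nodes :: "family_name set" where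
  "hierarchy_nodes =
    {F_FIN, F_MON, F_COMB, F_NIL, F_DEF, F_ORD, F_SYDEF, F_INF, F_SUF, F_PRE, F_COMM,
     F_STAR, F_NC, F_PS, F_CIRC, F_REG}"

end

theory Submission
  imports Defs "HOL-Library.List_Lexorder"
begin

text \<open>Since axioms are free, a selection language may be changed on finitely many words, and on
  words over letters that never occur in the generated language.  The first freedom yields the
  inclusions that fail for the families themselves (such as \<open>NIL\<close> in \<open>COMM\<close>), the second one the
  equalities for the comet families: attach \<open>c\<^sup>*\<close> for a fresh letter \<open>c\<close>.  Power separation rests
  on regular languages having finitely many quotients.

  For most non-inclusions take \<open>L = W\<^sup>* \<union> m S m\<close> with a marker \<open>m\<close> outside \<open>W\<close>: then \<open>L\<close> is in
  \<open>EC(F)\<close> only if \<open>S\<close> is, up to finitely many words, a finite union of languages \<open>u (T \<inter> W\<^sup>*) v\<close> with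
  \<open>T\<close> in \<open>F\<close>, so the defining closure property of \<open>F\<close> can be applied to a long word of \<open>S\<close> whose core
  is padded by a power of one letter.  To separate \<open>NC\<close> from \<open>ORD\<close>, let \<open>S\<close> consist of all products of
  blocks \<open>p q'\<close> with distinct \<open>p\<close>, \<open>q\<close> among three letters: after reading one of the three letters, the
  middle one of the three states reached is made dead by a letter which keeps the outer two alive, so an ordered
  automaton would need arbitrarily long chains of alternately live and dead states.\<close>

text \<open>The padding on both sides of a core answers the contexts: a rule selects
  \<open>x\<close>, not the whole word \<open>u @ x @ v\<close>, and short contexts can consume only
  padding, so the core is still present in \<open>x\<close>. A marked language needs
  \<open>lists W\<close> in the family and a set \<open>S\<close> that is not trivial up to finitely
  many words. The first fails for COMB, the second for NIL. These two families therefore get thin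
  languages without a part \<open>W\<^sup>*\<close>: words \<open>b a\<^sup>n\<close> can only be
  lengthened by appending letters \<open>a\<close>, and a few other words of the language act as
  traps, which the closure property of the opposing family forces into the selection language
  although a step from them leads out of the language. Most closure properties are refuted on one
  word of one selection language. Being ordered concerns many words of the same selection language
  at once, so there one rule has to be found that serves all of them. Non-inclusions pass to larger
  left and smaller right families; hence a short table of separations settles both properness and
  incomparability.\<close>

section \<open>Grammars as finite sets of rules\<close>

inductive_set gen ::
  "'a list set \<Rightarrow> ('a list set \<times> 'a list \<times> 'a list) set \<Rightarrow> 'a list set" for A R where
  gen_axiom: "x \<in> A \<Longrightarrow> x \<in> gen A R"
| gen_step: "x \<in> gen A R \<Longrightarrow> (S, u, v) \<in> R \<Longrightarrow> x \<in> S \<Longrightarrow> u @ x @ v \<in> gen A R"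

definition rules :: "'a family \<Rightarrow> ('a list set \<times> 'a list \<times> 'a list) set \<Rightarrow> bool" where
  "rules \<F> R \<longleftrightarrow> finite R \<and> (\<forall>(S, u, v) \<in> R. (\<exists>U. alphabet U \<and> S \<in> \<F> U) \<and> u @ v \<noteq> [])"

lemma gen_eq_rtranclp:
  "gen A R = {z. \<exists>x \<in> A. (\<lambda>x y. \<exists>(S, u, v) \<in> R. x \<in> S \<and> y = u @ x @ v)\<^sup>*\<^sup>* x z}"
    (is "_ = {z. \<exists>x \<in> A. ?D\<^sup>*\<^sup>* x z}")
proof (intro equalityI subsetI CollectI)
  fix z assume "z \<in> gen A R"
  then show "\<exists>x \<in> A. ?D\<^sup>*\<^sup>* x z"
  proof induction
    case (gen_step x S u v)
    then have "?D x (u @ x @ v)" by blast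
    moreover obtain x0 where "x0 \<in> A" "?D\<^sup>*\<^sup>* x0 x" using gen_step.IH by blast
    ultimately show ?case by (blast intro: rtranclp.rtrancl_into_rtrancl)
  qed blast
next
  fix z assume "z \<in> {z. \<exists>x \<in> A. ?D\<^sup>*\<^sup>* x z}"
  then obtain x where "?D\<^sup>*\<^sup>* x z" "x \<in> A" by blast
  then show "z \<in> gen A R"
    by (induction rule: rtranclp_induct) (auto intro: gen.intros)
qed

lemma L_ex_eq_gen: "L_ex G = gen (axms G) {(S, u, v). \<exists>C. (S, C) \<in> selection G \<and> (u, v) \<in> C}"
proof -
  have "derives_ex G = (\<lambda>x y. \<exists>(S, u, v) \<in> {(S, u, v). \<exists>C. (S, C) \<in> selection G \<and> (u, v) \<in> C}.
      x \<in> S \<and> y = u @ x @ v)"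
    by (auto simp: derives_ex_def fun_eq_iff)
  then show ?thesis by (simp add: L_ex_def gen_eq_rtranclp)
qed

text \<open>The alphabet of a grammar can be taken as large as its finitely many data require,
  so it plays no role.\<close>

lemma EC_iff: "L \<in> EC \<F> \<longleftrightarrow> (\<exists>A R. finite A \<and> rules \<F> R \<and> L = gen A R)"
proof
  assume "L \<in> EC \<F>"
  then obtain G where G: "contextual_grammar \<F> G" and L: "L = L_ex G" by (auto simp: EC_def)
  let ?R = "{(S, u, v). \<exists>C. (S, C) \<in> selection G \<and> (u, v) \<in> C}"
  have "?R = (\<Union>(S, C) \<in> selection G. {S} \<times> C)" by auto
  moreover have "finite \<dots>" using G by (force simp: contextual_grammar_def)
  ultimately have "rules \<F> ?R" using G unfolding rules_def contextual_grammar_def by fastforce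
  moreover have "finite (axms G)" using G by (simp add: contextual_grammar_def)
  ultimately show "\<exists>A R. finite A \<and> rules \<F> R \<and> L = gen A R" using L L_ex_eq_gen by blast
next
  assume "\<exists>A R. finite A \<and> rules \<F> R \<and> L = gen A R"
  then obtain A R where A: "finite A" and R: "rules \<F> R" and L: "L = gen A R" by blast
  have "\<forall>\<rho> \<in> R. \<exists>U. alphabet U \<and> fst \<rho> \<in> \<F> U" using R by (fastforce simp: rules_def)
  then obtain U where U: "\<And>\<rho>. \<rho> \<in> R \<Longrightarrow> alphabet (U \<rho>) \<and> fst \<rho> \<in> \<F> (U \<rho>)" by metis
  \<comment> \<open>The selection alphabets have to lie inside the alphabet of the grammar, so the
    chosen ones are included; \<open>undefined\<close> keeps \<open>V\<close> non-empty when
    \<open>A\<close> and \<open>R\<close> supply no letter.\<close>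
  define V where "V = insert undefined ((\<Union>x\<in>A. set x) \<union>
    (\<Union>\<rho>\<in>R. set (fst (snd \<rho>)) \<union> set (snd (snd \<rho>)) \<union> U \<rho>))"
  define G where "G = \<lparr>alph = V, selection = (\<lambda>(S, u, v). (S, {(u, v)})) ` R, axms = A\<rparr>"
  have alph: "alphabet V" using A R U by (auto simp: V_def alphabet_def rules_def)
  have rule: "(\<exists>U. alphabet U \<and> U \<subseteq> V \<and> S \<in> \<F> U) \<and> u \<in> lists V \<and> v \<in> lists V \<and> u @ v \<noteq> []"
    if "(S, u, v) \<in> R" for S u v
  proof (intro conjI exI[of _ "U (S, u, v)"])
    show "U (S, u, v) \<subseteq> V" "u \<in> lists V" "v \<in> lists V" using that by (force simp: V_def)+
    show "u @ v \<noteq> []" using that R by (auto simp: rules_def)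
  qed (use U[OF that] in auto)
  have "case \<sigma> of (S, C) \<Rightarrow> (\<exists>U. alphabet U \<and> U \<subseteq> V \<and> S \<in> \<F> U) \<and>
      finite C \<and> C \<subseteq> lists V \<times> lists V \<and> (\<forall>(u, v) \<in> C. u @ v \<noteq> [])"
    if "\<sigma> \<in> selection G" for \<sigma>
  proof -
    obtain S u v where "(S, u, v) \<in> R" "\<sigma> = (S, {(u, v)})" using \<open>\<sigma> \<in> selection G\<close> by (auto simp: G_def)
    with rule[of S u v] show ?thesis by simp
  qed
  moreover have "A \<subseteq> lists V" by (auto simp: V_def)
  moreover have "finite (selection G)" "alph G = V" "axms G = A" using R by (auto simp: G_def rules_def)
  ultimately have "contextual_grammar \<F> G"
    using A alph by (simp only: contextual_grammar_def Ball_def) blast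
  moreover have "{(S, u, v). \<exists>C. (S, C) \<in> selection G \<and> (u, v) \<in> C} = R"
    by (auto simp: G_def image_iff intro!: exI[of _ "{(_, _)}"] bexI[rotated])
  then have "L_ex G = L" by (simp add: L L_ex_eq_gen G_def)
  ultimately show "L \<in> EC \<F>" by (auto simp: EC_def)
qed

lemma ECE:
  assumes "L \<in> EC \<F>"
  obtains A R where "finite A" "rules \<F> R" "L = gen A R"
  using iffD1[OF EC_iff assms] by blast

lemma conc_lists:
  assumes "K \<subseteq> lists V" "L \<subseteq> lists V"
  shows "K \<cdot> L \<subseteq> lists V"
proof
  fix w assume "w \<in> K \<cdot> L"
  then obtain x y where "w = x @ y" "x \<in> K" "y \<in> L" by (auto simp: conc_def)
  moreover from this have "x \<in> lists V" "y \<in> lists V" using assms by blast+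
  ultimately show "w \<in> lists V" by simp
qed



text \<open>Letters enter a derivation only through axioms and contexts, never through selection
  languages. This is what makes letters outside \<open>V\<close> free for use in selection.\<close>

lemma gen_lists:
  assumes "finite A" "rules \<F> R"
  obtains V where "finite V" "gen A R \<subseteq> lists V"
proof
  let ?V = "(\<Union>x\<in>A. set x) \<union> (\<Union>(S, u, v)\<in>R. set u \<union> set v)"
  show "finite ?V" using assms by (auto simp: rules_def)
  show "gen A R \<subseteq> lists ?V"
  proof
    fix x assume "x \<in> gen A R" then show "x \<in> lists ?V"
    proof induction
      case (gen_step x S u v)
      then have "set u \<union> set v \<subseteq> ?V" by blast
      with gen_step show ?case by auto
    qed auto
  qed
qed

text \<open>A simulation may miss finitely many words of a selection language, because the
  derivation steps from these words can be turned into axioms; and it may add words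
  outside \<open>lists V\<close>, because these are never derived.\<close>

lemma EC_subsetI:
  assumes "\<And>V U S. finite V \<Longrightarrow> alphabet U \<Longrightarrow> S \<in> \<F> U \<Longrightarrow>
    \<exists>\<T>. finite \<T> \<and> (\<forall>T\<in>\<T>. \<exists>U'. alphabet U' \<and> T \<in> \<G> U') \<and>
        \<Union>\<T> \<inter> lists V \<subseteq> S \<and> finite (S - \<Union>\<T>)"
  shows "EC \<F> \<subseteq> EC \<G>"
proof
  fix L assume "L \<in> EC \<F>"
  then obtain A R where A: "finite A" and R: "rules \<F> R" and L: "L = gen A R" by (rule ECE)
  obtain V where V: "finite V" "L \<subseteq> lists V" using gen_lists[OF A R] L by blast
  have "\<exists>\<T>. finite \<T> \<and> (\<forall>T\<in>\<T>. \<exists>U'. alphabet U' \<and> T \<in> \<G> U') \<and>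
      \<Union>\<T> \<inter> lists V \<subseteq> S \<and> finite (S - \<Union>\<T>)" if "S \<in> fst ` R" for S
    using that R assms[OF V(1)] by (fastforce simp: rules_def)
  then obtain \<T> where \<T>: "\<And>S. S \<in> fst ` R \<Longrightarrow> finite (\<T> S) \<and>
      (\<forall>T\<in>\<T> S. \<exists>U'. alphabet U' \<and> T \<in> \<G> U') \<and>
      \<Union>(\<T> S) \<inter> lists V \<subseteq> S \<and> finite (S - \<Union>(\<T> S))"
    by metis
  \<comment> \<open>The missed words are intersected with \<open>L\<close>: the result of a step may
    become an axiom only if the word it starts from is derivable.\<close>
  define A' where "A' = A \<union> (\<Union>(S, u, v)\<in>R. (\<lambda>x. u @ x @ v) ` ((S - \<Union>(\<T> S)) \<inter> L))"
  define R' where "R' = (\<Union>(S, u, v)\<in>R. (\<lambda>T. (T, u, v)) ` \<T> S)"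
  have finR: "finite R" using R by (simp add: rules_def)
  have \<T>': "finite (\<T> S)" "\<And>T. T \<in> \<T> S \<Longrightarrow> \<exists>U'. alphabet U' \<and> T \<in> \<G> U'"
      "\<Union>(\<T> S) \<inter> lists V \<subseteq> S" "finite (S - \<Union>(\<T> S))" if "(S, u, v) \<in> R" for S u v
    using \<T>[of S] that by force+
  have "finite A'" using A finR \<T>' by (auto simp: A'_def)
  moreover have "rules \<G> R'"
    using R finR \<T>'(1,2) unfolding rules_def R'_def by fastforce
  moreover have "L = gen A' R'"
  proof (intro equalityI subsetI)
    fix x assume "x \<in> L"
    then have "x \<in> gen A R" by (simp add: L)
    then show "x \<in> gen A' R'"
    proof induction
      case (gen_axiom x) then show ?case by (auto simp: A'_def intro: gen.gen_axiom)
    next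
      case (gen_step x S u v)
      show ?case
      proof (cases "x \<in> \<Union>(\<T> S)")
        case True
        then obtain T where "T \<in> \<T> S" "x \<in> T" by blast
        then show ?thesis using gen_step by (intro gen.gen_step[of x _ _ T]) (auto simp: R'_def)
      next
        case False
        then have "u @ x @ v \<in> A'" using gen_step L by (force simp: A'_def)
        then show ?thesis by (rule gen.gen_axiom)
      qed
    qed
  next
    fix x assume "x \<in> gen A' R'"
    then show "x \<in> L"
    proof induction
      case (gen_axiom x) then show ?case by (auto simp: A'_def L intro: gen.intros)
    next
      case (gen_step x T u v)
      then obtain S where "(S, u, v) \<in> R" "T \<in> \<T> S" by (auto simp: R'_def)
      moreover from this have "x \<in> S" using \<T>'(3) gen_step V by blast
      ultimately show ?case using gen_step L by (auto intro: gen.intros)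
    qed
  qed
  ultimately show "L \<in> EC \<G>" using EC_iff by blast
qed

lemma EC_subsetI1:
  assumes "\<And>U S. alphabet U \<Longrightarrow> S \<in> \<F> U \<Longrightarrow> \<exists>T. T \<in> \<G> U \<and> T \<subseteq> S \<and> finite (S - T)"
  shows "EC \<F> \<subseteq> EC \<G>"
proof (rule EC_subsetI)
  fix V U and S :: "'a list set" assume "alphabet U" "S \<in> \<F> U"
  then obtain T where "T \<in> \<G> U" "T \<subseteq> S" "finite (S - T)" using assms by blast
  then show "\<exists>\<T>. finite \<T> \<and> (\<forall>T\<in>\<T>. \<exists>U'. alphabet U' \<and> T \<in> \<G> U') \<and>
      \<Union>\<T> \<inter> lists V \<subseteq> S \<and> finite (S - \<Union>\<T>)"
    using \<open>alphabet U\<close> by (intro exI[of _ "{T}"]) auto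
qed

lemma EC_mono:
  assumes "\<And>U. alphabet U \<Longrightarrow> \<F> U \<subseteq> \<G> U"
  shows "EC \<F> \<subseteq> EC \<G>"
  using assms by (intro EC_subsetI1) (metis Diff_cancel finite.emptyI subsetD subset_refl)

section \<open>Regular languages\<close>

lemma conc_Nil [simp]: "{[]} \<cdot> L = L" "L \<cdot> {[]} = L"
  by (auto simp: conc_def)

lemma conc_empty [simp]: "{} \<cdot> L = {}" "L \<cdot> {} = {}"
  by (auto simp: conc_def)

lemma concI: "x \<in> K \<Longrightarrow> y \<in> L \<Longrightarrow> x @ y \<in> K \<cdot> L"
  by (auto simp: conc_def)

lemma Nil_kstar [simp]: "[] \<in> kstar L"
  by (auto simp: kstar_def image_iff intro: bexI[of _ "[]"])

lemma kstar_append: "x \<in> L \<Longrightarrow> w \<in> kstar L \<Longrightarrow> x @ w \<in> kstar L"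
proof -
  assume "x \<in> L" "w \<in> kstar L"
  then obtain ws where "ws \<in> lists L" "w = concat ws" by (auto simp: kstar_def)
  then show ?thesis using \<open>x \<in> L\<close> by (auto simp: kstar_def image_iff intro!: bexI[of _ "x # ws"])
qed

lemma kstar_induct [consumes 1, case_names Nil append]:
  assumes "w \<in> kstar L" "P []" "\<And>x w. x \<in> L \<Longrightarrow> w \<in> kstar L \<Longrightarrow> P w \<Longrightarrow> P (x @ w)"
  shows "P w"
proof -
  obtain ws where "ws \<in> lists L" "w = concat ws" using assms(1) by (auto simp: kstar_def)
  then show ?thesis
  proof (induction ws arbitrary: w)
    case (Cons x ws)
    then have "concat ws \<in> kstar L" by (auto simp: kstar_def)
    then show ?case using Cons assms(3) by auto
  qed (use assms in auto)
qed

lemma kstar_append_kstar: "x \<in> kstar L \<Longrightarrow> w \<in> kstar L \<Longrightarrow> x @ w \<in> kstar L"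
  by (induction rule: kstar_induct) (auto intro: kstar_append)

lemma kstar_subset: "w \<in> L \<Longrightarrow> w \<in> kstar L"
  using kstar_append[of w L "[]"] by simp

lemma kstar_singleton: "kstar {w} = range (wpow w)"
proof (intro equalityI subsetI)
  fix x assume "x \<in> kstar {w}" then show "x \<in> range (wpow w)"
  proof (induction rule: kstar_induct)
    case Nil show ?case by (auto simp: wpow_def image_iff intro: exI[of _ 0])
  next
    case (append x v)
    then obtain n where "v = wpow w n" "x = w" by blast
    then show ?case by (auto simp: wpow_def image_iff intro: exI[of _ "Suc n"])
  qed
next
  fix x assume "x \<in> range (wpow w)"
  then show "x \<in> kstar {w}" by (auto simp: kstar_def wpow_def in_lists_conv_set)
qed

lemma wpow_letter [simp]: "wpow [a] n = replicate n a"
  by (induction n) (auto simp: wpow_def)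

lemma wpow_0 [simp]: "wpow w 0 = []" and wpow_Suc: "wpow w (Suc n) = w @ wpow w n"
  by (auto simp: wpow_def)

lemma wpow_add: "wpow w (m + n) = wpow w m @ wpow w n"
  by (induction m) (auto simp: wpow_Suc)

lemma wpow_Suc2: "wpow w (Suc n) = wpow w n @ w"
  using wpow_add[of w n 1] by (simp add: wpow_Suc)

lemma wpow_lists [simp]: "w \<in> lists V \<Longrightarrow> wpow w n \<in> lists V"
  by (induction n) (auto simp: wpow_Suc)

lemma kstar_letter: "kstar {[a]} = range (\<lambda>n. replicate n a)"
  by (simp add: kstar_singleton)

lemma kstar_double_letter: "kstar {[a, a]} = range (\<lambda>n. replicate (2 * n) a)"
proof -
  have "wpow [a, a] n = replicate (2 * n) a" for n by (induction n) (auto simp: wpow_Suc)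
  then show ?thesis by (simp add: kstar_singleton)
qed

lemma kstar_letters: "kstar {[a] | a. a \<in> V} = lists V"
proof (intro equalityI subsetI)
  fix w assume "w \<in> lists V" then show "w \<in> kstar {[a] | a. a \<in> V}"
  proof (induction w)
    case (Cons a w)
    then show ?case using kstar_append[of "[a]" "{[a] | a. a \<in> V}" w] by auto
  qed simp
next
  fix w assume "w \<in> kstar {[a] | a. a \<in> V}" then show "w \<in> lists V"
    by (induction rule: kstar_induct) auto
qed

lemma regular_lists: "regular V L \<Longrightarrow> L \<subseteq> lists V"
proof -
  have "lang r \<subseteq> lists (atoms r)" for r :: "'a rexp"
    by (induction r) (force simp: conc_def kstar_def in_lists_conv_set)+
  then show "regular V L \<Longrightarrow> L \<subseteq> lists V" unfolding regular_def using lists_mono by blast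
qed

lemma regular_empty [simp, intro]: "regular V {}"
  unfolding regular_def by (rule exI[of _ Zero]) simp

lemma regular_Nil [simp, intro]: "regular V {[]}"
  unfolding regular_def by (rule exI[of _ "Star Zero"]) (auto simp: kstar_def)

lemma regular_letter [intro]: "a \<in> V \<Longrightarrow> regular V {[a]}"
  unfolding regular_def by (rule exI[of _ "Atom a"]) simp

lemma regular_Un [intro]: "regular V K \<Longrightarrow> regular V L \<Longrightarrow> regular V (K \<union> L)"
  unfolding regular_def by (metis Un_least rexp.set(3) lang.simps(3))

lemma regular_conc [intro]: "regular V K \<Longrightarrow> regular V L \<Longrightarrow> regular V (K \<cdot> L)"
  unfolding regular_def by (metis Un_least rexp.set(4) lang.simps(4))

lemma regular_kstar [intro]: "regular V K \<Longrightarrow> regular V (kstar K)"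
  unfolding regular_def by (metis rexp.set(5) lang.simps(5))

lemma regular_mono: "regular V L \<Longrightarrow> V \<subseteq> W \<Longrightarrow> regular W L"
  unfolding regular_def by blast

lemma regular_word: "w \<in> lists V \<Longrightarrow> regular V {w}"
proof (induction w)
  case (Cons a w)
  then have "regular V ({[a]} \<cdot> {w})" by (intro regular_conc) auto
  then show ?case by (simp add: conc_def)
qed auto

lemma regular_finite: "finite L \<Longrightarrow> L \<subseteq> lists V \<Longrightarrow> regular V L"
  by (induction rule: finite_induct) (auto intro: regular_Un[of _ "{_}", simplified] regular_word)

lemma regular_lists_self [simp, intro]: "finite V \<Longrightarrow> regular V (lists V)"
  unfolding kstar_letters[symmetric] by (intro regular_kstar regular_finite) auto

section \<open>Finitely many quotients\<close>

definition lquot :: "'a list \<Rightarrow> 'a list set \<Rightarrow> 'a list set" where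
  "lquot w L = {z. w @ z \<in> L}"

definition rquot :: "'a list \<Rightarrow> 'a list set \<Rightarrow> 'a list set" where
  "rquot w L = {z. z @ w \<in> L}"

lemma mem_lquot [simp]: "z \<in> lquot w L \<longleftrightarrow> w @ z \<in> L"
  by (simp add: lquot_def)

lemma mem_rquot [simp]: "z \<in> rquot w L \<longleftrightarrow> z @ w \<in> L"
  by (simp add: rquot_def)

lemma lquot_append: "lquot (u @ v) L = lquot v (lquot u L)"
  by auto

lemma rquot_append: "rquot (u @ v) L = rquot u (rquot v L)"
  by auto

lemma lquot_conc: "lquot w (K \<cdot> L) = lquot w K \<cdot> L \<union> \<Union>{lquot v L | v. \<exists>u. w = u @ v \<and> u \<in> K}"
  (is "?A = ?B \<union> ?C")
proof (intro equalityI subsetI)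
  fix z assume "z \<in> ?A"
  then obtain x y where xy: "w @ z = x @ y" "x \<in> K" "y \<in> L" by (auto simp: conc_def)
  from xy(1) obtain t where "w = x @ t \<and> t @ z = y \<or> w @ t = x \<and> z = t @ y"
    by (auto simp: append_eq_append_conv2)
  then show "z \<in> ?B \<union> ?C"
  proof (elim disjE conjE)
    assume "w = x @ t" "t @ z = y"
    then have "z \<in> lquot t L" using xy by simp
    then show ?thesis using \<open>w = x @ t\<close> xy by blast
  next
    assume "w @ t = x" "z = t @ y"
    then show ?thesis using xy by (auto simp: conc_def)
  qed
next
  fix z assume "z \<in> ?B \<union> ?C"
  then consider x y where "z = x @ y" "w @ x \<in> K" "y \<in> L"
    | u v where "w = u @ v" "u \<in> K" "v @ z \<in> L"
    by (auto simp: conc_def)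
  then show "z \<in> ?A"
  proof cases
    case 1 then show ?thesis by (auto simp: conc_def intro: exI[of _ "w @ x"])
  next
    case 2 then show ?thesis by (auto simp: conc_def)
  qed
qed

text \<open>A factorisation of \<open>w @ z\<close> is cut at the factor containing the last letter
  of \<open>w\<close>: \<open>u\<close> collects the factors before it, and \<open>v\<close> is its
  part inside \<open>w\<close>. For empty \<open>w\<close> there is no such factor.\<close>

lemma lquot_kstar:
  assumes "w \<noteq> []"
  shows "lquot w (kstar L) = \<Union>{lquot v L \<cdot> kstar L | v. \<exists>u. w = u @ v \<and> u \<in> kstar L}"
    (is "?A = ?B")
proof (intro equalityI subsetI)
  fix z assume "z \<in> ?A"
  then have "w @ z \<in> kstar L" by simp
  moreover have "w \<noteq> [] \<Longrightarrow> w @ z \<in> kstar L \<Longrightarrow>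
      \<exists>u v s t. w = u @ v \<and> u \<in> kstar L \<and> z = s @ t \<and> v @ s \<in> L \<and> t \<in> kstar L"
  proof (induction "length w" arbitrary: w rule: less_induct)
    case less
    obtain x y where xy: "w @ z = x @ y" "x \<in> L" "y \<in> kstar L" "x \<noteq> []"
    proof -
      have "\<exists>x y. p = x @ y \<and> x \<in> L \<and> y \<in> kstar L \<and> x \<noteq> []" if "p \<in> kstar L" "p \<noteq> []" for p
        using that
      proof (induction rule: kstar_induct)
        case (append x w) then show ?case by (cases "x = []") auto
      qed simp
      then show ?thesis using less.prems that by (metis Nil_is_append_conv)
    qed
    from xy(1) obtain t where "w = x @ t \<and> t @ z = y \<or> w @ t = x \<and> z = t @ y"
      by (auto simp: append_eq_append_conv2)
    then consider (inside) "w @ t = x" "z = t @ y" | (after) "w = x @ t" "t @ z = y" "t \<noteq> []"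
      | (exact) "w = x" "z = y"
      by (cases "t = []") auto
    then show ?case
    proof cases
      case inside
      then show ?thesis using xy by (intro exI[of _ "[]"] exI[of _ w] exI[of _ t] exI[of _ y]) auto
    next
      case exact
      then show ?thesis using xy
        by (intro exI[of _ "[]"] exI[of _ w] exI[of _ "[]"] exI[of _ y]) auto
    next
      case after
      then have "length t < length w" "t @ z \<in> kstar L" using xy by auto
      then obtain u v s s' where "t = u @ v" "u \<in> kstar L" "z = s @ s'" "v @ s \<in> L" "s' \<in> kstar L"
        using less.hyps after(3) by blast
      then show ?thesis using after xy kstar_append[of x L u]
        by (intro exI[of _ "x @ u"] exI[of _ v] exI[of _ s] exI[of _ s']) auto
    qed
  qed
  ultimately obtain u v s t where "w = u @ v" "u \<in> kstar L" "z = s @ t" "v @ s \<in> L" "t \<in> kstar L"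
    using assms by meson
  then have "z \<in> lquot v L \<cdot> kstar L" by (auto simp: conc_def)
  then show "z \<in> ?B" using \<open>w = u @ v\<close> \<open>u \<in> kstar L\<close> by blast
next
  fix z assume "z \<in> ?B"
  then obtain u v s t where "w = u @ v" "u \<in> kstar L" "z = s @ t" "v @ s \<in> L" "t \<in> kstar L"
    by (auto simp: conc_def)
  then have "u @ (v @ s) @ t \<in> kstar L" by (intro kstar_append_kstar kstar_append)
  then show "z \<in> ?A" using \<open>w = u @ v\<close> \<open>z = s @ t\<close> by simp
qed

text \<open>One half of the Myhill-Nerode theorem, by induction on the expression and without
  automata: a quotient of a compound language is determined by a quotient, or by a set of quotients,
  of its parts.\<close>

lemma finite_lquots: "regular V L \<Longrightarrow> finite (range (\<lambda>w. lquot w L))"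
proof -
  have "finite (range (\<lambda>w. lquot w (lang r)))" for r :: "'a rexp"
  proof (induction r)
    case Zero
    have "range (\<lambda>w. lquot w (lang Zero)) \<subseteq> {{}}" by auto
    then show ?case by (rule finite_subset) simp
  next
    case (Atom a)
    have "lquot w {[a]} \<in> {{[a]}, {[]}, {}}" for w
      by (cases w; cases "tl w"; cases "hd w = a") (auto simp: lquot_def)
    then have "range (\<lambda>w. lquot w (lang (Atom a))) \<subseteq> {{[a]}, {[]}, {}}" by auto
    then show ?case by (rule finite_subset) simp
  next
    case (Union r s)
    have "lquot w (lang (Union r s)) = (\<lambda>(A, B). A \<union> B) (lquot w (lang r), lquot w (lang s))" for w
      by auto
    then have "range (\<lambda>w. lquot w (lang (Union r s))) \<subseteq>
        (\<lambda>(A, B). A \<union> B) ` (range (\<lambda>w. lquot w (lang r)) \<times> range (\<lambda>w. lquot w (lang s)))"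
      by (intro image_subsetI image_eqI[rotated]) auto
    then show ?case by (rule finite_subset) (use Union in simp)
  next
    case (Times r s)
    have "range (\<lambda>w. lquot w (lang (Times r s))) \<subseteq>
        (\<lambda>(A, \<B>). A \<cdot> lang s \<union> \<Union>\<B>) `
          (range (\<lambda>w. lquot w (lang r)) \<times> Pow (range (\<lambda>w. lquot w (lang s))))"
    proof clarify
      fix w
      show "lquot w (lang (Times r s)) \<in> (\<lambda>(A, \<B>). A \<cdot> lang s \<union> \<Union>\<B>) `
          (range (\<lambda>w. lquot w (lang r)) \<times> Pow (range (\<lambda>w. lquot w (lang s))))"
        unfolding lang.simps lquot_conc
        by (rule image_eqI[of _ _ "(lquot w (lang r),
            {lquot v (lang s) | v. \<exists>u. w = u @ v \<and> u \<in> lang r})"]) auto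
    qed
    then show ?case by (rule finite_subset) (use Times in simp)
  next
    case (Star r)
    let ?P = "Pow ((\<lambda>A. A \<cdot> kstar (lang r)) ` range (\<lambda>w. lquot w (lang r)))"
    have "lquot w (lang (Star r)) \<in> insert (kstar (lang r)) (Sup ` ?P)" for w
    proof (cases "w = []")
      case True then show ?thesis by (simp add: lquot_def)
    next
      case False
      have "{lquot v (lang r) \<cdot> kstar (lang r) | v. \<exists>u. w = u @ v \<and> u \<in> kstar (lang r)} \<in> ?P"
        by auto
      then show ?thesis using lquot_kstar[OF False, of "lang r"] by (auto simp del: Pow_iff)
    qed
    then have "range (\<lambda>w. lquot w (lang (Star r))) \<subseteq> insert (kstar (lang r)) (Sup ` ?P)" by blast
    then show ?case by (rule finite_subset) (use Star in simp)
  qed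
  then show "regular V L \<Longrightarrow> finite (range (\<lambda>w. lquot w L))" by (auto simp: regular_def)
qed

text \<open>A right quotient by \<open>w\<close> is determined by the set of left quotients that
  contain \<open>w\<close>, so no reversal of expressions is required.\<close>

lemma finite_rquots:
  assumes "regular V L"
  shows "finite (range (\<lambda>w. rquot w L))"
proof -
  let ?D = "range (\<lambda>w. lquot w L)"
  have "rquot w L = {z. lquot z L \<in> {Q \<in> ?D. w \<in> Q}}" for w
    by (auto simp only: mem_rquot mem_lquot mem_Collect_eq)
  then have "range (\<lambda>w. rquot w L) \<subseteq> (\<lambda>\<Q>. {z. lquot z L \<in> \<Q>}) ` Pow ?D"
    by (intro image_subsetI image_eqI[rotated, of "{Q \<in> ?D. _ \<in> Q}"]) auto
  then show ?thesis by (rule finite_subset) (simp add: finite_lquots[OF assms])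
qed

text \<open>Pigeonhole on the orbit of \<open>s\<close>, meant for quotients as states and a fixed
  word as the step. A state at index \<open>card D\<close> or later lies on the cycle of the orbit
  and therefore recurs beyond every \<open>N\<close>.\<close>

lemma funpow_repeat:
  fixes f :: "'s \<Rightarrow> 's"
  assumes "finite D" "\<And>i. (f ^^ i) s \<in> D"
  shows "\<exists>i < card D. (f ^^ i) s = (f ^^ n) s"
    and "card D \<le> n \<Longrightarrow> \<exists>m \<ge> N. (f ^^ m) s = (f ^^ n) s"
proof -
  \<comment> \<open>The least index of this state: a repetition up to it would yield a smaller
    one.\<close>
  define i where "i = (LEAST i. (f ^^ i) s = (f ^^ n) s)"
  have i: "(f ^^ i) s = (f ^^ n) s" unfolding i_def by (rule LeastI) simp
  have "inj_on (\<lambda>j. (f ^^ j) s) {..i}"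
  proof (rule linorder_inj_onI)
    fix j k assume jk: "j < k" "j \<in> {..i}" "k \<in> {..i}"
    show "(f ^^ j) s \<noteq> (f ^^ k) s"
    proof
      assume "(f ^^ j) s = (f ^^ k) s"
      then have "(f ^^ (i - k + j)) s = (f ^^ (i - k + k)) s" by (simp add: funpow_add)
      then have "(f ^^ (i - k + j)) s = (f ^^ n) s" using i jk by simp
      then have "i \<le> i - k + j" unfolding i_def by (rule Least_le)
      then show False using jk by auto
    qed
  qed auto
  then have "card {..i} \<le> card D" using assms by (intro card_inj_on_le) auto
  then show "\<exists>i < card D. (f ^^ i) s = (f ^^ n) s" using i by (intro exI[of _ i]) auto
next
  assume n: "card D \<le> n"
  have "\<not> inj_on (\<lambda>j. (f ^^ j) s) {..n}"
  proof
    assume "inj_on (\<lambda>j. (f ^^ j) s) {..n}"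
    then have "card {..n} \<le> card D" using assms by (intro card_inj_on_le) auto
    then show False using n by simp
  qed
  then obtain j k where jk: "j < k" "k \<le> n" "(f ^^ j) s = (f ^^ k) s"
    unfolding inj_on_def by (metis atMost_iff linorder_neqE_nat)
  have "(f ^^ (n + m * (k - j))) s = (f ^^ n) s" for m
  proof (induction m)
    case (Suc m)
    define r where "r = n - k + m * (k - j) + (k - j)"
    have "n + Suc m * (k - j) = r + k" "n + m * (k - j) = r + j" using jk by (auto simp: r_def)
    then have "(f ^^ (n + Suc m * (k - j))) s = (f ^^ (n + m * (k - j))) s"
      by (simp only: funpow_add o_apply jk(3))
    then show ?case using Suc by simp
  qed simp
  moreover from jk have "N \<le> N * (k - j)" by (cases "k - j") auto
  then have "N \<le> n + N * (k - j)" by (rule trans_le_add2)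
  ultimately show "\<exists>m \<ge> N. (f ^^ m) s = (f ^^ n) s" by blast
qed

lemma lquot_wpow: "lquot (wpow x n) L = (lquot x ^^ n) L"
  by (induction n) (auto simp: wpow_Suc2 lquot_append)

lemma rquot_wpow: "rquot (wpow x n) L = (rquot x ^^ n) L"
  by (induction n) (auto simp: wpow_Suc rquot_append)

text \<open>The bound does not depend on \<open>x\<close>; power separation asks for exactly this
  uniformity.\<close>

lemma lquot_wpow_repeat:
  assumes "regular V L"
  shows "\<exists>i < card (range (\<lambda>w. lquot w L)). lquot (wpow x i) L = lquot (wpow x n) L"
  unfolding lquot_wpow
  by (rule funpow_repeat(1)[OF finite_lquots[OF assms]]) (metis lquot_wpow rangeI)

lemma rquot_wpow_repeat:
  assumes "regular V L"
  shows "\<exists>i < card (range (\<lambda>w. rquot w L)). rquot (wpow x i) L = rquot (wpow x n) L"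
  unfolding rquot_wpow
  by (rule funpow_repeat(1)[OF finite_rquots[OF assms]]) (metis rquot_wpow rangeI)

text \<open>Supplies an arbitrarily late power in \<open>L\<close>, from which closure under
  prefixes or suffixes descends to any power wanted.\<close>

lemma regular_pump:
  assumes "regular V L"
  obtains m where "m \<ge> 1" "\<And>x n N. n \<ge> m \<Longrightarrow> wpow x n \<in> L \<Longrightarrow> \<exists>k \<ge> N. wpow x k \<in> L"
proof
  let ?m = "Suc (card (range (\<lambda>w. lquot w L)))"
  show "?m \<ge> 1" by simp
  fix x n N assume n: "n \<ge> ?m" and L: "wpow x n \<in> L"
  have "\<exists>k \<ge> N. (lquot x ^^ k) L = (lquot x ^^ n) L"
    by (rule funpow_repeat(2)[OF finite_lquots[OF assms]]) (use n in \<open>auto simp: lquot_wpow[symmetric]\<close>)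
  then obtain k where "k \<ge> N" "lquot (wpow x k) L = lquot (wpow x n) L"
    unfolding lquot_wpow by blast
  then show "\<exists>k \<ge> N. wpow x k \<in> L" using L by (metis append_Nil2 mem_lquot)
qed

section \<open>Ordered languages\<close>

text \<open>A right-congruence form of ordered automata, with \<open>f w\<close> in the role of the
  state reached by \<open>w\<close>. As states have to be natural numbers, the finitely many values
  of \<open>f\<close> are replaced by their ranks, which keeps their order.\<close>

lemma orderedI:
  fixes f :: "'a list \<Rightarrow> 's::linorder"
  assumes fin: "finite (f ` lists V)"
    and mono: "\<And>w w' a. w \<in> lists V \<Longrightarrow> w' \<in> lists V \<Longrightarrow> a \<in> V \<Longrightarrow> f w \<le> f w' \<Longrightarrow>
      f (w @ [a]) \<le> f (w' @ [a])"
    and L: "L \<subseteq> lists V"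
    and sat: "\<And>w w'. w \<in> L \<Longrightarrow> w' \<in> lists V \<Longrightarrow> f w = f w' \<Longrightarrow> w' \<in> L"
  shows "ordered V L"
proof -
  define D where "D = f ` lists V"
  define rk where "rk s = card {t \<in> D. t < s}" for s
  have finD: "finite D" using fin by (simp add: D_def)
  have rk_less: "rk s < rk t" if "s \<in> D" "s < t" for s t
    unfolding rk_def using that finD by (intro psubset_card_mono) auto
  have rk_le: "rk s \<le> rk t \<longleftrightarrow> s \<le> t" if "s \<in> D" "t \<in> D" for s t
    using rk_less[of s t] rk_less[of t s] that by (cases s t rule: linorder_cases) auto
  have rk_eq: "rk s = rk t \<longleftrightarrow> s = t" if "s \<in> D" "t \<in> D" for s t
    using rk_le[OF that] rk_le[of t s] that by (auto simp: order.antisym)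
  \<comment> \<open>A representative word for each state. Transitions do not depend on the choice:
    \<open>mono\<close> in both directions keeps equal values equal after one more letter.\<close>
  define g where "g z = (SOME w. w \<in> lists V \<and> rk (f w) = z)" for z
  define \<delta> where "\<delta> z a = rk (f (g z @ [a]))" for z a
  define Z where "Z = rk ` D"
  have fD: "f w \<in> D" if "w \<in> lists V" for w using that by (simp add: D_def)
  have g: "g z \<in> lists V" "rk (f (g z)) = z" if "z \<in> Z" for z
  proof -
    have "\<exists>w. w \<in> lists V \<and> rk (f w) = z" using that by (auto simp: Z_def D_def)
    then have "g z \<in> lists V \<and> rk (f (g z)) = z" unfolding g_def by (rule someI_ex)
    then show "g z \<in> lists V" "rk (f (g z)) = z" by auto
  qed
  have mono': "(f (w @ [a])) = f (w' @ [a])"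
    if "w \<in> lists V" "w' \<in> lists V" "a \<in> V" "f w = f w'" for w w' a
    using mono[of w w' a] mono[of w' w a] that by (simp add: order.antisym)
  have \<delta>: "\<delta> (rk (f w)) a = rk (f (w @ [a]))" if "w \<in> lists V" "a \<in> V" for w a
  proof -
    have "rk (f w) \<in> Z" using fD[OF that(1)] by (simp add: Z_def)
    then have "f (g (rk (f w))) = f w" using g rk_eq fD that(1) by blast
    then show ?thesis unfolding \<delta>_def using mono' g(1) \<open>rk (f w) \<in> Z\<close> that by metis
  qed
  have run: "foldl \<delta> (rk (f [])) w = rk (f w)" if "w \<in> lists V" for w
    using that by (induction w rule: rev_induct) (auto simp: \<delta>)
  define F where "F = rk ` f ` L"
  define r where "r = {(x, y). x \<in> Z \<and> y \<in> Z \<and> x \<le> y}"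
  have "dfa V Z (rk (f [])) F \<delta>"
    unfolding dfa_def
  proof (intro conjI ballI)
    show "finite Z" using finD by (simp add: Z_def)
    show "rk (f []) \<in> Z" using fD[of "[]"] by (simp add: Z_def)
    show "F \<subseteq> Z" using L by (auto simp: F_def Z_def intro!: imageI fD)
    show "\<delta> z a \<in> Z" if "z \<in> Z" "a \<in> V" for z a
      using g(1)[OF \<open>z \<in> Z\<close>] \<open>a \<in> V\<close> unfolding \<delta>_def Z_def by (intro imageI fD) auto
  qed
  moreover have "L = accepted V (rk (f [])) F \<delta>"
  proof (intro equalityI subsetI)
    fix w assume "w \<in> L" then show "w \<in> accepted V (rk (f [])) F \<delta>"
      using L run[of w] by (auto simp: accepted_def F_def simp del: in_lists_conv_set)
  next
    fix w assume "w \<in> accepted V (rk (f [])) F \<delta>"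
    then have w: "w \<in> lists V" "rk (f w) \<in> rk ` f ` L" using run[of w] by (simp_all add: accepted_def F_def)
    then obtain w' where "w' \<in> L" "rk (f w) = rk (f w')" by auto
    then show "w \<in> L" using sat rk_eq fD w(1) L by (metis subsetD)
  qed
  moreover have "linear_order_on Z r"
    by (auto simp: linear_order_on_def partial_order_on_def preorder_on_def r_def
        refl_on_def trans_def antisym_def total_on_def)
  moreover have "(\<delta> z a, \<delta> z' a) \<in> r" if "(z, z') \<in> r" "a \<in> V" for z z' a
  proof -
    have z: "z \<in> Z" "z' \<in> Z" "z \<le> z'" using that by (auto simp: r_def)
    note gz = g[OF z(1)] g[OF z(2)]
    have "f (g z) \<le> f (g z')" using z gz rk_le[of "f (g z)" "f (g z')"] fD by simp
    then have "f (g z @ [a]) \<le> f (g z' @ [a])" using mono gz \<open>a \<in> V\<close> by blast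
    moreover have "f (g z @ [a]) \<in> D" "f (g z' @ [a]) \<in> D" using gz \<open>a \<in> V\<close> by (auto intro!: fD)
    ultimately show ?thesis using rk_le by (auto simp: \<delta>_def r_def Z_def)
  qed
  ultimately show ?thesis unfolding ordered_def by blast
qed

text \<open>The rank of the reached state serves as \<open>f\<close>. This turns the arbitrary order
  on \<open>Z\<close> into that of the natural numbers, where chains can be counted.\<close>

lemma orderedE:
  assumes "ordered V L"
  obtains f :: "'a list \<Rightarrow> nat" and N where
    "\<And>w. w \<in> lists V \<Longrightarrow> f w \<le> N"
    "\<And>w w' t. w \<in> lists V \<Longrightarrow> w' \<in> lists V \<Longrightarrow> t \<in> lists V \<Longrightarrow> f w \<le> f w' \<Longrightarrow>
      f (w @ t) \<le> f (w' @ t)"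
    "L \<subseteq> lists V"
    "\<And>w w'. w \<in> L \<Longrightarrow> w' \<in> lists V \<Longrightarrow> f w = f w' \<Longrightarrow> w' \<in> L"
proof -
  obtain Z z0 F \<delta> r where dfa: "dfa V Z z0 F \<delta>" and L: "L = accepted V z0 F \<delta>"
    and lin: "linear_order_on Z r"
    and mono: "\<And>z z' a. (z, z') \<in> r \<Longrightarrow> a \<in> V \<Longrightarrow> (\<delta> z a, \<delta> z' a) \<in> r"
    using assms unfolding ordered_def by blast
  have finZ: "finite Z" using dfa by (simp add: dfa_def)
  have "refl_on Z r" "total_on Z r" and r: "trans r" "antisym r"
    using lin by (simp_all add: linear_order_on_def partial_order_on_def preorder_on_def)
  then have refl: "(z, z) \<in> r" if "z \<in> Z" for z
    using that by (simp add: refl_on_def)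
  have total: "(x, y) \<in> r \<or> (y, x) \<in> r" if "x \<in> Z" "y \<in> Z" for x y
    using \<open>total_on Z r\<close> refl that unfolding total_on_def by (cases "x = y") blast+
  define rk where "rk z = card {y \<in> Z. (y, z) \<in> r}" for z
  have rk_mono: "rk x \<le> rk y" if "(x, y) \<in> r" for x y
    unfolding rk_def using finZ that r(1) by (intro card_mono) (auto dest: transD)
  have rk_le: "rk x \<le> rk y \<longleftrightarrow> (x, y) \<in> r" if "x \<in> Z" "y \<in> Z" for x y
  proof
    assume le: "rk x \<le> rk y"
    show "(x, y) \<in> r"
    proof (rule ccontr)
      assume n: "(x, y) \<notin> r"
      then have yx: "(y, x) \<in> r" using total that by blast
      then have "{z \<in> Z. (z, y) \<in> r} \<subseteq> {z \<in> Z. (z, x) \<in> r}" using r(1) by (auto dest: transD)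
      then have "{z \<in> Z. (z, y) \<in> r} \<subset> {z \<in> Z. (z, x) \<in> r}"
        using n refl[OF that(1)] that(1) by blast
      then have "rk y < rk x" unfolding rk_def using finZ by (intro psubset_card_mono) auto
      then show False using le by simp
    qed
  qed (rule rk_mono)
  have rk_eq: "rk x = rk y \<longleftrightarrow> x = y" if "x \<in> Z" "y \<in> Z" for x y
    using rk_le[OF that] rk_le[OF that(2,1)] antisymD[OF r(2), of x y] by auto
  define run where "run w = foldl \<delta> z0 w" for w
  have runZ: "run w \<in> Z" if "w \<in> lists V" for w
    using that dfa by (induction w rule: rev_induct) (auto simp: run_def dfa_def)
  have mono': "(run (w @ t), run (w' @ t)) \<in> r" if "(run w, run w') \<in> r" "t \<in> lists V" for w w' t
    using that(2)
  proof (induction t rule: rev_induct)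
    case (snoc a t)
    then have "(\<delta> (run (w @ t)) a, \<delta> (run (w' @ t)) a) \<in> r" by (intro mono) auto
    then show ?case by (simp add: run_def)
  qed (use that in simp)
  show ?thesis
  proof (rule that[of "\<lambda>w. rk (run w)" "card Z"])
    show "rk (run w) \<le> card Z" for w unfolding rk_def using finZ by (intro card_mono) auto
    show "rk (run (w @ t)) \<le> rk (run (w' @ t))"
      if "w \<in> lists V" "w' \<in> lists V" "t \<in> lists V" "rk (run w) \<le> rk (run w')" for w w' t
      using mono'[of w w' t] rk_le rk_mono runZ that by simp
    show "L \<subseteq> lists V" by (auto simp: L accepted_def)
    show "w' \<in> L" if "w \<in> L" "w' \<in> lists V" "rk (run w) = rk (run w')" for w w'
      using that rk_eq[of "run w" "run w'"] runZ by (auto simp: L accepted_def run_def)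
  qed
qed

section \<open>Inclusions\<close>

lemma fam_regular:
  assumes "alphabet V" "L \<in> fam X V"
  shows "regular V L"
  using assms by (cases X) (auto simp: alphabet_def intro: regular_finite, auto simp: regular_def)

lemma EC_fam_REG: "EC (fam X) \<subseteq> EC (fam F_REG)"
  by (rule EC_mono) (auto dest: fam_regular)

text \<open>Besides the inclusions of \<open>F_MON\<close>, this supplies the selection language by
  which marked languages grow their inner words.\<close>

lemma lists_self_fam:
  assumes "alphabet V" "X \<notin> {F_FIN, F_COMB, F_UF}"
  shows "lists V \<in> fam X V"
proof -
  have fin: "finite V" using assms by (simp add: alphabet_def)
  have reg: "regular V (lists V)" using fin by simp
  have letters: "regular V {[a] | a. a \<in> V}" "lists V = kstar {[a] | a. a \<in> V}"
    "{[a] | a. a \<in> V} \<notin> {{}, {[]}}"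
    using assms fin by (auto simp: kstar_letters alphabet_def intro!: regular_finite)
  have mset: "y \<in> lists V" if "mset y = mset x" "x \<in> lists V" for x y :: "'a list"
    using that mset_eq_setD by (fastforce simp: in_lists_conv_set)
  have "(\<lambda>w. 0::nat) ` lists V \<subseteq> {0}" by auto
  then have "finite ((\<lambda>w. 0::nat) ` lists V)" by (rule finite_subset) simp
  then have ord: "ordered V (lists V)" by (rule orderedI) auto
  show ?thesis
  proof (cases X)
    case F_DEF then show ?thesis using reg
      by (auto intro!: exI[of _ "{}"] exI[of _ "{[]}"])
  next
    case F_SYDEF then show ?thesis using reg
      by (auto intro!: exI[of _ "{[]}"])
  next
    case F_NC
    have "\<exists>k\<ge>1. \<forall>x\<in>lists V. \<forall>y\<in>lists V. \<forall>z\<in>lists V.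
        x @ wpow y k @ z \<in> lists V \<longleftrightarrow> x @ wpow y (k + 1) @ z \<in> lists V"
      by (intro exI[of _ 1]) (simp del: in_lists_conv_set)
    then show ?thesis using reg unfolding F_NC fam.simps mem_Collect_eq by (rule conjI[rotated])
  next
    case F_PS
    have "{wpow x n | n. n \<ge> 1} \<subseteq> lists V" if "x \<in> lists V" for x
      using wpow_lists[OF that] by blast
    then have "\<exists>m\<ge>1. \<forall>x\<in>lists V.
        {wpow x n | n. n \<ge> m} \<inter> lists V = {} \<or> {wpow x n | n. n \<ge> m} \<subseteq> lists V"
      by (intro exI[of _ 1]) (simp del: in_lists_conv_set)
    then show ?thesis using reg unfolding F_PS fam.simps mem_Collect_eq by (rule conjI[rotated])
  next
    case F_COMM
    have "\<forall>x\<in>lists V. \<forall>y. mset y = mset x \<longrightarrow> y \<in> lists V" using mset by (intro ballI allI impI)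
    then show ?thesis using reg F_COMM by (simp del: in_lists_conv_set)
  next
    case F_STAR then show ?thesis using reg letters by auto
  next
    case F_LCOM
    have "\<exists>E G. regular V E \<and> regular V G \<and> G \<notin> {{}, {[]}} \<and> lists V = E \<cdot> kstar G"
      using letters by (intro exI[of _ "{[]}"] exI[of _ "{[a] | a. a \<in> V}"]) simp
    then show ?thesis using reg F_LCOM by simp
  next
    case F_RCOM
    have "\<exists>G H. regular V G \<and> regular V H \<and> G \<notin> {{}, {[]}} \<and> lists V = kstar G \<cdot> H"
      using letters by (intro exI[of _ "{[a] | a. a \<in> V}"] exI[of _ "{[]}"]) simp
    then show ?thesis using reg F_RCOM by simp
  next
    case F_2COM
    have "\<exists>E G H. regular V E \<and> regular V G \<and> regular V H \<and> G \<notin> {{}, {[]}} \<and>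
        lists V = E \<cdot> kstar G \<cdot> H"
      using letters by (intro exI[of _ "{[]}"] exI[of _ "{[a] | a. a \<in> V}"] exI[of _ "{[]}"]) simp
    then show ?thesis using reg F_2COM by simp
  qed (use assms reg ord in \<open>auto simp: in_lists_conv_set\<close>)
qed

lemma finite_in_EC:
  assumes "finite L"
  shows "L \<in> EC \<F>"
proof -
  have "x \<in> L" if "x \<in> gen L {}" for x using that by induction auto
  then have "gen L {} = L" by (auto intro: gen.intros)
  then show ?thesis unfolding EC_iff using assms by (metis rules_def finite.emptyI empty_iff)
qed

text \<open>However long a derivation is, its last step starts from one of finitely many
  words.\<close>

lemma EC_FIN_finite:
  assumes "L \<in> EC (fam F_FIN)"
  shows "finite L"
proof -
  obtain A R where "finite A" and R: "rules (fam F_FIN) R" and L: "L = gen A R"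
    using assms by (rule ECE)
  have "L \<subseteq> A \<union> (\<Union>(S, u, v)\<in>R. (\<lambda>x. u @ x @ v) ` S)"
  proof
    fix z assume "z \<in> L"
    then have "z \<in> gen A R" by (simp add: L)
    then show "z \<in> A \<union> (\<Union>(S, u, v)\<in>R. (\<lambda>x. u @ x @ v) ` S)" by cases fast+
  qed
  moreover have "finite \<dots>" using \<open>finite A\<close> R by (auto simp: rules_def)
  ultimately show ?thesis by (rule finite_subset)
qed

lemma EC_FIN_MON: "EC (fam F_FIN) \<subseteq> EC (fam F_MON)"
  using EC_FIN_finite finite_in_EC by blast

lemma EC_MON_subset:
  assumes "X \<notin> {F_FIN, F_COMB, F_UF}"
  shows "EC (fam F_MON) \<subseteq> EC (fam X)"
  by (rule EC_mono) (use assms in \<open>auto intro!: lists_self_fam\<close>)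

text \<open>No \<open>F_COMB\<close> language contains the empty word, so \<open>lists U\<close> is
  replaced by its non-empty words; steps from \<open>[]\<close> turn into axioms.\<close>

lemma EC_MON_COMB: "EC (fam F_MON) \<subseteq> EC (fam F_COMB)"
proof (rule EC_subsetI1)
  fix U and S :: "'a list set" assume U: "alphabet U" and "S \<in> fam F_MON U"
  then have S: "S = lists U" by simp
  let ?T = "lists U \<cdot> {[a] | a. a \<in> U}"
  have "regular U {[a] | a. a \<in> U}" using U by (auto simp: alphabet_def intro!: regular_finite)
  then have "?T \<in> fam F_COMB U" using U by (auto simp: alphabet_def)
  moreover have "?T \<subseteq> S" unfolding S by (rule conc_lists) auto
  moreover have "w \<in> insert [] ?T" if "w \<in> lists U" for w
    using that by (cases w rule: rev_cases) (auto simp: conc_def)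
  then have "S - ?T \<subseteq> {[]}" unfolding S by blast
  then have "finite (S - ?T)" by (rule finite_subset) simp
  ultimately show "\<exists>T. T \<in> fam F_COMB U \<and> T \<subseteq> S \<and> finite (S - T)" by blast
qed

lemma EC_COMB_DEF: "EC (fam F_COMB) \<subseteq> EC (fam F_DEF)"
proof (rule EC_mono)
  fix U :: "'a set" assume U: "alphabet U"
  show "fam F_COMB U \<subseteq> fam F_DEF U"
  proof
    fix S assume "S \<in> fam F_COMB U"
    then obtain X where X: "X \<subseteq> U" "S = lists U \<cdot> {[a] | a. a \<in> X}" "regular U S" by auto
    have "finite X" using X U finite_subset by (auto simp: alphabet_def)
    then have "finite {[a] | a. a \<in> X}" "{[a] | a. a \<in> X} \<subseteq> lists U" using X by auto
    then have "\<exists>A B. finite A \<and> A \<subseteq> lists U \<and> finite B \<and> B \<subseteq> lists U \<and> S = A \<union> lists U \<cdot> B"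
      using X by (intro exI[of _ "{}"] exI[of _ "{[a] | a. a \<in> X}"]) simp
    then show "S \<in> fam F_DEF U" using X by simp
  qed
qed

text \<open>The product form shows both regularity and definiteness of the long words.\<close>

lemma long_words: "lists U \<cdot> {w \<in> lists U. length w = n} = {w \<in> lists U. n \<le> length w}"
proof (intro equalityI subsetI)
  fix w assume "w \<in> {w \<in> lists U. n \<le> length w}"
  then have "w = take (length w - n) w @ drop (length w - n) w"
    "take (length w - n) w \<in> lists U" "drop (length w - n) w \<in> lists U"
    "length (drop (length w - n) w) = n"
    by (auto dest: in_set_takeD in_set_dropD)
  then show "w \<in> lists U \<cdot> {w \<in> lists U. length w = n}" unfolding conc_def by blast
qed (auto simp: conc_def)

lemma finite_words_length:
  "finite U \<Longrightarrow> finite {w \<in> lists U. length w = n}" "finite U \<Longrightarrow> finite {w \<in> lists U. length w < n}"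
proof -
  assume U: "finite U"
  have "{w \<in> lists U. length w = n} \<subseteq> {w. set w \<subseteq> U \<and> length w \<le> n}"
    "{w \<in> lists U. length w < n} \<subseteq> {w. set w \<subseteq> U \<and> length w \<le> n}" by auto
  then show "finite {w \<in> lists U. length w = n}" "finite {w \<in> lists U. length w < n}"
    using finite_lists_length_le[OF U] finite_subset by blast+
qed

lemma regular_long_words: "finite U \<Longrightarrow> regular U {w \<in> lists U. n \<le> length w}"
  unfolding long_words[symmetric]
  by (intro regular_conc regular_lists_self regular_finite finite_words_length) auto

lemma finite_lengths_bounded:
  assumes "finite L"
  obtains n where "\<And>w. w \<in> L \<Longrightarrow> length w < n"
proof -
  have "finite (length ` L)" using assms by simp
  then obtain n where "\<And>k. k \<in> length ` L \<Longrightarrow> k < n"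
    by (metis finite_nat_set_iff_bounded)
  then show ?thesis using that by blast
qed

lemma EC_NIL_DEF: "EC (fam F_NIL) \<subseteq> EC (fam F_DEF)"
proof (rule EC_mono)
  fix U :: "'a set" assume U: "alphabet U"
  show "fam F_NIL U \<subseteq> fam F_DEF U"
  proof
    fix S assume "S \<in> fam F_NIL U"
    then have reg: "regular U S" and "finite S \<or> finite (lists U - S)" by auto
    note sub = regular_lists[OF reg]
    from \<open>finite S \<or> finite (lists U - S)\<close>
    have "\<exists>A B. finite A \<and> A \<subseteq> lists U \<and> finite B \<and> B \<subseteq> lists U \<and> S = A \<union> lists U \<cdot> B"
    proof
      assume "finite S"
      then show ?thesis using sub by (intro exI[of _ S] exI[of _ "{}"]) simp
    next
      assume "finite (lists U - S)"
      then obtain n where n: "\<And>w. w \<in> lists U - S \<Longrightarrow> length w < n"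
        using finite_lengths_bounded by blast
      have "{w \<in> S. length w < n} \<subseteq> {w \<in> lists U. length w < n}" using sub by blast
      then have "finite {w \<in> S. length w < n}"
        by (rule finite_subset) (use U in \<open>simp add: alphabet_def finite_words_length\<close>)
      moreover have "S = {w \<in> S. length w < n} \<union> lists U \<cdot> {w \<in> lists U. length w = n}"
      proof -
        have "w \<in> S" if "w \<in> lists U" "n \<le> length w" for w using n[of w] that by fastforce
        then show ?thesis unfolding long_words using sub by fastforce
      qed
      ultimately show ?thesis using sub U finite_words_length(1)
        by (intro exI[of _ "{w \<in> S. length w < n}"] exI[of _ "{w \<in> lists U. length w = n}"])
          (auto simp: alphabet_def simp del: in_lists_conv_set)
    qed
    then show "S \<in> fam F_DEF U" using reg by simp
  qed
qed

text \<open>Beyond the last exception, membership depends on the length alone, and permutations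
  preserve it.\<close>

lemma EC_NIL_COMM: "EC (fam F_NIL) \<subseteq> EC (fam F_COMM)"
proof (rule EC_subsetI1)
  fix U and S :: "'a list set" assume U: "alphabet U" and "S \<in> fam F_NIL U"
  then have reg: "regular U S" and "finite S \<or> finite (lists U - S)" by auto
  then show "\<exists>T. T \<in> fam F_COMM U \<and> T \<subseteq> S \<and> finite (S - T)"
  proof (elim disjE)
    assume "finite S" then show ?thesis by (intro exI[of _ "{}"]) auto
  next
    assume "finite (lists U - S)"
    then obtain n where n: "\<And>w. w \<in> lists U - S \<Longrightarrow> length w < n"
      using finite_lengths_bounded by blast
    let ?T = "{w \<in> lists U. n \<le> length w}"
    have "regular U ?T" using U regular_long_words by (auto simp: alphabet_def)
    moreover have "\<forall>x\<in>?T. \<forall>y. mset y = mset x \<longrightarrow> y \<in> ?T"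
      by (auto simp: in_lists_conv_set dest: mset_eq_length mset_eq_setD)
    ultimately have "?T \<in> fam F_COMM U" by (simp del: in_lists_conv_set mem_Collect_eq) blast
    moreover have "?T \<subseteq> S" using n by force
    moreover have "S - ?T \<subseteq> {w \<in> lists U. length w < n}" using regular_lists[OF reg] by auto
    then have "finite (S - ?T)"
      by (rule finite_subset) (use U in \<open>simp add: alphabet_def finite_words_length\<close>)
    ultimately show ?thesis by blast
  qed
qed

lemma EC_DEF_SYDEF: "EC (fam F_DEF) \<subseteq> EC (fam F_SYDEF)"
proof (rule EC_subsetI1)
  fix U and S :: "'a list set" assume U: "alphabet U" and "S \<in> fam F_DEF U"
  then obtain A B where AB: "finite A" "finite B" "B \<subseteq> lists U" "S = A \<union> lists U \<cdot> B" by auto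
  have "regular U B" using AB by (intro regular_finite)
  moreover from this have "regular U (lists U \<cdot> B)" using U by (auto simp: alphabet_def)
  moreover have "lists U \<cdot> B = {[]} \<cdot> lists U \<cdot> B" by simp
  ultimately have "lists U \<cdot> B \<in> fam F_SYDEF U"
    unfolding fam.simps by blast
  moreover have "finite (S - lists U \<cdot> B)" using AB by (auto intro: finite_subset[of _ A])
  ultimately show "\<exists>T. T \<in> fam F_SYDEF U \<and> T \<subseteq> S \<and> finite (S - T)" using AB by blast
qed

lemma take_mono_lexorder:
  fixes xs ys :: "'s::linorder list"
  shows "xs \<le> ys \<Longrightarrow> take n xs \<le> take n ys"
proof (induction n arbitrary: xs ys)
  case (Suc n) then show ?case by (cases xs; cases ys) auto
qed simp

text \<open>The automaton stores the last \<open>k\<close> letters; read backwards, they are ordered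
  lexicographically.\<close>

lemma ordered_definite:
  assumes "finite U" "finite B" "B \<subseteq> lists U"
  shows "ordered U (lists U \<cdot> B)"
proof -
  obtain enc :: "'a \<Rightarrow> nat" where enc: "inj_on enc U" using assms(1) finite_imp_inj_to_nat_seg by metis
  obtain k where k: "\<And>b. b \<in> B \<Longrightarrow> length b < k" using finite_lengths_bounded[OF assms(2)] by blast
  define f where "f w = take k (rev (map enc w))" for w
  show ?thesis
  proof (rule orderedI[of f])
    have "f ` lists U \<subseteq> {w. set w \<subseteq> enc ` U \<and> length w \<le> k}"
      by (auto simp: f_def dest!: in_set_takeD)
    then show "finite (f ` lists U)"
      by (rule finite_subset) (use assms(1) in \<open>simp add: finite_lists_length_le\<close>)
    show "f (w @ [a]) \<le> f (w' @ [a])" if "f w \<le> f w'" for w w' a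
    proof (cases k)
      case (Suc j)
      \<comment> \<open>Appending \<open>a\<close> puts its code in front of the stored word and may
        drop the oldest letter; with equal heads, only the first \<open>j\<close> stored letters are
        compared.\<close>
      have "take j (f w) \<le> take j (f w')" using that by (rule take_mono_lexorder)
      then show ?thesis using Suc by (simp add: f_def min_def)
    qed (simp add: f_def)
    show "lists U \<cdot> B \<subseteq> lists U" using assms(3) by (intro conc_lists) auto
    fix w w' assume "w \<in> lists U \<cdot> B" and w': "w' \<in> lists U" and eq: "f w = f w'"
    then obtain x b where xb: "w = x @ b" "b \<in> B" by (auto simp: conc_def)
    have len: "length b < k" using k xb by blast
    have "rev (map enc b) = take (length b) (f w)" using len by (simp add: f_def xb min_def)
    also have "\<dots> = take (length b) (rev (map enc w'))" using len eq by (simp add: f_def min_def)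
    also have "\<dots> = rev (map enc (drop (length w' - length b) w'))"
      by (simp add: take_rev drop_map)
    finally have "map enc b = map enc (drop (length w' - length b) w')" by simp
    moreover have "set b \<subseteq> U" "set (drop (length w' - length b) w') \<subseteq> U"
      using xb assms(3) w' by (auto dest: in_set_dropD)
    ultimately have "b = drop (length w' - length b) w'"
      using enc inj_on_map_eq_map[of enc b "drop (length w' - length b) w'"]
      by (meson inj_on_subset Un_least)
    then have "w' = take (length w' - length b) w' @ b" by (metis append_take_drop_id)
    moreover have "take (length w' - length b) w' \<in> lists U" using w' by (auto dest: in_set_takeD)
    ultimately show "w' \<in> lists U \<cdot> B" using xb(2) unfolding conc_def by blast
  qed
qed

lemma EC_DEF_ORD: "EC (fam F_DEF) \<subseteq> EC (fam F_ORD)"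
proof (rule EC_subsetI1)
  fix U and S :: "'a list set" assume U: "alphabet U" and "S \<in> fam F_DEF U"
  then obtain A B where AB: "finite A" "finite B" "B \<subseteq> lists U" "S = A \<union> lists U \<cdot> B" by auto
  have "regular U B" using AB by (intro regular_finite)
  then have "lists U \<cdot> B \<in> fam F_ORD U"
    using U AB ordered_definite[of U B] by (auto simp: alphabet_def)
  moreover have "finite (S - lists U \<cdot> B)" using AB by (auto intro: finite_subset[of _ A])
  ultimately show "\<exists>T. T \<in> fam F_ORD U \<and> T \<subseteq> S \<and> finite (S - T)" using AB by blast
qed

text \<open>Used contrapositively: a monotone sequence bounded by \<open>N\<close> repeats a value
  within its first \<open>N + 1\<close> steps.\<close>

lemma nat_chain_stops:
  fixes g :: "nat \<Rightarrow> nat"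
  assumes "\<And>i. i \<le> N \<Longrightarrow> g i \<noteq> g (Suc i)" and "mono g \<or> antimono g"
  shows "\<exists>i. g i > N"
  using assms(2)
proof
  assume g: "mono g"
  have "n \<le> Suc N \<Longrightarrow> n \<le> g n" for n
  proof (induction n)
    case (Suc n)
    then have "g n < g (Suc n)" using assms(1)[of n] monoD[OF g, of n "Suc n"] by simp
    with Suc show ?case by simp
  qed simp
  from this[of "Suc N"] show ?thesis by (auto simp: Suc_le_eq)
next
  assume g: "antimono g"
  have "n \<le> Suc N \<Longrightarrow> g n + n \<le> g 0" for n
  proof (induction n)
    case (Suc n)
    then have "g n > g (Suc n)" using assms(1)[of n] antimonoD[OF g, of n "Suc n"] by simp
    with Suc show ?case by simp
  qed simp
  from this[of "Suc N"] have "g 0 > N" by auto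
  then show ?thesis ..
qed

text \<open>Reading \<open>y\<close> is a monotone map of the states, so the states after
  \<open>x y\<^sup>i\<close> move in one direction only and become stationary: an ordered automaton
  cannot run through a proper cycle.\<close>

lemma EC_ORD_NC: "EC (fam F_ORD) \<subseteq> EC (fam F_NC)"
proof (rule EC_mono)
  fix U :: "'a set" assume U: "alphabet U"
  show "fam F_ORD U \<subseteq> fam F_NC U"
  proof
    fix L assume "L \<in> fam F_ORD U"
    then have reg: "regular U L" and "ordered U L" by auto
    from this(2) obtain f N where bd: "\<And>w. w \<in> lists U \<Longrightarrow> f w \<le> (N :: nat)"
      and mono: "\<And>w w' t. w \<in> lists U \<Longrightarrow> w' \<in> lists U \<Longrightarrow> t \<in> lists U \<Longrightarrow> f w \<le> f w' \<Longrightarrow>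
        f (w @ t) \<le> f (w' @ t)"
      and sub: "L \<subseteq> lists U"
      and sat: "\<And>w w'. w \<in> L \<Longrightarrow> w' \<in> lists U \<Longrightarrow> f w = f w' \<Longrightarrow> w' \<in> L"
      by (rule orderedE) blast
    have eq: "f (w @ t) = f (w' @ t)"
      if "f w = f w'" "w \<in> lists U" "w' \<in> lists U" "t \<in> lists U" for w w' t
      using mono[of w w' t] mono[of w' w t] that by simp
    have stable: "f (x @ wpow y (Suc N)) = f (x @ wpow y (Suc (Suc N)))"
      if x: "x \<in> lists U" and y: "y \<in> lists U" for x y
    proof -
      define g where "g i = f (x @ wpow y i)" for i
      have shift: "g (Suc i) \<le> g (Suc j)" if "g i \<le> g j" for i j
        using mono[of "x @ wpow y i" "x @ wpow y j" y] that x y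
        by (simp add: g_def wpow_Suc2 del: in_lists_conv_set)
      have "g i \<le> g (Suc i)" if "g 0 \<le> g 1" for i
        by (induction i) (use that in simp, rule shift)
      moreover have "g (Suc i) \<le> g i" if "g 1 \<le> g 0" for i
        by (induction i) (use that in simp, rule shift)
      ultimately have "mono g \<or> antimono g"
        unfolding mono_iff_le_Suc antimono_iff_le_Suc using linear[of "g 0" "g 1"] by blast
      moreover have "\<not> (\<exists>i. g i > N)" using bd x y by (auto simp: g_def not_less simp del: in_lists_conv_set)
      ultimately obtain i where i: "i \<le> N" "g i = g (Suc i)" using nat_chain_stops[of N g] by blast
      have "g (i + d) = g (Suc (i + d))" for d
      proof (induction d)
        case (Suc d)
        then show ?case using shift[of "i + d" "Suc (i + d)"] shift[of "Suc (i + d)" "i + d"] by simp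
      qed (use i in simp)
      from this[of "Suc N - i"] show ?thesis using i by (simp add: g_def)
    qed
    have "x @ wpow y (Suc N) @ z \<in> L \<longleftrightarrow> x @ wpow y (Suc N + 1) @ z \<in> L"
      if "x \<in> lists U" "y \<in> lists U" "z \<in> lists U" for x y z
    proof -
      have "f (x @ wpow y (Suc N) @ z) = f (x @ wpow y (Suc N + 1) @ z)"
        using eq[OF stable, of x y z] that by (simp del: in_lists_conv_set)
      moreover have "x @ wpow y (Suc N) @ z \<in> lists U" "x @ wpow y (Suc N + 1) @ z \<in> lists U"
        using that by (simp_all del: in_lists_conv_set)
      ultimately show ?thesis using sat by metis
    qed
    then show "L \<in> fam F_NC U" using reg by (auto intro!: exI[of _ "Suc N"] simp del: in_lists_conv_set)
  qed
qed

section \<open>Families inside the power-separating one\<close>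

lemma PS_I:
  assumes "regular U L" "m \<ge> 1"
    and "\<And>x n k. x \<in> lists U \<Longrightarrow> n \<ge> m \<Longrightarrow> k \<ge> m \<Longrightarrow> wpow x n \<in> L \<Longrightarrow> wpow x k \<in> L"
  shows "L \<in> fam F_PS U"
proof -
  have "{wpow x n | n. n \<ge> m} \<inter> L = {} \<or> {wpow x n | n. n \<ge> m} \<subseteq> L" if "x \<in> lists U" for x
    using assms(3)[OF that] by blast
  then show ?thesis using assms(1,2) unfolding fam.simps by blast
qed

lemma EC_NC_PS: "EC (fam F_NC) \<subseteq> EC (fam F_PS)"
proof (rule EC_mono, rule subsetI)
  fix U :: "'a set" and L assume U: "alphabet U" "L \<in> fam F_NC U"
  then obtain m where "regular U L" "m \<ge> 1" and
    m: "\<And>x y z. x \<in> lists U \<Longrightarrow> y \<in> lists U \<Longrightarrow> z \<in> lists U \<Longrightarrow>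
      x @ wpow y m @ z \<in> L \<longleftrightarrow> x @ wpow y (m + 1) @ z \<in> L"
    by auto
  have "wpow x n \<in> L \<longleftrightarrow> wpow x m \<in> L" if "n \<ge> m" "x \<in> lists U" for n x
    using that(1)
  proof (induction n rule: dec_induct)
    case (step n)
    have "wpow x (n - m) @ wpow x m @ [] = wpow x n" "wpow x (n - m) @ wpow x (m + 1) @ [] = wpow x (Suc n)"
      using step by (simp_all only: append_Nil2 wpow_add[symmetric]) simp_all
    then show ?case using m[of "wpow x (n - m)" x "[]"] that(2) step by simp
  qed simp
  then show "L \<in> fam F_PS U" using PS_I[OF \<open>regular U L\<close> \<open>m \<ge> 1\<close>] by blast
qed

lemma prefix_wpow: "e @ t = wpow x n \<Longrightarrow> \<exists>i x1 x2. x = x1 @ x2 \<and> e = wpow x i @ x1"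
proof (induction n arbitrary: e)
  case 0 then show ?case by (intro exI[of _ 0] exI[of _ "[]"] exI[of _ x]) simp
next
  case (Suc n)
  then obtain s where "e = x @ s \<and> s @ t = wpow x n \<or> e @ s = x"
    by (auto simp: wpow_Suc append_eq_append_conv2)
  then show ?case
  proof (elim disjE conjE)
    assume "e = x @ s" "s @ t = wpow x n"
    then obtain i x1 x2 where "x = x1 @ x2" "s = wpow x i @ x1" using Suc.IH by blast
    then show ?thesis using \<open>e = x @ s\<close>
      by (intro exI[of _ "Suc i"] exI[of _ x1] exI[of _ x2]) (simp add: wpow_Suc)
  next
    assume "e @ s = x"
    then show ?thesis by (intro exI[of _ 0] exI[of _ e] exI[of _ s]) simp
  qed
qed

lemma suffix_wpow: "t @ h = wpow x n \<Longrightarrow> \<exists>i x1 x2. x = x1 @ x2 \<and> h = x2 @ wpow x i"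
proof (induction n arbitrary: h)
  case 0 then show ?case by (intro exI[of _ 0] exI[of _ x] exI[of _ "[]"]) simp
next
  case (Suc n)
  then obtain s where "h = s @ x \<and> t @ s = wpow x n \<or> s @ h = x"
    by (auto simp: wpow_Suc2 append_eq_append_conv2)
  then show ?case
  proof (elim disjE conjE)
    assume "h = s @ x" "t @ s = wpow x n"
    then obtain i x1 x2 where "x = x1 @ x2" "s = x2 @ wpow x i" using Suc.IH by blast
    then show ?thesis using \<open>h = s @ x\<close>
      by (intro exI[of _ "Suc i"] exI[of _ x1] exI[of _ x2]) (simp add: wpow_Suc2)
  next
    assume "s @ h = x"
    then show ?thesis by (intro exI[of _ 0] exI[of _ s] exI[of _ h]) simp
  qed
qed

text \<open>When \<open>e @ w @ h\<close> is a power of \<open>x\<close>, then \<open>e\<close>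
  begins and \<open>h\<close> ends with whole copies of \<open>x\<close>, whose numbers can be
  reduced below the numbers of quotients of \<open>E\<close> and \<open>H\<close>. The middle part
  is arbitrary and absorbs the difference to the wanted power.\<close>

lemma EC_SYDEF_PS: "EC (fam F_SYDEF) \<subseteq> EC (fam F_PS)"
proof (rule EC_mono, rule subsetI)
  fix U :: "'a set" and L assume U: "alphabet U" "L \<in> fam F_SYDEF U"
  then obtain E H where reg: "regular U L" "regular U E" "regular U H" and L: "L = E \<cdot> lists U \<cdot> H"
    by auto
  let ?m = "card (range (\<lambda>w. lquot w E))" and ?m' = "card (range (\<lambda>w. rquot w H))"
  show "L \<in> fam F_PS U"
  proof (rule PS_I[of _ _ "Suc (?m + ?m')"])
    fix x n k assume x: "x \<in> lists U" and k: "k \<ge> Suc (?m + ?m')" and "wpow x n \<in> L"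
    then obtain e w h where ewh: "wpow x n = e @ w @ h" "e \<in> E" "h \<in> H"
      by (auto simp: L conc_def)
    obtain i x1 x2 where e: "x = x1 @ x2" "e = wpow x i @ x1"
      using prefix_wpow[of e "w @ h" x n] ewh by auto
    obtain j y1 y2 where h: "x = y1 @ y2" "h = y2 @ wpow x j"
      using suffix_wpow[of "e @ w" h x n] ewh by auto
    obtain i' where i': "i' < ?m" "lquot (wpow x i') E = lquot (wpow x i) E"
      using lquot_wpow_repeat[OF reg(2)] by blast
    obtain j' where j': "j' < ?m'" "rquot (wpow x j') H = rquot (wpow x j) H"
      using rquot_wpow_repeat[OF reg(3)] by blast
    have "x1 \<in> lquot (wpow x i) E" using ewh(2) e(2) by simp
    then have E: "wpow x i' @ x1 \<in> E" unfolding i'(2)[symmetric] by simp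
    have "y2 \<in> rquot (wpow x j) H" using ewh(3) h(2) by simp
    then have H: "y2 @ wpow x j' \<in> H" unfolding j'(2)[symmetric] by simp
    \<comment> \<open>Two copies of \<open>x\<close> are set apart, one to be completed after
      \<open>x1\<close> and one before \<open>y2\<close>; the threshold leaves room for them because
      \<open>i'\<close> and \<open>j'\<close> lie strictly below the two numbers of
      quotients.\<close>
    have "k = i' + (1 + ((k - i' - j' - 2) + (1 + j')))" using k i' j' by simp
    then have "wpow x k = wpow x i' @ x @ wpow x (k - i' - j' - 2) @ x @ wpow x j'"
      by (metis wpow_add wpow_Suc One_nat_def append_Nil2 wpow_0)
    also have "\<dots> = (wpow x i' @ x1) @ (x2 @ wpow x (k - i' - j' - 2) @ y1) @ (y2 @ wpow x j')"
      using e(1) h(1) by (metis append.assoc)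
    finally have "wpow x k = (wpow x i' @ x1) @ (x2 @ wpow x (k - i' - j' - 2) @ y1) @ (y2 @ wpow x j')" .
    moreover have "x2 @ wpow x (k - i' - j' - 2) @ y1 \<in> lists U"
    proof -
      have "x2 \<in> lists U" "y1 \<in> lists U" using x e(1) h(1) by (metis append_in_lists_conv)+
      then show ?thesis using x by (simp del: in_lists_conv_set)
    qed
    ultimately show "wpow x k \<in> L" using E H unfolding L conc_def by blast
  qed (use reg in auto)
qed

lemma EC_SUF_PS: "EC (fam F_SUF) \<subseteq> EC (fam F_PS)"
proof (rule EC_mono, rule subsetI)
  fix U :: "'a set" and L assume U: "alphabet U" "L \<in> fam F_SUF U"
  have reg: "regular U L" and suf: "\<And>x y. x \<in> lists U \<Longrightarrow> y \<in> lists U \<Longrightarrow> x @ y \<in> L \<Longrightarrow> y \<in> L"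
    using U(2) unfolding fam.simps by blast+
  obtain m where m: "m \<ge> 1" "\<And>x n N. n \<ge> m \<Longrightarrow> wpow x n \<in> L \<Longrightarrow> \<exists>k \<ge> N. wpow x k \<in> L"
    using regular_pump[OF reg] by blast
  show "L \<in> fam F_PS U"
  proof (rule PS_I[OF reg m(1)])
    fix x n k assume x: "x \<in> lists U" and "n \<ge> m" "wpow x n \<in> L"
    then obtain l where "l \<ge> k" "wpow x l \<in> L" using m(2) by blast
    then have "wpow x (l - k) @ wpow x k \<in> L" by (simp add: wpow_add[symmetric])
    then show "wpow x k \<in> L" using suf x by (meson wpow_lists)
  qed
qed

lemma EC_PRE_PS: "EC (fam F_PRE) \<subseteq> EC (fam F_PS)"
proof (rule EC_mono, rule subsetI)
  fix U :: "'a set" and L assume U: "alphabet U" "L \<in> fam F_PRE U"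
  have reg: "regular U L" and pre: "\<And>x y. x \<in> lists U \<Longrightarrow> y \<in> lists U \<Longrightarrow> x @ y \<in> L \<Longrightarrow> x \<in> L"
    using U(2) unfolding fam.simps by blast+
  obtain m where m: "m \<ge> 1" "\<And>x n N. n \<ge> m \<Longrightarrow> wpow x n \<in> L \<Longrightarrow> \<exists>k \<ge> N. wpow x k \<in> L"
    using regular_pump[OF reg] by blast
  show "L \<in> fam F_PS U"
  proof (rule PS_I[OF reg m(1)])
    fix x n k assume x: "x \<in> lists U" and "n \<ge> m" "wpow x n \<in> L"
    then obtain l where "l \<ge> k" "wpow x l \<in> L" using m(2) by blast
    then have "wpow x k @ wpow x (l - k) \<in> L" by (simp add: wpow_add[symmetric])
    then show "wpow x k \<in> L" using pre x by (meson wpow_lists)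
  qed
qed

section \<open>Inclusions between families with closure properties\<close>

lemma EC_INF_SUF: "EC (fam F_INF) \<subseteq> EC (fam F_SUF)"
proof (rule EC_mono, rule subsetI)
  fix U :: "'a set" and L assume L: "L \<in> fam F_INF U"
  have "regular U L" and inf: "\<And>x y z. x \<in> lists U \<Longrightarrow> y \<in> lists U \<Longrightarrow> z \<in> lists U \<Longrightarrow>
    x @ y @ z \<in> L \<Longrightarrow> y \<in> L" using L unfolding fam.simps by blast+
  then show "L \<in> fam F_SUF U" using inf[of _ _ "[]"] unfolding fam.simps append_Nil2
    using lists.Nil by blast
qed

lemma EC_INF_PRE: "EC (fam F_INF) \<subseteq> EC (fam F_PRE)"
proof (rule EC_mono, rule subsetI)
  fix U :: "'a set" and L assume L: "L \<in> fam F_INF U"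
  have "regular U L" and inf: "\<And>x y z. x \<in> lists U \<Longrightarrow> y \<in> lists U \<Longrightarrow> z \<in> lists U \<Longrightarrow>
    x @ y @ z \<in> L \<Longrightarrow> y \<in> L" using L unfolding fam.simps by blast+
  then show "L \<in> fam F_PRE U" using inf[of "[]"] unfolding fam.simps append_Nil
    using lists.Nil by blast
qed

lemma EC_COMM_CIRC: "EC (fam F_COMM) \<subseteq> EC (fam F_CIRC)"
proof (rule EC_mono, rule subsetI)
  fix U :: "'a set" and L assume L: "L \<in> fam F_COMM U"
  have "regular U L" and comm: "\<And>x y. x \<in> L \<Longrightarrow> mset y = mset x \<Longrightarrow> y \<in> L" using L unfolding fam.simps by blast+
  moreover have "y @ x \<in> L" if "x @ y \<in> L" for x y using comm[OF that, of "y @ x"] by simp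
  ultimately show "L \<in> fam F_CIRC U" unfolding fam.simps by blast
qed

section \<open>Regular selection\<close>

lemma kstar_eq:
  assumes "K \<subseteq> M" "M \<subseteq> kstar K"
  shows "kstar M = kstar K"
proof (intro equalityI subsetI)
  fix w assume "w \<in> kstar M"
  then show "w \<in> kstar K"
  proof (induction rule: kstar_induct)
    case (append x w) then show ?case using assms kstar_append_kstar by blast
  qed simp
next
  fix w assume "w \<in> kstar K"
  then show "w \<in> kstar M"
  proof (induction rule: kstar_induct)
    case (append x w) then show ?case using assms kstar_append by blast
  qed simp
qed

text \<open>The star of a union is the star of the product of the single stars; this removes unions
  below a star.\<close>

lemma kstar_UN_eq_foldr:
  "kstar (\<Union>r\<in>set rs. lang r) = lang (Star (foldr (\<lambda>r t. Times (Star r) t) rs (Star Zero)))"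
proof -
  let ?K = "\<Union>r\<in>set rs. lang r" and ?t = "\<lambda>rs. foldr (\<lambda>r t. Times (Star r) t) rs (Star Zero)"
  have Nil: "[] \<in> lang (?t rs)" for rs :: "'a rexp list"
    by (induction rs) (auto simp: conc_def)
  have "(\<Union>r\<in>set rs. lang r) \<subseteq> lang (?t rs)" for rs :: "'a rexp list"
  proof (induction rs)
    case (Cons r rs)
    have "lang r \<subseteq> lang (?t (r # rs))"
      using Nil[of rs] kstar_subset[of _ "lang r"] by (force simp: conc_def)
    moreover have "lang (?t rs) \<subseteq> lang (?t (r # rs))"
      by (auto simp: conc_def intro: exI[of _ "[]"])
    ultimately show ?case using Cons by auto
  qed simp
  moreover have "lang (?t rs) \<subseteq> kstar K" if "\<And>r. r \<in> set rs \<Longrightarrow> lang r \<subseteq> K"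
    for K and rs :: "'a rexp list"
    using that
  proof (induction rs)
    case Nil
    have "kstar {} = {[] :: 'a list}" by (auto simp: kstar_def)
    then show ?case by simp
  next
    case (Cons r rs)
    have "w \<in> kstar K" if "w \<in> kstar (lang r)" for w
      using that by (induction rule: kstar_induct) (use Cons.prems in \<open>auto intro: kstar_append\<close>)
    then show ?case using Cons by (auto simp: conc_def intro!: kstar_append_kstar)
  qed
  ultimately have "lang (?t rs) \<subseteq> kstar ?K" "?K \<subseteq> lang (?t rs)" by blast+
  then show ?thesis using kstar_eq[of ?K "lang (?t rs)"] by simp
qed

lemma UN_conc: "(\<Union>x\<in>I. f x) \<cdot> (\<Union>y\<in>J. g y) = (\<Union>x\<in>I. \<Union>y\<in>J. f x \<cdot> g y)"
  by (auto simp: conc_def)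

text \<open>Unions are moved outwards: they distribute over concatenation, and below a star they
  vanish, so a star contributes a single expression.\<close>

lemma union_free_decomposition:
  "\<exists>rs. (\<forall>s\<in>set rs. union_free s \<and> atoms s \<subseteq> atoms r) \<and> lang r = (\<Union>s\<in>set rs. lang s)"
proof (induction r)
  case Zero show ?case by (intro exI[of _ "[]"]) simp
next
  case (Atom a) show ?case by (intro exI[of _ "[Atom a]"]) simp
next
  case (Union r s)
  obtain rs where "\<forall>s\<in>set rs. union_free s \<and> atoms s \<subseteq> atoms r" "lang r = (\<Union>s\<in>set rs. lang s)"
    using Union.IH(1) by metis
  moreover obtain ss where "\<forall>s'\<in>set ss. union_free s' \<and> atoms s' \<subseteq> atoms s" "lang s = (\<Union>s\<in>set ss. lang s)"
    using Union.IH(2) by metis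
  ultimately show ?case by (intro exI[of _ "rs @ ss"]) auto
next
  case (Times r s)
  obtain rs where rs: "\<forall>s\<in>set rs. union_free s \<and> atoms s \<subseteq> atoms r" "lang r = (\<Union>s\<in>set rs. lang s)"
    using Times.IH(1) by metis
  obtain ss where ss: "\<forall>s'\<in>set ss. union_free s' \<and> atoms s' \<subseteq> atoms s" "lang s = (\<Union>s\<in>set ss. lang s)"
    using Times.IH(2) by metis
  let ?ts = "[Times r s. r \<leftarrow> rs, s \<leftarrow> ss]"
  have "\<forall>t\<in>set ?ts. union_free t \<and> atoms t \<subseteq> atoms (Times r s)" using rs(1) ss(1) by fastforce
  moreover have "lang (Times r s) = (\<Union>t\<in>set ?ts. lang t)"
    by (simp add: rs(2) ss(2) UN_conc)
  ultimately show ?case by blast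
next
  case (Star r)
  then obtain rs where rs:
    "\<forall>s\<in>set rs. union_free s \<and> atoms s \<subseteq> atoms r" "lang r = (\<Union>s\<in>set rs. lang s)" by blast
  let ?t = "Star (foldr (\<lambda>r t. Times (Star r) t) rs (Star Zero))"
  from rs(1) have "union_free ?t \<and> atoms ?t \<subseteq> atoms r" by (induction rs) auto
  moreover have "lang (Star r) = lang ?t"
    by (simp only: kstar_UN_eq_foldr[symmetric] rs(2) lang.simps(5)[of r])
  ultimately show ?case by (intro exI[of _ "[?t]"]) simp
qed

text \<open>A rule may be split into several rules with the same context, so selection by a finite
  union adds no power.\<close>

lemma EC_UF: "EC (fam F_UF) = EC (fam F_REG)"
proof (rule equalityI[OF EC_fam_REG], rule EC_subsetI)
  fix V U :: "'a set" and S assume U: "alphabet U" "S \<in> fam F_REG U"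
  then obtain r where r: "atoms r \<subseteq> U" "lang r = S" by (auto simp: regular_def)
  obtain rs where rs: "\<forall>s\<in>set rs. union_free s \<and> atoms s \<subseteq> atoms r" "lang r = (\<Union>s\<in>set rs. lang s)"
    using union_free_decomposition[of r] by metis
  show "\<exists>\<T>. finite \<T> \<and> (\<forall>T\<in>\<T>. \<exists>U'. alphabet U' \<and> T \<in> fam F_UF U') \<and>
      \<Union>\<T> \<inter> lists V \<subseteq> S \<and> finite (S - \<Union>\<T>)"
  proof (intro exI[of _ "lang ` set rs"] conjI ballI)
    fix T assume "T \<in> lang ` set rs"
    then have "T \<in> fam F_UF U" using rs(1) r(1) by fastforce
    then show "\<exists>U'. alphabet U' \<and> T \<in> fam F_UF U'" using U by blast
  qed (use rs(2) r(2) in auto)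
qed

text \<open>Words over a fresh letter can be attached to a selection language, because the
  selection alphabet need not consist of letters of the generated language.\<close>

lemma EC_REG_subset:
  assumes "\<And>c U S. c \<notin> U \<Longrightarrow> alphabet U \<Longrightarrow> regular U S \<Longrightarrow>
    S \<cdot> kstar {[c]} \<in> \<G> (insert c U) \<or> kstar {[c]} \<cdot> S \<in> \<G> (insert c U)"
  shows "EC (fam F_REG) \<subseteq> EC (\<G> :: 'a::infinite family)"
proof (rule EC_subsetI)
  fix V U :: "'a set" and S assume V: "finite V" and U: "alphabet U" and "S \<in> fam F_REG U"
  then have S: "regular U S" by simp
  obtain c where c: "c \<notin> V \<union> U"
    using V U ex_new_if_finite[OF infinite_UNIV, of "V \<union> U"] by (auto simp: alphabet_def)
  define T where "T = (if S \<cdot> kstar {[c]} \<in> \<G> (insert c U) then S \<cdot> kstar {[c]} else kstar {[c]} \<cdot> S)"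
  have "T \<in> \<G> (insert c U)" using assms[of c U S] c U S by (auto simp: T_def)
  moreover have "alphabet (insert c U)" using U by (simp add: alphabet_def)
  moreover have "T \<inter> lists V \<subseteq> S"
    using c by (auto simp: T_def conc_def kstar_letter split: if_splits)
  moreover have "S \<subseteq> T" using Nil_kstar[of "{[c]}"] by (force simp: T_def conc_def)
  then have "finite (S - T)" by (metis Diff_eq_empty_iff finite.emptyI)
  ultimately show "\<exists>\<T>. finite \<T> \<and> (\<forall>T\<in>\<T>. \<exists>U'. alphabet U' \<and> T \<in> \<G> U') \<and>
      \<Union>\<T> \<inter> lists V \<subseteq> S \<and> finite (S - \<Union>\<T>)"
    by (intro exI[of _ "{T}"]) auto
qed

lemma EC_LCOM: "EC (fam F_LCOM) = (EC (fam F_REG) :: 'a::infinite list set set)"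
proof (rule equalityI[OF EC_fam_REG], rule EC_REG_subset)
  fix c :: 'a and U and S :: "'a list set" assume "regular U S"
  then have "regular (insert c U) S" "regular (insert c U) {[c]}" "{[c]} \<notin> {{}, {[]}}"
    by (auto intro: regular_mono)
  then show "S \<cdot> kstar {[c]} \<in> fam F_LCOM (insert c U) \<or> kstar {[c]} \<cdot> S \<in> fam F_LCOM (insert c U)"
    unfolding fam.simps by blast
qed

lemma EC_RCOM: "EC (fam F_RCOM) = (EC (fam F_REG) :: 'a::infinite list set set)"
proof (rule equalityI[OF EC_fam_REG], rule EC_REG_subset)
  fix c :: 'a and U and S :: "'a list set" assume "regular U S"
  then have "regular (insert c U) S" "regular (insert c U) {[c]}" "{[c]} \<notin> {{}, {[]}}"
    by (auto intro: regular_mono)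
  then show "S \<cdot> kstar {[c]} \<in> fam F_RCOM (insert c U) \<or> kstar {[c]} \<cdot> S \<in> fam F_RCOM (insert c U)"
    unfolding fam.simps by blast
qed

lemma EC_2COM: "EC (fam F_2COM) = (EC (fam F_REG) :: 'a::infinite list set set)"
proof (rule equalityI[OF EC_fam_REG], rule EC_REG_subset)
  fix c :: 'a and U and S :: "'a list set" assume "regular U S"
  then have "regular (insert c U) S" "regular (insert c U) {[c]}" "{[c]} \<notin> {{}, {[]}}"
    "regular (insert c U) {[]}" "kstar {[c]} \<cdot> S = {[]} \<cdot> kstar {[c]} \<cdot> S"
    by (auto intro: regular_mono)
  then show "S \<cdot> kstar {[c]} \<in> fam F_2COM (insert c U) \<or> kstar {[c]} \<cdot> S \<in> fam F_2COM (insert c U)"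
    unfolding fam.simps by blast
qed

section \<open>Marked languages\<close>

text \<open>On a marked language every derivation of a long word from \<open>S\<close> ends with a step that
  creates both markers, so membership in \<open>EC\<close> forces \<open>S\<close> to be a finite union of languages
  \<open>u T v\<close> up to finitely many words.\<close>

definition marked :: "'a \<Rightarrow> 'a set \<Rightarrow> 'a list set \<Rightarrow> 'a list set" where
  "marked m W S = lists W \<union> (\<lambda>y. m # y @ [m]) ` S"

text \<open>One rule per letter builds the inner word from the empty axiom, and one rule with
  selection \<open>S\<close> sets both markers.\<close>

lemma marked_in_EC:
  assumes "alphabet W" "lists W \<in> \<F> W" "S \<in> \<F> W" "S \<subseteq> lists W"
  shows "marked m W S \<in> EC \<F>"
proof -
  define R where "R = insert (S, [m], [m]) ((\<lambda>a. (lists W, [], [a])) ` W)"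
  have "rules \<F> R" using assms by (auto simp: rules_def R_def alphabet_def)
  moreover have "marked m W S = gen {[]} R"
  proof (intro equalityI subsetI)
    have lists: "w \<in> gen {[]} R" if "w \<in> lists W" for w
      using that
    proof (induction w rule: rev_induct)
      case (snoc a w)
      then have "[] @ w @ [a] \<in> gen {[]} R"
        by (intro gen_step[of w _ _ "lists W"]) (auto simp: R_def)
      then show ?case by simp
    qed (simp add: gen_axiom)
    fix w assume "w \<in> marked m W S"
    then consider "w \<in> lists W" | y where "y \<in> S" "w = [m] @ y @ [m]" by (auto simp: marked_def)
    then show "w \<in> gen {[]} R"
    proof cases
      case 2
      then have "y \<in> gen {[]} R" using lists assms(4) by blast
      then show ?thesis unfolding 2(2) by (rule gen_step[of _ _ _ S]) (auto simp: R_def 2)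
    qed (rule lists)
  next
    fix w assume "w \<in> gen {[]} R"
    then show "w \<in> marked m W S"
    proof induction
      case (gen_step x T u v) then show ?case by (auto simp: R_def marked_def)
    qed (simp add: marked_def)
  qed
  ultimately show ?thesis unfolding EC_iff by (intro exI[of _ "{[]}"] exI[of _ R]) simp
qed

text \<open>\<open>R\<close> collects the rules whose contexts carry both markers, with the markers
  removed. Since all of \<open>lists W\<close> is derivable, a rule cannot hide unwanted words of
  \<open>T\<close> over \<open>W\<close>: each of them must lead into \<open>S\<close>.\<close>

lemma marked_EC_cover:
  assumes L: "marked m W S \<in> EC \<F>" and m: "m \<notin> W" and S: "S \<subseteq> lists W"
  obtains R N where "finite R"
    "\<And>T u v. (T, u, v) \<in> R \<Longrightarrow> \<exists>U. alphabet U \<and> T \<in> \<F> U"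
    "\<And>T u v. (T, u, v) \<in> R \<Longrightarrow> length u + length v \<le> N"
    "\<And>T u v x. (T, u, v) \<in> R \<Longrightarrow> x \<in> T \<Longrightarrow> x \<in> lists W \<Longrightarrow> u @ x @ v \<in> S"
    "\<And>y. y \<in> S \<Longrightarrow> length y > N \<Longrightarrow> \<exists>T u v x. (T, u, v) \<in> R \<and> x \<in> T \<and> y = u @ x @ v"
proof -
  obtain A R0 where A: "finite A" and R0: "rules \<F> R0" and gen: "marked m W S = gen A R0"
    using L by (rule ECE)
  define R where "R = {(T, u, v). (T, m # u, v @ [m]) \<in> R0}"
  have "finite (A \<union> (\<lambda>(T, u, v). u @ v) ` R0)" using A R0 by (simp add: rules_def)
  then obtain N where N: "\<And>w. w \<in> A \<union> (\<lambda>(T, u, v). u @ v) ` R0 \<Longrightarrow> length w < N"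
    by (rule finite_lengths_bounded) blast
  have N0: "length u + length v < N" if "(T, u, v) \<in> R0" for T u v
  proof -
    have "u @ v \<in> (\<lambda>(T, u, v). u @ v) ` R0" using that by force
    then show ?thesis using N[of "u @ v"] by simp
  qed
  have mS: "m \<notin> set y" if "y \<in> S" for y using that S m by (auto simp: in_lists_conv_set)
  show ?thesis
  proof (rule that[of R N])
    have "R \<subseteq> (\<lambda>(T, u, v). (T, tl u, butlast v)) ` R0"
      by (auto simp: R_def image_iff intro!: bexI[rotated])
    then show "finite R" by (rule finite_subset) (use R0 in \<open>simp add: rules_def\<close>)
    show "\<exists>U. alphabet U \<and> T \<in> \<F> U" if "(T, u, v) \<in> R" for T u v
      using that R0 by (fastforce simp: R_def rules_def)
    show "length u + length v \<le> N" if "(T, u, v) \<in> R" for T u v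
      using N0[of T "m # u" "v @ [m]"] that by (simp add: R_def)
    show "u @ x @ v \<in> S" if "(T, u, v) \<in> R" "x \<in> T" "x \<in> lists W" for T u v x
    proof -
      have "x \<in> gen A R0" using that(3) by (simp add: gen[symmetric] marked_def)
      then have "(m # u) @ x @ (v @ [m]) \<in> gen A R0" by (rule gen_step) (use that in \<open>auto simp: R_def\<close>)
      then show ?thesis using m by (auto simp: gen[symmetric] marked_def)
    qed
    fix y assume y: "y \<in> S" "length y > N"
    then have "m # y @ [m] \<in> gen A R0" by (simp add: gen[symmetric] marked_def)
    then show "\<exists>T u v x. (T, u, v) \<in> R \<and> x \<in> T \<and> y = u @ x @ v"
    proof cases
      case gen_axiom
      then have "length (m # y @ [m]) < N" by (intro N) auto
      then show ?thesis using y by simp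
    next
      case (gen_step x T u v)
      have len: "length (m # y @ [m]) = length u + length x + length v" unfolding gen_step by simp
      then have "x \<noteq> []" using y N0[OF gen_step(3)] by auto
      have "u @ v \<noteq> []" using gen_step(3) R0 by (auto simp: rules_def)
      have "x \<in> marked m W S" using gen_step by (simp add: gen)
      then consider "x \<in> lists W" | z where "z \<in> S" "x = m # z @ [m]" by (auto simp: marked_def)
      then show ?thesis
      proof cases
        \<comment> \<open>As \<open>x\<close> is non-empty and free of \<open>m\<close>, both outer
          letters of the result have to come from the context.\<close>
        case 1
        then have "hd x \<noteq> m" "last x \<noteq> m" using m \<open>x \<noteq> []\<close> by (auto simp: in_lists_conv_set)
        obtain u' where u: "u = m # u'"
          using gen_step(1) \<open>hd x \<noteq> m\<close> \<open>x \<noteq> []\<close> by (cases u; cases x) auto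
        obtain v' where v: "v = v' @ [m]"
          using gen_step(1) \<open>last x \<noteq> m\<close> \<open>x \<noteq> []\<close> unfolding u
          by (cases v rule: rev_cases; cases x rule: rev_cases) auto
        have "y = u' @ x @ v'" using gen_step(1) by (simp add: u v)
        then show ?thesis using gen_step by (auto simp: R_def u v)
      next
        \<comment> \<open>Here \<open>x\<close> already has both markers, and \<open>y\<close>
          contains none, which leaves no room for a context.\<close>
        case 2
        have "u = []" using gen_step(1) mS[OF y(1)]
          by (cases u; cases v rule: rev_cases) (auto simp: 2)
        moreover have "v = []" using gen_step(1) mS[OF y(1)]
          by (cases v rule: rev_cases) (auto simp: 2 \<open>u = []\<close>)
        ultimately show ?thesis using \<open>u @ v \<noteq> []\<close> by simp
      qed
    qed
  qed
qed

text \<open>Contexts of total length at most \<open>n\<close> cannot reach beyond the padding, so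
  \<open>w\<close> survives inside \<open>x\<close>.\<close>

lemma replicate_core:
  assumes "replicate n a @ w @ replicate n a = u @ x @ v" "length u + length v \<le> n"
  shows "u = replicate (length u) a" "v = replicate (length v) a"
    "x = replicate (n - length u) a @ w @ replicate (n - length v) a"
proof -
  let ?y = "replicate n a @ w @ replicate n a"
  have n: "replicate n a = replicate k a @ replicate (n - k) a"
    "replicate n a = replicate (n - k) a @ replicate k a" if "k \<le> n" for k
    using that by (simp_all add: replicate_add[symmetric])
  have y: "?y = replicate (length u) a @
      (replicate (n - length u) a @ w @ replicate (n - length v) a) @ replicate (length v) a"
    using n(1)[of "length u"] n(2)[of "length v"] assms(2) by (metis append.assoc add_leD1 add_leD2)
  have "u = replicate (length u) a \<and> x @ v =
      (replicate (n - length u) a @ w @ replicate (n - length v) a) @ replicate (length v) a"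
    using assms(1) unfolding y by (subst (asm) append_eq_append_conv) auto
  moreover from this have "x = replicate (n - length u) a @ w @ replicate (n - length v) a \<and>
      v = replicate (length v) a"
    by (subst append_eq_append_conv[symmetric, of _ _ v]) auto
  ultimately show "u = replicate (length u) a" "v = replicate (length v) a"
    "x = replicate (n - length u) a @ w @ replicate (n - length v) a" by blast+
qed

text \<open>Since a grammar has only finitely many selection languages \<open>T\<close>, the index \<open>n\<close> can be
  chosen above all bounds \<open>f T U\<close>.\<close>

lemma marked_EC_core:
  fixes f :: "'a list set \<Rightarrow> 'a set \<Rightarrow> nat"
  assumes L: "marked m W S \<in> EC \<F>" and m: "m \<notin> W" and S: "S \<subseteq> lists W"
    and core: "\<And>n. replicate (g n) a @ w n @ replicate (g n) a \<in> S" and g: "\<And>n. n \<le> g n"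
  obtains U T n i j p q where "alphabet U" "T \<in> \<F> U" "f T U < n" "f T U < i" "f T U < j"
    "p + i = g n" "q + j = g n" "replicate i a @ w n @ replicate j a \<in> T"
    "replicate i a @ w n @ replicate j a \<in> lists W"
    "\<forall>x \<in> T \<inter> lists W. replicate p a @ x @ replicate q a \<in> S"
proof -
  obtain R N where R: "finite R" "\<And>T u v. (T, u, v) \<in> R \<Longrightarrow> \<exists>U. alphabet U \<and> T \<in> \<F> U"
    "\<And>T u v. (T, u, v) \<in> R \<Longrightarrow> length u + length v \<le> N"
    "\<And>T u v x. (T, u, v) \<in> R \<Longrightarrow> x \<in> T \<Longrightarrow> x \<in> lists W \<Longrightarrow> u @ x @ v \<in> S"
    "\<And>y. y \<in> S \<Longrightarrow> length y > N \<Longrightarrow> \<exists>T u v x. (T, u, v) \<in> R \<and> x \<in> T \<and> y = u @ x @ v"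
    by (rule marked_EC_cover[OF L m S]) blast
  \<comment> \<open>An alphabet is fixed for each rule in advance, because the bound
    \<open>f\<close> depends on it.\<close>
  have "\<forall>\<rho>\<in>R. \<exists>U. alphabet U \<and> fst \<rho> \<in> \<F> U" using R(2) by auto
  then obtain U where U: "\<And>\<rho>. \<rho> \<in> R \<Longrightarrow> alphabet (U \<rho>) \<and> fst \<rho> \<in> \<F> (U \<rho>)" by metis
  define n where "n = Suc (N + (\<Sum>\<rho>\<in>R. f (fst \<rho>) (U \<rho>)))"
  let ?y = "replicate (g n) a @ w n @ replicate (g n) a"
  have "length ?y > N" using g[of n] by (simp add: n_def)
  then obtain T u v x where T: "(T, u, v) \<in> R" "x \<in> T" "?y = u @ x @ v" using R(5)[OF core] by blast
  have "f T (U (T, u, v)) \<le> (\<Sum>\<rho>\<in>R. f (fst \<rho>) (U \<rho>))"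
    using member_le_sum[of "(T, u, v)" R "\<lambda>\<rho>. f (fst \<rho>) (U \<rho>)"] T R(1) by simp
  then have n: "length u + length v + f T (U (T, u, v)) < n"
    using R(3)[OF T(1)] by (simp add: n_def)
  then have len: "length u + length v \<le> g n" using g[of n] by linarith
  note x = replicate_core[OF T(3) len]
  have "x \<in> lists W" using core[of n] S unfolding T(3) by auto
  show ?thesis
  proof (rule that[of "U (T, u, v)" T n "g n - length u" "g n - length v" "length u" "length v"])
    show "\<forall>z \<in> T \<inter> lists W. replicate (length u) a @ z @ replicate (length v) a \<in> S"
      using R(4)[OF T(1)] by (auto simp only: x(1,2)[symmetric] Int_iff)
  qed (use U[OF T(1)] T(2) x(3) \<open>x \<in> lists W\<close> n g[of n] in auto)
qed

lemma fam_lists: "alphabet U \<Longrightarrow> T \<in> fam X U \<Longrightarrow> T \<subseteq> lists U"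
  by (meson fam_regular regular_lists)

section \<open>Words around blocks of one letter\<close>

lemma replicate_Cons_eq [simp]:
  "x \<noteq> a \<Longrightarrow> y \<noteq> a \<Longrightarrow> replicate i a @ x # r = replicate j a @ y # s \<longleftrightarrow> i = j \<and> x = y \<and> r = s"
proof (induction i arbitrary: j)
  case 0 then show ?case by (cases j) auto
next
  case (Suc i) then show ?case by (cases j) auto
qed

lemma replicate_Cons_neq [simp]:
  "x \<noteq> a \<Longrightarrow> replicate i a @ x # r \<noteq> replicate j a"
  "x \<noteq> a \<Longrightarrow> replicate j a \<noteq> replicate i a @ x # r"
  "x \<noteq> a \<Longrightarrow> x # r \<noteq> replicate j a"
  "x \<noteq> a \<Longrightarrow> replicate j a \<noteq> x # r"
  by (metis in_set_conv_decomp in_set_replicate list.set_intros(1))+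

lemma replicate_Cons_eq_Cons [simp]:
  "x \<noteq> a \<Longrightarrow> y \<noteq> a \<Longrightarrow> replicate i a @ x # r = y # s \<longleftrightarrow> i = 0 \<and> x = y \<and> r = s"
  "x \<noteq> a \<Longrightarrow> y \<noteq> a \<Longrightarrow> y # s = replicate i a @ x # r \<longleftrightarrow> i = 0 \<and> x = y \<and> r = s"
  by (cases i; auto)+

lemma NC_pump_letter:
  assumes k: "\<forall>x\<in>lists U. \<forall>y\<in>lists U. \<forall>z\<in>lists U. x @ wpow y k @ z \<in> T \<longleftrightarrow> x @ wpow y (k + 1) @ z \<in> T"
    and T: "x @ replicate l a @ z \<in> T" "T \<subseteq> lists U" "k \<le> l" "0 < l"
  shows "x @ replicate (Suc l) a @ z \<in> T"
proof -
  obtain d where d: "l = d + k" using T(3) by (metis add.commute le_Suc_ex)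
  have "x @ replicate l a @ z \<in> lists U" using T by blast
  \<comment> \<open>That \<open>l\<close> is positive puts \<open>a\<close> into \<open>U\<close>,
    the alphabet over which the non-counting condition may be applied.\<close>
  then have "x @ replicate d a \<in> lists U" "[a] \<in> lists U" "z \<in> lists U"
    using T(4) by (auto simp: d in_lists_conv_set)
  then have "(x @ replicate d a) @ wpow [a] k @ z \<in> T \<longleftrightarrow> (x @ replicate d a) @ wpow [a] (k + 1) @ z \<in> T"
    using k by blast
  moreover have "(x @ replicate d a) @ wpow [a] k @ z = x @ replicate l a @ z"
    "(x @ replicate d a) @ wpow [a] (k + 1) @ z = x @ replicate (Suc l) a @ z"
    by (simp_all add: d replicate_add replicate_app_Cons_same)
  ultimately show ?thesis using T(1) by (simp only:)
qed

lemma conc_singleton: "{u} \<cdot> L = (\<lambda>w. u @ w) ` L"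
  by (auto simp: conc_def)

lemma conc_kstar_letter: "kstar {[a]} \<cdot> L = {replicate i a @ w | i w. w \<in> L}"
  by (auto simp: conc_def kstar_letter)

lemma conc_kstar_double_letter: "kstar {[a, a]} \<cdot> L = {replicate (2 * i) a @ w | i w. w \<in> L}"
  by (auto simp: conc_def kstar_double_letter)

lemma five_letters:
  obtains a b c d m :: "'a::infinite" where "distinct [a, b, c, d, m]"
proof -
  obtain B :: "'a set" where "finite B" "card B = 5"
    using infinite_arbitrarily_large[OF infinite_UNIV, of 5] by blast
  moreover from this obtain xs where "set xs = B" "distinct xs" using finite_distinct_list by blast
  ultimately have "distinct xs" "length xs = 5" using distinct_card by metis+
  then show ?thesis using that by (auto simp: length_Suc_conv numeral_eq_Suc)
qed

section \<open>Non-inclusions\<close>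

text \<open>Only an infinite language is wanted, so the marker may be the letter itself.\<close>

lemma MON_not_FIN: "\<not> EC (fam F_MON) \<subseteq> (EC (fam F_FIN) :: 'a list set set)"
proof
  fix a :: 'a
  assume incl: "EC (fam F_MON) \<subseteq> (EC (fam F_FIN) :: 'a list set set)"
  have al: "alphabet {a}" by (simp add: alphabet_def)
  then have "lists {a} \<in> fam F_MON {a}" by (intro lists_self_fam) auto
  then have "marked a {a} (lists {a}) \<in> EC (fam F_MON)" using al by (intro marked_in_EC) auto
  then have "finite (marked a {a} (lists {a}))" using incl EC_FIN_finite by blast
  then have "finite (range (\<lambda>n. replicate n a))"
    by (rule finite_subset[rotated]) (auto simp: marked_def)
  moreover have "inj (\<lambda>n. replicate n a)" by (rule injI) (metis length_replicate)
  ultimately show False using finite_imageD by blast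
qed

section \<open>Thin languages for nilpotent and combinational selection\<close>

text \<open>In the last step towards a long word \<open>b a\<^sup>n\<close>, a non-empty left
  context would use up the only \<open>b\<close>, which the non-empty word \<open>x\<close> needs
  itself. So the step appends letters \<open>a\<close>, and it does the same to every other word of
  \<open>L\<close> in \<open>T\<close>.\<close>

lemma EC_ba_step:
  assumes L: "L \<in> EC \<F>" and ab: "a \<noteq> b" and ba: "\<And>n. b # replicate (Suc n) a \<in> L"
    and b: "\<And>x. x \<in> L \<Longrightarrow> x \<noteq> [] \<Longrightarrow> b \<in> set x"
  obtains T U k l where "alphabet U" "T \<in> \<F> U" "l \<ge> 1" "b # replicate k a \<in> T" "b # replicate k a \<in> L"
    "\<And>x. x \<in> T \<Longrightarrow> x \<in> L \<Longrightarrow> x @ replicate l a \<in> L"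
proof -
  obtain A R where A: "finite A" and R: "rules \<F> R" and gen: "L = gen A R" using L by (rule ECE)
  have "finite (A \<union> (\<lambda>(T, u, v). u @ v) ` R)" using A R by (simp add: rules_def)
  then obtain N where N: "\<And>w. w \<in> A \<union> (\<lambda>(T, u, v). u @ v) ` R \<Longrightarrow> length w < N"
    by (rule finite_lengths_bounded) blast
  have "b # replicate (Suc N) a \<in> gen A R" using ba[of N] by (simp only: gen)
  then show ?thesis
  proof cases
    case gen_axiom
    then have "length (b # replicate (Suc N) a) < N" by (intro N) auto
    then show ?thesis by simp
  next
    case (gen_step x T u v)
    have "u @ v \<in> (\<lambda>(T, u, v). u @ v) ` R" using gen_step(3) by force
    then have "length (u @ v) < N" using N by blast
    moreover have "length (b # replicate (Suc N) a) = length (u @ x @ v)" using gen_step(1) by simp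
    ultimately have "x \<noteq> []" by auto
    then have "b \<in> set x" using gen_step b gen by blast
    have "u = []"
    proof (cases u)
      case (Cons c u')
      then have "replicate (Suc N) a = u' @ x @ v" using gen_step(1) by simp
      then have "set x \<subseteq> {a}" by (metis Un_iff in_set_replicate set_append singletonI subsetI)
      then show ?thesis using \<open>b \<in> set x\<close> ab by auto
    qed
    then obtain x' where x': "x = b # x'" "replicate (Suc N) a = x' @ v"
      using gen_step(1) \<open>x \<noteq> []\<close> by (cases x) auto
    then have "x' = replicate (length x') a" "v = replicate (length v) a"
      by (metis append_eq_conv_conj in_set_replicate replicate_length_same in_set_takeD in_set_dropD)+
    moreover have "v \<noteq> []" using gen_step(3) R \<open>u = []\<close> by (auto simp: rules_def)
    moreover obtain U where "alphabet U" "T \<in> \<F> U" using gen_step(3) R by (auto simp: rules_def)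
    moreover have "z @ v \<in> L" if "z \<in> T" "z \<in> L" for z
      using gen.gen_step[of z A R T u v] that gen_step(3) \<open>u = []\<close> gen by simp
    ultimately show ?thesis
      using that[of U T "length v" "length x'"] gen_step(2,4) x'(1) gen by (simp add: Suc_le_eq)
  qed
qed

lemma snoc_in_conc_letters: "w @ [s] \<in> K \<cdot> {[s] | s. s \<in> X} \<longleftrightarrow> w \<in> K \<and> s \<in> X"
  by (auto simp: conc_def)

text \<open>The traps are \<open>[]\<close> and \<open>[b, b, a]\<close>: appending letters
  \<open>a\<close> to either leaves \<open>L\<close>, so \<open>T\<close> avoids both. But
  \<open>[]\<close> lies in every star language and in every non-empty language closed under
  prefixes or suffixes, and a \<open>F_COMB\<close> language over letters including \<open>a\<close>
  and \<open>b\<close> that has a word ending with \<open>a\<close> contains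
  \<open>[b, b, a]\<close>.\<close>

lemma NIL_not:
  fixes Y assumes Y: "Y \<in> {F_COMB, F_SUF, F_PRE, F_STAR}"
  shows "\<not> EC (fam F_NIL) \<subseteq> (EC (fam Y) :: 'a::infinite list set set)"
proof
  assume incl: "EC (fam F_NIL) \<subseteq> (EC (fam Y) :: 'a list set set)"
  obtain a b c d m :: 'a where "distinct [a, b, c, d, m]" by (rule five_letters)
  then have ab: "a \<noteq> b" "b \<noteq> a" by auto
  define L where "L = {[], [b, b, a]} \<union> range (\<lambda>n. b # replicate (Suc n) a)"
  \<comment> \<open>Both traps are shorter than 4, so the rule never applies to them;
    \<open>[b, a, a, a]\<close> is the first word it extends, and the words up to it are
    axioms.\<close>
  let ?S = "{w \<in> lists {a, b}. 4 \<le> length w}"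
  let ?A = "{[], [b, b, a], [b, a], [b, a, a], [b, a, a, a]}"
  have al: "alphabet {a, b}" by (simp add: alphabet_def)
  have "lists {a, b} - ?S = {w \<in> lists {a, b}. length w < 4}" by auto
  then have "?S \<in> fam F_NIL {a, b}"
    using regular_long_words[of "{a, b}" 4] finite_words_length(2)[of "{a, b}" 4] by simp
  then have "rules (fam F_NIL) {(?S, [], [a])}" using al by (auto simp: rules_def simp del: fam.simps)
  moreover have "L = gen ?A {(?S, [], [a])}"
  proof (intro equalityI subsetI)
    have *: "b # replicate (Suc n) a \<in> gen ?A {(?S, [], [a])}" for n
    proof (induction n)
      case (Suc n)
      show ?case
      proof (cases "n < 2")
        case True
        then have "n = 0 \<or> n = 1" by auto
        then show ?thesis by (auto intro: gen_axiom)
      next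
        case False
        then have "[] @ (b # replicate (Suc n) a) @ [a] \<in> gen ?A {(?S, [], [a])}"
          using Suc by (intro gen_step[of _ _ _ ?S]) auto
        then show ?thesis by (simp add: replicate_append_same)
      qed
    qed (auto intro: gen_axiom)
    fix w assume "w \<in> L" then show "w \<in> gen ?A {(?S, [], [a])}"
      using * by (auto simp: L_def intro: gen_axiom)
  next
    fix w assume "w \<in> gen ?A {(?S, [], [a])}"
    then show "w \<in> L"
    proof induction
      case (gen_axiom w)
      have "[b, a] = b # replicate (Suc 0) a" "[b, a, a] = b # replicate (Suc 1) a"
        "[b, a, a, a] = b # replicate (Suc 2) a" by (auto simp: numeral_2_eq_2)
      then show ?case using gen_axiom unfolding L_def by blast
    next
      case (gen_step x S u v)
      then obtain n where "x = b # replicate (Suc n) a" "u = []" "v = [a]" by (auto simp: L_def)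
      then have "u @ x @ v = b # replicate (Suc (Suc n)) a" by (simp add: replicate_append_same)
      then show ?case unfolding L_def by blast
    qed
  qed
  ultimately have "L \<in> EC (fam F_NIL)"
    unfolding EC_iff by (intro exI[of _ ?A] exI[of _ "{(?S, [], [a])}"]) simp
  then have "L \<in> EC (fam Y)" using incl by blast
  then obtain T U k l where T: "alphabet U" "T \<in> fam Y U" "l \<ge> 1" "b # replicate k a \<in> T"
    "b # replicate k a \<in> L" and step: "\<And>x. x \<in> T \<Longrightarrow> x \<in> L \<Longrightarrow> x @ replicate l a \<in> L"
    by (rule EC_ba_step[of L _ a b]) (use ab in \<open>auto simp: L_def\<close>)
  have k: "k \<ge> 1" using T(5) ab by (cases k) (auto simp: L_def)
  have wU: "b # replicate k a \<in> lists U" "[] \<in> lists U" using fam_lists[OF T(1,2)] T(4) by auto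
  then have U: "b \<in> U" "a \<in> U" using k by auto
  have l: "replicate l a \<notin> L" "[b, b, a] @ replicate l a \<notin> L"
    using T(3) ab by (cases l; auto simp: L_def)+
  then have "[] \<notin> T" "[b, b, a] \<notin> T" using step[of "[]"] step[of "[b, b, a]"] by (auto simp: L_def)
  from Y show False
  proof (elim insertE emptyE)
    assume "Y = F_COMB"
    then obtain X where X: "T = lists U \<cdot> {[s] | s. s \<in> X}" using T(2) by auto
    obtain k' where "k = Suc k'" using k by (cases k) auto
    then have "b # replicate k a = (b # replicate k' a) @ [a]" by (simp add: replicate_append_same)
    then have "a \<in> X" using T(4) by (simp only: X snoc_in_conc_letters)
    then have "[b, b] @ [a] \<in> T" using U by (simp only: X snoc_in_conc_letters) simp
    then show False using \<open>[b, b, a] \<notin> T\<close> by simp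
  next
    assume "Y = F_SUF"
    then have "T \<in> fam F_SUF U" using T(2) by (simp only:)
    then have "\<forall>x\<in>lists U. \<forall>y\<in>lists U. x @ y \<in> T \<longrightarrow> y \<in> T" unfolding fam.simps by blast
    moreover have "(b # replicate k a) @ [] \<in> T" using T(4) by simp
    ultimately show False using wU \<open>[] \<notin> T\<close> by blast
  next
    assume "Y = F_PRE"
    then have "T \<in> fam F_PRE U" using T(2) by (simp only:)
    then have "\<forall>x\<in>lists U. \<forall>y\<in>lists U. x @ y \<in> T \<longrightarrow> x \<in> T" unfolding fam.simps by blast
    moreover have "[] @ (b # replicate k a) \<in> T" using T(4) by simp
    ultimately show False using wU \<open>[] \<notin> T\<close> by blast
  next
    assume "Y = F_STAR"
    then show False using T(2) \<open>[] \<notin> T\<close> by auto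
  qed
qed

text \<open>The last letter tells on which side to extend: \<open>b a\<^sup>n\<close> grows to the
  right, \<open>a\<^sup>n b\<close> to the left. The trap for suffixes, prefixes and stars is
  \<open>[]\<close>, the one for rotations is \<open>a\<^sup>k b\<close>.\<close>

lemma COMB_not:
  fixes Y assumes Y: "Y \<in> {F_SUF, F_PRE, F_STAR, F_CIRC}"
  shows "\<not> EC (fam F_COMB) \<subseteq> (EC (fam Y) :: 'a::infinite list set set)"
proof
  assume incl: "EC (fam F_COMB) \<subseteq> (EC (fam Y) :: 'a list set set)"
  obtain a b c d m :: 'a where "distinct [a, b, c, d, m]" by (rule five_letters)
  then have ab: "a \<noteq> b" "b \<noteq> a" by auto
  define L where "L = {[]} \<union> range (\<lambda>n. b # replicate (Suc n) a) \<union> range (\<lambda>n. replicate (Suc n) a @ [b])"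
  let ?S = "\<lambda>s. lists {a, b} \<cdot> {[s]}"
  let ?A = "{[], [b, a], [a, b]}" and ?R = "{(?S a, [], [a]), (?S b, [a], [])}"
  have al: "alphabet {a, b}" by (simp add: alphabet_def)
  have "?S s \<in> fam F_COMB {a, b}" if "s \<in> {a, b}" for s
  proof -
    have "regular {a, b} {[s]}" using that by (rule regular_letter)
    then have "regular {a, b} (?S s)" by (intro regular_conc) auto
    moreover have "\<exists>X\<subseteq>{a, b}. ?S s = lists {a, b} \<cdot> {[x] | x. x \<in> X}"
      using that by (intro exI[of _ "{s}"]) auto
    ultimately show ?thesis by simp
  qed
  then have "rules (fam F_COMB) ?R" using al by (auto simp: rules_def simp del: fam.simps)
  moreover have "L = gen ?A ?R"
  proof (intro equalityI subsetI)
    have 1: "b # replicate (Suc n) a \<in> gen ?A ?R" for n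
    proof (induction n)
      case (Suc n)
      have "b # replicate (Suc n) a = (b # replicate n a) @ [a]" by (simp add: replicate_append_same)
      then have "b # replicate (Suc n) a \<in> ?S a" unfolding conc_def by fastforce
      then have "[] @ (b # replicate (Suc n) a) @ [a] \<in> gen ?A ?R"
        by (rule gen_step[OF Suc, rotated]) simp
      then show ?case by (simp add: replicate_append_same)
    qed (auto intro: gen_axiom)
    have 2: "replicate (Suc n) a @ [b] \<in> gen ?A ?R" for n
    proof (induction n)
      case (Suc n)
      have "replicate (Suc n) a @ [b] \<in> ?S b" unfolding conc_def by fastforce
      then have "[a] @ (replicate (Suc n) a @ [b]) @ [] \<in> gen ?A ?R"
        by (rule gen_step[OF Suc, rotated]) simp
      then show ?case by simp
    qed (auto intro: gen_axiom)
    fix w assume "w \<in> L" then show "w \<in> gen ?A ?R"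
      using 1 2 by (auto simp: L_def intro: gen_axiom)
  next
    fix w assume "w \<in> gen ?A ?R"
    then show "w \<in> L"
    proof induction
      case (gen_axiom w)
      have "[b, a] = b # replicate (Suc 0) a" "[a, b] = replicate (Suc 0) a @ [b]" by auto
      then show ?case using gen_axiom unfolding L_def by blast
    next
      case (gen_step x S u v)
      from gen_step(2) have "(S, u, v) = (?S a, [], [a]) \<or> (S, u, v) = (?S b, [a], [])" by blast
      then show ?case
      proof
        assume S: "(S, u, v) = (?S a, [], [a])"
        then have "x \<noteq> []" "last x = a" using gen_step(3) by (auto simp: conc_def)
        then have "x \<noteq> replicate (Suc n) a @ [b]" for n using ab by (metis last_snoc)
        then obtain n where "x = b # replicate (Suc n) a"
          using gen_step.IH \<open>x \<noteq> []\<close> unfolding L_def by blast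
        then have "u @ x @ v = b # replicate (Suc (Suc n)) a" using S by (simp add: replicate_append_same)
        then show ?case unfolding L_def by blast
      next
        assume S: "(S, u, v) = (?S b, [a], [])"
        then have "x \<noteq> []" "last x = b" using gen_step(3) by (auto simp: conc_def)
        then have "x \<noteq> b # replicate (Suc n) a" for n
          using ab by (metis last_ConsR last_replicate nat.distinct(1) replicate_empty)
        then obtain n where "x = replicate (Suc n) a @ [b]"
          using gen_step.IH \<open>x \<noteq> []\<close> unfolding L_def by blast
        then have "u @ x @ v = replicate (Suc (Suc n)) a @ [b]" using S by simp
        then show ?case unfolding L_def by blast
      qed
    qed
  qed
  ultimately have "L \<in> EC (fam F_COMB)" unfolding EC_iff by (intro exI[of _ ?A] exI[of _ ?R]) simp
  then have "L \<in> EC (fam Y)" using incl by blast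
  then obtain T U k l where T: "alphabet U" "T \<in> fam Y U" "l \<ge> 1" "b # replicate k a \<in> T"
    "b # replicate k a \<in> L" and step: "\<And>x. x \<in> T \<Longrightarrow> x \<in> L \<Longrightarrow> x @ replicate l a \<in> L"
    by (rule EC_ba_step[of L _ a b]) (use ab in \<open>auto simp: L_def\<close>)
  have k: "k \<ge> 1" using T(5) ab by (cases k) (auto simp: L_def)
  have wU: "b # replicate k a \<in> lists U" "[] \<in> lists U" using fam_lists[OF T(1,2)] T(4) by auto
  have "replicate l a \<notin> L" using T(3) ab by (cases l) (auto simp: L_def)
  then have "[] \<notin> T" using step[of "[]"] by (auto simp: L_def)
  from Y show False
  proof (elim insertE emptyE)
    assume "Y = F_SUF"
    then have "T \<in> fam F_SUF U" using T(2) by (simp only:)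
    then have "\<forall>x\<in>lists U. \<forall>y\<in>lists U. x @ y \<in> T \<longrightarrow> y \<in> T" unfolding fam.simps by blast
    moreover have "(b # replicate k a) @ [] \<in> T" using T(4) by simp
    ultimately show False using wU \<open>[] \<notin> T\<close> by blast
  next
    assume "Y = F_PRE"
    then have "T \<in> fam F_PRE U" using T(2) by (simp only:)
    then have "\<forall>x\<in>lists U. \<forall>y\<in>lists U. x @ y \<in> T \<longrightarrow> x \<in> T" unfolding fam.simps by blast
    moreover have "[] @ (b # replicate k a) \<in> T" using T(4) by simp
    ultimately show False using wU \<open>[] \<notin> T\<close> by blast
  next
    assume "Y = F_STAR"
    then show False using T(2) \<open>[] \<notin> T\<close> by auto
  next
    assume "Y = F_CIRC"
    then have "[b] @ replicate k a \<in> T \<Longrightarrow> replicate k a @ [b] \<in> T" using T(2) by simp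
    then have "replicate k a @ [b] \<in> T" using T(4) by simp
    moreover obtain k' where "k = Suc k'" using k by (cases k) auto
    ultimately have "(replicate k a @ [b]) @ replicate l a \<in> L"
      by (intro step) (auto simp: L_def)
    then show False using k T(3) ab by (cases k; cases l) (auto simp: L_def)
  qed
qed

section \<open>Infix-closed selection\<close>

text \<open>The infixes of \<open>a\<^sup>* c (aa)\<^sup>* d a\<^sup>*\<close>: the gap between
  \<open>c\<close> and \<open>d\<close> is even, but an infix shows this only while it contains both
  letters.\<close>

definition infix_lang :: "'a \<Rightarrow> 'a \<Rightarrow> 'a \<Rightarrow> 'a list set" where
  "infix_lang a c d =
    {replicate i a @ c # replicate (2 * n) a @ d # replicate j a | i n j. True} \<union>
    {replicate i a @ c # replicate j a | i j. True} \<union>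
    {replicate i a @ d # replicate j a | i j. True} \<union> range (\<lambda>i. replicate i a)"

lemma regular_letter_powers: "a \<in> V \<Longrightarrow> regular V (kstar {[a]})"
  by (intro regular_kstar regular_letter)

lemma regular_even_powers: "a \<in> V \<Longrightarrow> regular V (kstar {[a, a]})"
  by (intro regular_kstar regular_word) auto

lemma letter_powers_conc: "kstar {[a]} \<cdot> {w} \<cdot> kstar {[a]} = {replicate i a @ w @ replicate j a | i j. True}"
  by (auto simp: conc_def kstar_letter) blast

lemma count_list_replicate: "count_list (replicate n x) y = (if x = y then n else 0)"
  by (induction n) auto

lemma regular_letter_powers_conc:
  "a \<in> V \<Longrightarrow> w \<in> lists V \<Longrightarrow> regular V {replicate i a @ w @ replicate j a | i j. True}"
  unfolding letter_powers_conc[symmetric] by (intro regular_conc regular_letter_powers regular_word)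

lemma regular_infix_lang: "regular {a, c, d} (infix_lang a c d)"
proof -
  have "kstar {[a]} \<cdot> {[c]} \<cdot> kstar {[a, a]} \<cdot> {[d]} \<cdot> kstar {[a]} =
      {replicate i a @ c # replicate (2 * n) a @ d # replicate j a | i n j. True}" (is "?K = _")
  proof (intro equalityI subsetI)
    fix w assume "w \<in> {replicate i a @ c # replicate (2 * n) a @ d # replicate j a | i n j. True}"
    then obtain i n j where
      w: "w = replicate i a @ [c] @ replicate (2 * n) a @ [d] @ replicate j a" by auto
    show "w \<in> ?K" unfolding w
      by (intro concI) (auto simp: kstar_letter kstar_double_letter)
  qed (auto simp: conc_kstar_letter conc_kstar_double_letter conc_singleton, auto simp: kstar_letter)
  moreover have "regular {a, c, d} (kstar {[a]} \<cdot> {[c]} \<cdot> kstar {[a, a]} \<cdot> {[d]} \<cdot> kstar {[a]})"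
    by (intro regular_conc regular_letter_powers regular_even_powers regular_letter) auto
  moreover note regular_letter_powers_conc[of a "{a, c, d}" "[c]"] regular_letter_powers_conc[of a "{a, c, d}" "[d]"]
    regular_letter_powers[of a "{a, c, d}", unfolded kstar_letter]
  ultimately show ?thesis unfolding infix_lang_def by (intro regular_Un) simp_all
qed

text \<open>Every infix arises by deleting outer letters one at a time.\<close>

lemma infix_closedI:
  assumes "\<And>x w. x # w \<in> L \<Longrightarrow> w \<in> L" "\<And>w. w \<in> L \<Longrightarrow> butlast w \<in> L"
  shows "x @ y @ z \<in> L \<Longrightarrow> y \<in> L"
proof -
  have suf: "y \<in> L" if "x @ y \<in> L" for x y using that by (induction x) (auto dest: assms(1))
  have pre: "x \<in> L" if "x @ y \<in> L" for x y
    using that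
  proof (induction y rule: rev_induct)
    case (snoc c y)
    then show ?case using assms(2)[of "x @ y @ [c]"] by (simp add: butlast_append)
  qed simp
  show "x @ y @ z \<in> L \<Longrightarrow> y \<in> L" using suf pre by blast
qed

lemma infix_lang_INF: "infix_lang a c d \<in> fam F_INF {a, c, d}"
proof -
  have tl: "w \<in> infix_lang a c d" if "x # w \<in> infix_lang a c d" for x w
  proof -
    have *: "(\<exists>i'. i = Suc i' \<and> w = replicate i' a @ v) \<or> (i = 0 \<and> x # w = v)"
      if "x # w = replicate i a @ v" for i v
      using that by (cases i) auto
    from that consider i n j where "x # w = replicate i a @ c # replicate (2 * n) a @ d # replicate j a"
      | i j where "x # w = replicate i a @ c # replicate j a"
      | i j where "x # w = replicate i a @ d # replicate j a"
      | i where "x # w = replicate i a"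
      unfolding infix_lang_def by blast
    then show ?thesis
    proof cases
      case 1 then show ?thesis using *[OF 1] unfolding infix_lang_def by blast
    next
      case 2 then show ?thesis using *[OF 2] unfolding infix_lang_def by blast
    next
      case 3 then show ?thesis using *[OF 3] unfolding infix_lang_def by blast
    next
      case 4 then show ?thesis by (cases i) (auto simp: infix_lang_def)
    qed
  qed
  have bl: "butlast w \<in> infix_lang a c d" if "w \<in> infix_lang a c d" for w
  proof -
    from that consider i n j where "w = replicate i a @ c # replicate (2 * n) a @ d # replicate j a"
      | i j where "w = replicate i a @ c # replicate j a"
      | i j where "w = replicate i a @ d # replicate j a"
      | i where "w = replicate i a"
      unfolding infix_lang_def by blast
    then show ?thesis
    proof cases
      case 1
      show ?thesis
      proof (cases j)
        case 0
        then have "butlast w = replicate i a @ c # replicate (2 * n) a" by (simp add: 1 butlast_append)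
        then show ?thesis unfolding infix_lang_def by blast
      next
        case (Suc j')
        then have "w = (replicate i a @ c # replicate (2 * n) a @ d # replicate j' a) @ [a]"
          by (simp add: 1 replicate_append_same)
        then have "butlast w = replicate i a @ c # replicate (2 * n) a @ d # replicate j' a"
          by (simp only: butlast_snoc)
        then show ?thesis unfolding infix_lang_def by blast
      qed
    next
      case 2
      show ?thesis
      proof (cases j)
        case 0
        then have "butlast w = replicate i a" by (simp add: 2 butlast_append)
        then show ?thesis unfolding infix_lang_def by blast
      next
        case (Suc j')
        then have "w = (replicate i a @ c # replicate j' a) @ [a]" by (simp add: 2 replicate_append_same)
        then have "butlast w = replicate i a @ c # replicate j' a" by (simp only: butlast_snoc)
        then show ?thesis unfolding infix_lang_def by blast
      qed
    next
      case 3
      show ?thesis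
      proof (cases j)
        case 0
        then have "butlast w = replicate i a" by (simp add: 3 butlast_append)
        then show ?thesis unfolding infix_lang_def by blast
      next
        case (Suc j')
        then have "w = (replicate i a @ d # replicate j' a) @ [a]" by (simp add: 3 replicate_append_same)
        then have "butlast w = replicate i a @ d # replicate j' a" by (simp only: butlast_snoc)
        then show ?thesis unfolding infix_lang_def by blast
      qed
    next
      case 4
      then have "butlast w = replicate (i - 1) a" by (simp add: butlast_conv_take min_def)
      then show ?thesis unfolding infix_lang_def by blast
    qed
  qed
  have "y \<in> infix_lang a c d" if "x @ y @ z \<in> infix_lang a c d" for x y z
    using tl bl that by (rule infix_closedI)
  then have "\<forall>x\<in>lists {a, c, d}. \<forall>y\<in>lists {a, c, d}. \<forall>z\<in>lists {a, c, d}.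
      x @ y @ z \<in> infix_lang a c d \<longrightarrow> y \<in> infix_lang a c d" by (intro ballI impI)
  then show ?thesis unfolding fam.simps mem_Collect_eq by (rule conjI[OF regular_infix_lang])
qed

lemma SYDEF_insert:
  assumes S: "T \<in> fam F_SYDEF U" "alphabet U" "x \<in> T" "c \<in> set x"
  obtains e w h where "x = e @ w @ h" "e @ [c, c] @ h \<in> T"
proof -
  obtain E H where T: "T = E \<cdot> lists U \<cdot> H" using S(1) by auto
  have "x \<in> lists U" using fam_lists[OF S(2,1)] S(3) by blast
  then have "[c, c] \<in> lists U" using S(4) by auto
  moreover obtain e w h where "x = e @ w @ h" "e \<in> E" "h \<in> H" using S(3) unfolding T conc_def by blast
  moreover from this have "e @ [c, c] @ h \<in> T" unfolding T conc_def using \<open>[c, c] \<in> lists U\<close> by blast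
  ultimately show ?thesis using that by blast
qed

text \<open>Whatever stands between the factors from \<open>E\<close> and \<open>H\<close> can be
  replaced by \<open>[c, c]\<close>, as \<open>c\<close> occurs in the selected word and thus
  belongs to the selection alphabet. Inserting it twice exceeds the count even if the original
  \<open>c\<close> was removed.\<close>

lemma SYDEF_obstruction:
  assumes m: "m \<notin> W" and S: "S \<subseteq> lists W" and a: "a \<noteq> c" "c \<in> W"
    and core: "\<And>n. replicate n a @ w n @ replicate n a \<in> S" "\<And>n. c \<in> set (w n)"
    and cnt: "\<And>y. y \<in> S \<Longrightarrow> count_list y c \<le> 1"
  shows "marked m W S \<notin> EC (fam F_SYDEF)"
proof
  assume L: "marked m W S \<in> EC (fam F_SYDEF)"
  obtain T U n p q i j where T: "alphabet U" "T \<in> fam F_SYDEF U" "replicate i a @ w n @ replicate j a \<in> T"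
    "replicate i a @ w n @ replicate j a \<in> lists W"
    "\<And>x. x \<in> T \<Longrightarrow> x \<in> lists W \<Longrightarrow> replicate p a @ x @ replicate q a \<in> S"
    by (rule marked_EC_core[OF L m S core(1) le_refl, of "\<lambda>_ _. 0"]) blast
  have "c \<in> set (replicate i a @ w n @ replicate j a)" using core(2) by simp
  then obtain e t h where "replicate i a @ w n @ replicate j a = e @ t @ h" "e @ [c, c] @ h \<in> T"
    using SYDEF_insert[OF T(2,1,3)] by metis
  moreover from this have "e @ [c, c] @ h \<in> lists W" using T(4) a(2) by simp
  ultimately have "replicate p a @ (e @ [c, c] @ h) @ replicate q a \<in> S" using T(5) by blast
  from cnt[OF this] show False by simp
qed

text \<open>The exponent becomes a function of \<open>T\<close> and \<open>U\<close>, so that it is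
  available before the long word is chosen; \<open>NC_bound\<close> does the same for non-counting
  languages.\<close>

lemma PS_bound:
  obtains f :: "'a list set \<Rightarrow> 'a set \<Rightarrow> nat" where
    "\<And>T U x. T \<in> fam F_PS U \<Longrightarrow> x \<in> lists U \<Longrightarrow>
      {wpow x n | n. n \<ge> f T U} \<inter> T = {} \<or> {wpow x n | n. n \<ge> f T U} \<subseteq> T"
proof -
  define P where "P T U k \<longleftrightarrow>
    (\<forall>x\<in>lists U. {wpow x n | n. n \<ge> k} \<inter> T = {} \<or> {wpow x n | n. n \<ge> k} \<subseteq> T)"
    for T :: "'a list set" and U k
  have "P T U (SOME k. P T U k)" if "T \<in> fam F_PS U" for T U
  proof (rule someI_ex)
    show "\<exists>k. P T U k" using that unfolding P_def fam.simps by blast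
  qed
  then show ?thesis by (intro that[of "\<lambda>T U. SOME k. P T U k"]) (simp only: P_def)
qed

lemma NC_bound:
  obtains f :: "'a list set \<Rightarrow> 'a set \<Rightarrow> nat" where
    "\<And>T U. T \<in> fam F_NC U \<Longrightarrow> \<forall>x\<in>lists U. \<forall>y\<in>lists U. \<forall>z\<in>lists U.
      x @ wpow y (f T U) @ z \<in> T \<longleftrightarrow> x @ wpow y (f T U + 1) @ z \<in> T"
proof -
  define P where "P T U k \<longleftrightarrow> (\<forall>x\<in>lists U. \<forall>y\<in>lists U. \<forall>z\<in>lists U.
      x @ wpow y k @ z \<in> T \<longleftrightarrow> x @ wpow y (k + 1) @ z \<in> T)"
    for T :: "'a list set" and U k
  have "P T U (SOME k. P T U k)" if "T \<in> fam F_NC U" for T U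
  proof (rule someI_ex)
    show "\<exists>k. P T U k" using that unfolding P_def fam.simps by blast
  qed
  then show ?thesis by (intro that[of "\<lambda>T U. SOME k. P T U k"]) (simp only: P_def)
qed

lemma witness_not_subset:
  assumes "alphabet W" "lists W \<in> \<F> W" "S \<in> \<F> W" "S \<subseteq> lists W" "marked m W S \<notin> EC \<G>"
  shows "\<not> EC \<F> \<subseteq> EC \<G>"
  using marked_in_EC[of W \<F> S m] assms by blast

lemma CIRC_rotate: "T \<in> fam F_CIRC U \<Longrightarrow> x @ y \<in> T \<Longrightarrow> y @ x \<in> T"
  unfolding fam.simps by blast

text \<open>The parity of the gap refutes non-counting selection, the uniqueness of \<open>c\<close>
  refutes symmetric definite and star selection, and the order of \<open>c\<close> and
  \<open>d\<close> refutes rotations.\<close>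

lemma INF_not:
  fixes Y assumes Y: "Y \<in> {F_NC, F_SYDEF, F_STAR, F_CIRC}"
  shows "\<not> EC (fam F_INF) \<subseteq> (EC (fam Y) :: 'a::infinite list set set)"
proof -
  obtain a b c d m :: 'a where "distinct [a, b, c, d, m]" by (rule five_letters)
  then have ne [simp]: "a \<noteq> c" "c \<noteq> a" "a \<noteq> d" "d \<noteq> a" "c \<noteq> d" "d \<noteq> c" and m: "m \<notin> {a, c, d}" by auto
  let ?S = "infix_lang a c d" and ?W = "{a, c, d}"
  let ?w = "\<lambda>n. c # replicate (2 * n) a @ [d]"
  have al: "alphabet ?W" by (simp add: alphabet_def)
  have S: "?S \<subseteq> lists ?W" using regular_infix_lang by (rule regular_lists)
  have core: "replicate n a @ ?w n @ replicate n a \<in> ?S" for n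
    unfolding infix_lang_def by auto
  have cnt: "count_list y c \<le> 1" if "y \<in> ?S" for y
    using that by (auto simp: infix_lang_def count_list_replicate)
  have "marked m ?W ?S \<notin> EC (fam Y)"
  proof (cases "Y = F_SYDEF")
    case True
    then show ?thesis
      using SYDEF_obstruction[OF m S ne(1) _ core _ cnt] by auto
  next
    case False
    show ?thesis
    proof
      assume L: "marked m ?W ?S \<in> EC (fam Y)"
      obtain f :: "'a list set \<Rightarrow> 'a set \<Rightarrow> nat" where
        f: "\<And>T U. T \<in> fam F_NC U \<Longrightarrow> \<forall>x\<in>lists U. \<forall>y\<in>lists U. \<forall>z\<in>lists U.
          x @ wpow y (f T U) @ z \<in> T \<longleftrightarrow> x @ wpow y (f T U + 1) @ z \<in> T"
        by (rule NC_bound) blast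
      obtain T U n p q i j where T: "alphabet U" "T \<in> fam Y U" "f T U < n"
        "replicate i a @ ?w n @ replicate j a \<in> T"
        "replicate i a @ ?w n @ replicate j a \<in> lists ?W"
        "\<And>x. x \<in> T \<Longrightarrow> x \<in> lists ?W \<Longrightarrow> replicate p a @ x @ replicate q a \<in> ?S"
        by (rule marked_EC_core[OF L m S core le_refl, of f]) blast
      let ?x = "replicate i a @ ?w n @ replicate j a"
      from Y False consider "Y = F_NC" | "Y = F_STAR" | "Y = F_CIRC" by blast
      then show False
      proof cases
        case 1
        \<comment> \<open>The gap is pumped, not the padding; its length \<open>2 * n\<close>
          exceeds the exponent because \<open>n\<close> does.\<close>
        have "(replicate i a @ [c]) @ replicate (2 * n) a @ (d # replicate j a) \<in> T" using T(4) by simp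
        then have "(replicate i a @ [c]) @ replicate (Suc (2 * n)) a @ (d # replicate j a) \<in> T"
          using T(2,3) fam_lists[OF T(1,2)] f[of T U] unfolding 1
          by (intro NC_pump_letter[of U "f T U"]) auto
        then have "replicate p a @ ((replicate i a @ [c]) @ replicate (Suc (2 * n)) a @ (d # replicate j a))
            @ replicate q a \<in> ?S"
          using T(5) by (intro T(6)) auto
        then have "replicate (p + i) a @ c # replicate (Suc (2 * n)) a @ d # replicate (j + q) a \<in> ?S"
          by (simp add: replicate_add)
        then show False
          unfolding infix_lang_def by (auto simp del: replicate_Suc mult_Suc mult_Suc_right) presburger+
      next
        case 2
        then have "?x @ ?x \<in> T" using T(2,4) kstar_append_kstar by (auto simp del: append_assoc)
        then have "replicate p a @ (?x @ ?x) @ replicate q a \<in> ?S" using T(5) by (intro T(6)) auto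
        from cnt[OF this] show False by (simp add: count_list_replicate)
      next
        case 3
        have "(replicate i a @ c # replicate (2 * n) a) @ (d # replicate j a) \<in> T" using T(4) by simp
        then have "(d # replicate j a) @ (replicate i a @ c # replicate (2 * n) a) \<in> T"
          using T(2) unfolding 3 by (rule CIRC_rotate[rotated])
        then have "replicate p a @ ((d # replicate j a) @ (replicate i a @ c # replicate (2 * n) a)) @
            replicate q a \<in> ?S"
          using T(5) by (intro T(6)) auto
        then have "replicate p a @ d # replicate (j + i) a @ c # replicate (2 * n + q) a \<in> ?S"
          by (simp add: replicate_add)
        then show False unfolding infix_lang_def by auto
      qed
    qed
  qed
  moreover have "lists ?W \<in> fam F_INF ?W" using al by (intro lists_self_fam) auto
  ultimately show ?thesis
    using witness_not_subset[where \<F> = "fam F_INF", OF al _ infix_lang_INF S] by blast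
qed

section \<open>Witnesses by parity, rotation, cutting and permutation\<close>

lemma even_powers_not_PS:
  fixes X assumes "X \<in> {F_STAR, F_COMM}"
  shows "\<not> EC (fam X) \<subseteq> (EC (fam F_PS) :: 'a::infinite list set set)"
proof -
  obtain a b c d m :: 'a where "distinct [a, b, c, d, m]" by (rule five_letters)
  then have m: "m \<notin> {a}" by auto
  let ?S = "kstar {[a, a]}"
  have al: "alphabet {a}" by (simp add: alphabet_def)
  have reg: "regular {a} ?S" by (rule regular_even_powers) simp
  then have S: "?S \<subseteq> lists {a}" by (rule regular_lists)
  have "?S \<in> fam X {a}"
    using assms
  proof (elim insertE emptyE)
    assume "X = F_STAR"
    moreover have "regular {a} {[a, a]}" by (rule regular_word) simp
    ultimately show ?thesis using reg by auto
  next
    assume X: "X = F_COMM"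
    have "y \<in> ?S" if x: "x \<in> ?S" and y: "mset y = mset x" for x y
    proof -
      obtain n where "x = replicate (2 * n) a" using x unfolding kstar_double_letter by blast
      moreover from this have "set y \<subseteq> {a}" "length y = 2 * n"
        using mset_eq_setD[OF y] mset_eq_length[OF y] by auto
      ultimately have "y = replicate (2 * n) a" by (metis replicate_eqI singletonD subsetD)
      then show ?thesis by (auto simp: kstar_double_letter)
    qed
    then show ?thesis using reg unfolding X fam.simps by blast
  qed
  moreover have "lists {a} \<in> fam X {a}" using al assms by (intro lists_self_fam) auto
  moreover have "marked m {a} ?S \<notin> EC (fam F_PS)"
  proof
    assume L: "marked m {a} ?S \<in> EC (fam F_PS)"
    obtain f :: "'a list set \<Rightarrow> 'a set \<Rightarrow> nat" where
      f: "\<And>T U x. T \<in> fam F_PS U \<Longrightarrow> x \<in> lists U \<Longrightarrow>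
        {wpow x n | n. n \<ge> f T U} \<inter> T = {} \<or> {wpow x n | n. n \<ge> f T U} \<subseteq> T"
      by (rule PS_bound) blast
    have core: "replicate n a @ [] @ replicate n a \<in> ?S" for n
      by (auto simp: kstar_double_letter replicate_add[symmetric] mult_2)
    obtain T U n p q i j where T: "alphabet U" "T \<in> fam F_PS U" "f T U < i" "p + i = n" "q + j = n"
      "replicate i a @ [] @ replicate j a \<in> T"
      "\<And>x. x \<in> T \<Longrightarrow> x \<in> lists {a} \<Longrightarrow> replicate p a @ x @ replicate q a \<in> ?S"
      by (rule marked_EC_core[OF L m S core le_refl, of f]) blast
    have x: "wpow [a] (i + j) \<in> T" using T(6) by (simp add: replicate_add)
    then have "wpow [a] (i + j) \<in> lists U" using fam_lists[OF T(1,2)] by blast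
    then have "[a] \<in> lists U" using T(3) by auto
    moreover have "wpow [a] (i + j) \<in> {wpow [a] n | n. n \<ge> f T U}"
      using T(3) by (intro CollectI exI[of _ "i + j"]) simp
    ultimately have "{wpow [a] n | n. n \<ge> f T U} \<subseteq> T" using f[OF T(2)] x by blast
    moreover have "wpow [a] (Suc (i + j)) \<in> {wpow [a] n | n. n \<ge> f T U}"
      using T(3) by (intro CollectI exI[of _ "Suc (i + j)"]) simp
    ultimately have "wpow [a] (Suc (i + j)) \<in> T" by blast
    then have "replicate p a @ replicate (Suc (i + j)) a @ replicate q a \<in> ?S"
      unfolding wpow_letter by (rule T(7)) auto
    then obtain k where "replicate p a @ replicate (Suc (i + j)) a @ replicate q a = replicate (2 * k) a"
      by (auto simp: kstar_double_letter)
    then have "length (replicate p a @ replicate (Suc (i + j)) a @ replicate q a) = 2 * k"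
      by (simp only: length_replicate)
    \<comment> \<open>Since \<open>p + i\<close> and \<open>q + j\<close> both equal
      \<open>n\<close>, the left side is \<open>2 * n + 1\<close>.\<close>
    then have "p + Suc (i + j) + q = 2 * k" by simp
    then show False using T(4,5) by presburger
  qed
  ultimately show ?thesis using witness_not_subset[OF al _ _ S] by blast
qed

lemma le_double: "n \<le> 2 * (n :: nat)"
  by simp

text \<open>Counting from 0, every \<open>b\<close> in \<open>S\<close> stands at an odd position.
  Rotating one leading \<open>a\<close> of the selected word to its end puts the \<open>b\<close> at
  position \<open>2 * n\<close>; the doubled padding keeps the unrotated word in
  \<open>S\<close>.\<close>

lemma STAR_not_CIRC: "\<not> EC (fam F_STAR) \<subseteq> (EC (fam F_CIRC) :: 'a::infinite list set set)"
proof -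
  obtain a b c d m :: 'a where "distinct [a, b, c, d, m]" by (rule five_letters)
  then have m: "m \<notin> {a, b}" and ab [simp]: "a \<noteq> b" "b \<noteq> a" by auto
  let ?S = "kstar {[a, a], [a, b]}" and ?W = "{a, b}"
  have al: "alphabet ?W" by (simp add: alphabet_def)
  have H: "regular ?W {[a, a], [a, b]}" by (rule regular_finite) auto
  then have reg: "regular ?W ?S" by (rule regular_kstar)
  then have S: "?S \<subseteq> lists ?W" by (rule regular_lists)
  have odd: "odd i" if "w \<in> ?S" "i < length w" "w ! i = b" for w i
    using that
  proof (induction arbitrary: i rule: kstar_induct)
    case (append x w)
    then obtain y where x: "x = [a, y]" by auto
    show ?case
    proof (cases "i < 2")
      case True
      then have "i = 0 \<or> i = 1" by auto
      then show ?thesis using append.prems by (auto simp: x)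
    next
      case False
      then obtain k where "i = Suc (Suc k)" by (metis add_2_eq_Suc le_Suc_ex not_less)
      then show ?thesis using append.IH[of k] append.prems by (simp add: x)
    qed
  qed simp
  have even: "replicate (2 * n) a \<in> ?S" for n
  proof (induction n)
    case (Suc n)
    then show ?case using kstar_append[of "[a, a]" "{[a, a], [a, b]}" "replicate (2 * n) a"] by simp
  qed simp
  have core: "replicate (2 * n) a @ [a, b] @ replicate (2 * n) a \<in> ?S" for n
    by (intro kstar_append_kstar even kstar_append) auto
  have "marked m ?W ?S \<notin> EC (fam F_CIRC)"
  proof
    assume L: "marked m ?W ?S \<in> EC (fam F_CIRC)"
    obtain T U n p q i j where T: "T \<in> fam F_CIRC U" "p + i = 2 * n"
      "replicate i a @ [a, b] @ replicate j a \<in> T"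
      "replicate i a @ [a, b] @ replicate j a \<in> lists ?W"
      "\<And>x. x \<in> T \<Longrightarrow> x \<in> lists ?W \<Longrightarrow> replicate p a @ x @ replicate q a \<in> ?S"
      by (rule marked_EC_core[OF L m S core le_double, of "\<lambda>_ _. 0"]) blast
    have "[a] @ (replicate i a @ b # replicate j a) \<in> T"
      using T(3) by (simp add: replicate_app_Cons_same)
    then have "(replicate i a @ b # replicate j a) @ [a] \<in> T" using T(1) by (rule CIRC_rotate[rotated])
    then have "replicate p a @ ((replicate i a @ b # replicate j a) @ [a]) @ replicate q a \<in> ?S"
      using T(4) by (intro T(5)) auto
    then have "replicate (2 * n) a @ b # (replicate j a @ [a] @ replicate q a) \<in> ?S"
      by (simp add: T(2)[symmetric] replicate_add)
    from odd[OF this, of "2 * n"] show False by (simp add: nth_append)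
  qed
  moreover have "lists ?W \<in> fam F_STAR ?W" using al by (intro lists_self_fam) auto
  moreover have "?S \<in> fam F_STAR ?W" using reg H by auto
  ultimately show ?thesis using witness_not_subset[OF al _ _ S] by blast
qed

text \<open>Exactly one \<open>b\<close>: an automaton that counts the letters \<open>b\<close> up
  to 2 is ordered by its counter.\<close>

lemma ORD_not_SYDEF: "\<not> EC (fam F_ORD) \<subseteq> (EC (fam F_SYDEF) :: 'a::infinite list set set)"
proof -
  obtain a b c d m :: 'a where "distinct [a, b, c, d, m]" by (rule five_letters)
  then have m: "m \<notin> {a, b}" and ab [simp]: "a \<noteq> b" "b \<noteq> a" by auto
  let ?S = "{replicate i a @ [b] @ replicate j a | i j. True}" and ?W = "{a, b}"
  have al: "alphabet ?W" by (simp add: alphabet_def)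
  have reg: "regular ?W ?S" by (rule regular_letter_powers_conc) auto
  then have S: "?S \<subseteq> lists ?W" by (rule regular_lists)
  have cnt: "w \<in> ?S \<longleftrightarrow> count_list w b = 1" if "w \<in> lists ?W" for w
  proof
    assume "count_list w b = 1"
    then have "b \<in> set w" using count_notin by fastforce
    then obtain u v where uv: "w = u @ b # v" by (meson split_list)
    then have "b \<notin> set u" "b \<notin> set v" using \<open>count_list w b = 1\<close> by (auto simp: count_list_0_iff)
    then have "set u \<subseteq> {a}" "set v \<subseteq> {a}" using that uv by auto
    then have "u = replicate (length u) a" "v = replicate (length v) a"
      by (metis replicate_length_same singletonD subsetD)+
    then have "w = replicate (length u) a @ [b] @ replicate (length v) a"
      using uv by (metis append_Cons append_Nil)
    then show "w \<in> ?S" by blast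
  qed (auto simp: count_list_replicate)
  have "ordered ?W ?S"
  proof (rule orderedI[of "\<lambda>w. min 2 (count_list w b)"])
    show "finite ((\<lambda>w. min 2 (count_list w b)) ` lists ?W)"
      by (rule finite_subset[of _ "{..2}"]) auto
    show "w' \<in> ?S" if "w \<in> ?S" "w' \<in> lists ?W" "min 2 (count_list w b) = min 2 (count_list w' b)" for w w'
    proof -
      have "count_list w b = 1" using that cnt[of w] S by blast
      then show ?thesis using that cnt[of w'] by (auto simp: min_def split: if_splits)
    qed
  qed (use S in auto)
  then have "?S \<in> fam F_ORD ?W" using reg by simp
  moreover have "marked m ?W ?S \<notin> EC (fam F_SYDEF)"
  proof (rule SYDEF_obstruction[OF m S, of a b "\<lambda>_. [b]"])
    show "count_list y b \<le> 1" if "y \<in> ?S" for y using cnt[of y] that S by fastforce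
  qed auto
  moreover have "lists ?W \<in> fam F_ORD ?W" using al by (intro lists_self_fam) auto
  ultimately show ?thesis using witness_not_subset[OF al _ _ S] by blast
qed

text \<open>The only condition is an even number of letters \<open>a\<close> before the first
  \<open>b\<close>; one more letter in the left padding violates it.\<close>

lemma SYDEF_not_NC: "\<not> EC (fam F_SYDEF) \<subseteq> (EC (fam F_NC) :: 'a::infinite list set set)"
proof -
  obtain a b c d m :: 'a where "distinct [a, b, c, d, m]" by (rule five_letters)
  then have m: "m \<notin> {a, b}" and ab [simp]: "a \<noteq> b" "b \<noteq> a" by auto
  let ?W = "{a, b}"
  let ?E = "kstar {[a, a]} \<cdot> {[b]}"
  let ?S = "?E \<cdot> lists ?W \<cdot> {[]}"
  have al: "alphabet ?W" by (simp add: alphabet_def)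
  have E: "regular ?W ?E" by (intro regular_conc regular_even_powers regular_letter) auto
  then have reg: "regular ?W ?S" by (rule regular_conc[OF _ regular_conc]) auto
  then have S: "?S \<subseteq> lists ?W" by (rule regular_lists)
  have mem: "w \<in> ?S \<longleftrightarrow> (\<exists>n t. w = replicate (2 * n) a @ b # t \<and> t \<in> lists ?W)" for w
  proof (intro iffI)
    assume "\<exists>n t. w = replicate (2 * n) a @ b # t \<and> t \<in> lists ?W"
    then obtain n t where w: "w = (replicate (2 * n) a @ [b]) @ t @ []" "t \<in> lists ?W" by auto
    show "w \<in> ?S" unfolding w(1)
      by (intro concI w(2)) (auto simp: kstar_double_letter)
  qed (auto simp: conc_def kstar_double_letter)
  have "marked m ?W ?S \<notin> EC (fam F_NC)"
  proof
    assume L: "marked m ?W ?S \<in> EC (fam F_NC)"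
    obtain f :: "'a list set \<Rightarrow> 'a set \<Rightarrow> nat" where
      f: "\<And>T U. T \<in> fam F_NC U \<Longrightarrow> \<forall>x\<in>lists U. \<forall>y\<in>lists U. \<forall>z\<in>lists U.
        x @ wpow y (f T U) @ z \<in> T \<longleftrightarrow> x @ wpow y (f T U + 1) @ z \<in> T"
      by (rule NC_bound) blast
    have core: "replicate (2 * n) a @ [b] @ replicate (2 * n) a \<in> ?S" for n unfolding mem by auto
    obtain T U n p q i j where T: "alphabet U" "T \<in> fam F_NC U" "f T U < i" "p + i = 2 * n"
      "replicate i a @ [b] @ replicate j a \<in> T"
      "replicate i a @ [b] @ replicate j a \<in> lists ?W"
      "\<And>x. x \<in> T \<Longrightarrow> x \<in> lists ?W \<Longrightarrow> replicate p a @ x @ replicate q a \<in> ?S"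
      by (rule marked_EC_core[OF L m S core le_double, of f]) blast
    have "[] @ replicate i a @ (b # replicate j a) \<in> T" using T(5) by simp
    then have "[] @ replicate (Suc i) a @ (b # replicate j a) \<in> T"
      using T(2,3) fam_lists[OF T(1,2)] f[of T U] by (intro NC_pump_letter[of U "f T U"]) auto
    then have "replicate p a @ ([] @ replicate (Suc i) a @ (b # replicate j a)) @ replicate q a \<in> ?S"
      using T(6) by (intro T(7)) auto
    then have "replicate (p + Suc i) a @ b # replicate (j + q) a \<in> ?S"
      by (simp only: replicate_add append.simps append.assoc)
    then obtain k where "p + Suc i = 2 * k" unfolding mem by (auto simp del: replicate_Suc)
    then show False using T(4) by presburger
  qed
  moreover have "lists ?W \<in> fam F_SYDEF ?W" using al by (intro lists_self_fam) auto
  moreover have "?S \<in> fam F_SYDEF ?W" using reg E unfolding fam.simps by blast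
  ultimately show ?thesis using witness_not_subset[OF al _ _ S] by blast
qed

text \<open>The suffixes of \<open>a\<^sup>* b c a\<^sup>*\<close>. A prefix cut between
  \<open>b\<close> and \<open>c\<close> leaves a \<open>b\<close>, and the context, consisting of
  letters \<open>a\<close>, can neither remove it from view by \<open>c\<close> nor place it in
  another word of \<open>S\<close>.\<close>

lemma SUF_not_PRE: "\<not> EC (fam F_SUF) \<subseteq> (EC (fam F_PRE) :: 'a::infinite list set set)"
proof -
  obtain a b c d m :: 'a where "distinct [a, b, c, d, m]" by (rule five_letters)
  then have m: "m \<notin> {a, b, c}" and ne [simp]: "a \<noteq> b" "b \<noteq> a" "a \<noteq> c" "c \<noteq> a" "b \<noteq> c" "c \<noteq> b" by auto
  let ?W = "{a, b, c}"
  define S where "S = {replicate i a @ [b, c] @ replicate j a | i j. True} \<union>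
    {[c]} \<cdot> kstar {[a]} \<union> kstar {[a]}"
  have al: "alphabet ?W" by (simp add: alphabet_def)
  have reg: "regular ?W S" unfolding S_def
    by (intro regular_Un regular_letter_powers_conc regular_conc regular_letter regular_letter_powers) auto
  then have S: "S \<subseteq> lists ?W" by (rule regular_lists)
  have mem: "w \<in> S \<longleftrightarrow> (\<exists>i j. w = replicate i a @ b # c # replicate j a) \<or>
      (\<exists>j. w = c # replicate j a) \<or> (\<exists>i. w = replicate i a)" for w
    by (auto simp: S_def conc_singleton kstar_letter)
  have tl: "w \<in> S" if "x # w \<in> S" for x w
  proof -
    from that consider i j where "x # w = replicate i a @ b # c # replicate j a"
      | j where "x # w = c # replicate j a" | i where "x # w = replicate i a"
      unfolding mem by blast
    then show ?thesis
    proof cases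
      case 1 then show ?thesis by (cases i) (auto simp: mem)
    next
      case 3 then show ?thesis by (cases i) (auto simp: mem)
    qed (auto simp: mem)
  qed
  have suf: "y \<in> S" if "x @ y \<in> S" for x y using that by (induction x) (auto dest: tl)
  have "S \<in> fam F_SUF ?W" unfolding fam.simps using reg by (blast intro: suf)
  moreover have "marked m ?W S \<notin> EC (fam F_PRE)"
  proof
    assume L: "marked m ?W S \<in> EC (fam F_PRE)"
    have core: "replicate n a @ [b, c] @ replicate n a \<in> S" for n unfolding mem by auto
    obtain T U p q i j where T: "alphabet U" "T \<in> fam F_PRE U"
      "replicate i a @ [b, c] @ replicate j a \<in> T"
      "\<And>x. x \<in> T \<Longrightarrow> x \<in> lists ?W \<Longrightarrow> replicate p a @ x @ replicate q a \<in> S"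
      by (rule marked_EC_core[OF L m S core le_refl, of "\<lambda>_ _. 0"]) blast
    have "(replicate i a @ [b]) @ (c # replicate j a) \<in> T" using T(3) by simp
    moreover from this have "replicate i a @ [b] \<in> lists U" "c # replicate j a \<in> lists U"
      using fam_lists[OF T(1,2)] by auto
    ultimately have "replicate i a @ [b] \<in> T" using T(2) unfolding fam.simps by blast
    then have "replicate p a @ (replicate i a @ [b]) @ replicate q a \<in> S" by (rule T(4)) auto
    then have "replicate (p + i) a @ b # replicate q a \<in> S" by (simp add: replicate_add)
    then show False unfolding mem by auto
  qed
  moreover have "lists ?W \<in> fam F_SUF ?W" using al by (intro lists_self_fam) auto
  ultimately show ?thesis
    using witness_not_subset[of ?W "fam F_SUF" S m "fam F_PRE"] al S by blast
qed

text \<open>The mirror idea with the prefixes of \<open>a\<^sup>* b c a\<^sup>*\<close>: a suffix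
  cut between \<open>b\<close> and \<open>c\<close> leaves a \<open>c\<close> without its
  \<open>b\<close>.\<close>

lemma PRE_not_SUF: "\<not> EC (fam F_PRE) \<subseteq> (EC (fam F_SUF) :: 'a::infinite list set set)"
proof -
  obtain a b c d m :: 'a where "distinct [a, b, c, d, m]" by (rule five_letters)
  then have m: "m \<notin> {a, b, c}" and ne [simp]: "a \<noteq> b" "b \<noteq> a" "a \<noteq> c" "c \<noteq> a" "b \<noteq> c" "c \<noteq> b" by auto
  let ?W = "{a, b, c}"
  define S where "S = {replicate i a @ [b, c] @ replicate j a | i j. True} \<union>
    kstar {[a]} \<cdot> {[b]} \<union> kstar {[a]}"
  have al: "alphabet ?W" by (simp add: alphabet_def)
  have reg: "regular ?W S" unfolding S_def
    by (intro regular_Un regular_letter_powers_conc regular_conc regular_letter regular_letter_powers) auto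
  then have S: "S \<subseteq> lists ?W" by (rule regular_lists)
  have mem: "w \<in> S \<longleftrightarrow> (\<exists>i j. w = replicate i a @ b # c # replicate j a) \<or>
      (\<exists>i. w = replicate i a @ [b]) \<or> (\<exists>i. w = replicate i a)" for w
    unfolding S_def conc_kstar_letter unfolding kstar_letter by auto
  have bl: "w \<in> S" if "w @ [x] \<in> S" for x w
  proof -
    from that consider i j where "w @ [x] = replicate i a @ b # c # replicate j a"
      | i where "w @ [x] = replicate i a @ [b]" | i where "w @ [x] = replicate i a"
      unfolding mem by blast
    then show ?thesis
    proof cases
      case 1
      show ?thesis
      proof (cases j)
        case 0
        then have "w @ [x] = (replicate i a @ [b]) @ [c]" using 1 by simp
        then have "w = replicate i a @ [b]" by (simp only: append1_eq_conv)
        then show ?thesis unfolding mem by blast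
      next
        case (Suc k)
        then have "w @ [x] = (replicate i a @ b # c # replicate k a) @ [a]"
          using 1 by (simp add: replicate_append_same)
        then have "w = replicate i a @ b # c # replicate k a" by (simp only: append1_eq_conv)
        then show ?thesis unfolding mem by blast
      qed
    next
      case 2 then show ?thesis by (auto simp: mem)
    next
      case 3
      then obtain k where "i = Suc k" by (cases i) auto
      then have "w @ [x] = replicate k a @ [a]" using 3 by (simp add: replicate_append_same)
      then show ?thesis by (auto simp: mem)
    qed
  qed
  have pre: "x \<in> S" if "x @ y \<in> S" for x y
    using that
  proof (induction y rule: rev_induct)
    case (snoc e y) then show ?case using bl[of "x @ y" e] by simp
  qed simp
  have "S \<in> fam F_PRE ?W" unfolding fam.simps using reg by (blast intro: pre)
  moreover have "marked m ?W S \<notin> EC (fam F_SUF)"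
  proof
    assume L: "marked m ?W S \<in> EC (fam F_SUF)"
    have core: "replicate n a @ [b, c] @ replicate n a \<in> S" for n unfolding mem by auto
    obtain T U p q i j where T: "alphabet U" "T \<in> fam F_SUF U"
      "replicate i a @ [b, c] @ replicate j a \<in> T"
      "\<And>x. x \<in> T \<Longrightarrow> x \<in> lists ?W \<Longrightarrow> replicate p a @ x @ replicate q a \<in> S"
      by (rule marked_EC_core[OF L m S core le_refl, of "\<lambda>_ _. 0"]) blast
    have "(replicate i a @ [b]) @ (c # replicate j a) \<in> T" using T(3) by simp
    moreover from this have "replicate i a @ [b] \<in> lists U" "c # replicate j a \<in> lists U"
      using fam_lists[OF T(1,2)] by auto
    ultimately have "c # replicate j a \<in> T" using T(2) unfolding fam.simps by blast
    then have "replicate p a @ (c # replicate j a) @ replicate q a \<in> S" by (rule T(4)) auto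
    then have "replicate p a @ c # replicate (j + q) a \<in> S" by (simp add: replicate_add)
    then show False unfolding mem by auto
  qed
  moreover have "lists ?W \<in> fam F_PRE ?W" using al by (intro lists_self_fam) auto
  ultimately show ?thesis
    using witness_not_subset[of ?W "fam F_PRE" S m "fam F_SUF"] al S by blast
qed

text \<open>The rotations of words \<open>b b a\<^sup>n\<close>: the two letters \<open>b\<close>
  are neighbours on a circle. A permutation of the selected word separates them by \<open>j\<close>
  letters, and the padding in front keeps them from meeting around the end.\<close>

lemma CIRC_not_COMM: "\<not> EC (fam F_CIRC) \<subseteq> (EC (fam F_COMM) :: 'a::infinite list set set)"
proof -
  obtain a b c d m :: 'a where "distinct [a, b, c, d, m]" by (rule five_letters)
  then have m: "m \<notin> {a, b}" and ne [simp]: "a \<noteq> b" "b \<noteq> a" by auto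
  let ?W = "{a, b}"
  define S where "S = {replicate i a @ [b, b] @ replicate j a | i j. True} \<union> {[b]} \<cdot> kstar {[a]} \<cdot> {[b]}"
  have al: "alphabet ?W" by (simp add: alphabet_def)
  have reg: "regular ?W S" unfolding S_def
    by (intro regular_Un regular_letter_powers_conc regular_conc regular_letter regular_letter_powers) auto
  then have S: "S \<subseteq> lists ?W" by (rule regular_lists)
  have mem: "w \<in> S \<longleftrightarrow> (\<exists>i j. w = replicate i a @ b # b # replicate j a) \<or>
      (\<exists>i. w = b # replicate i a @ [b])" for w
    by (auto simp: S_def conc_singleton conc_kstar_letter)
  have rot: "w @ [x] \<in> S" if "x # w \<in> S" for x w
  proof -
    from that consider i j where "x # w = replicate i a @ b # b # replicate j a"
      | i where "x # w = b # replicate i a @ [b]"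
      unfolding mem by blast
    then show ?thesis
    proof cases
      case 1
      show ?thesis
      proof (cases i)
        case 0
        then have "w @ [x] = b # replicate j a @ [b]" using 1 by simp
        then show ?thesis unfolding mem by blast
      next
        case (Suc k)
        then have "w @ [x] = replicate k a @ b # b # replicate (Suc j) a"
          using 1 by (simp add: replicate_append_same)
        then show ?thesis unfolding mem by blast
      qed
    next
      case 2
      then have "w @ [x] = replicate i a @ b # b # replicate 0 a" by simp
      then show ?thesis unfolding mem by blast
    qed
  qed
  have circ: "y @ x \<in> S" if "x @ y \<in> S" for x y
    using that
  proof (induction x arbitrary: y)
    case (Cons e x)
    then have "x @ (y @ [e]) \<in> S" using rot[of e "x @ y"] by simp
    then show ?case using Cons.IH by force
  qed simp
  have "S \<in> fam F_CIRC ?W" unfolding fam.simps using reg by (blast intro: circ)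
  moreover have "marked m ?W S \<notin> EC (fam F_COMM)"
  proof
    assume L: "marked m ?W S \<in> EC (fam F_COMM)"
    have core: "replicate n a @ [b, b] @ replicate n a \<in> S" for n unfolding mem by auto
    obtain U T n i j p q where T': "alphabet U" "T \<in> fam F_COMM U" "0 < n" "0 < i" "0 < j" "p + i = n"
      "q + j = n" "replicate i a @ [b, b] @ replicate j a \<in> T"
      "replicate i a @ [b, b] @ replicate j a \<in> lists ?W"
      "\<forall>x \<in> T \<inter> lists ?W. replicate p a @ x @ replicate q a \<in> S"
      by (rule marked_EC_core[OF L m S core le_refl, of "\<lambda>_ _. 0"])
    note T = T'(1-3,5,6,8,10)
    have "mset (replicate i a @ b # replicate j a @ [b]) = mset (replicate i a @ [b, b] @ replicate j a)"
      by simp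
    moreover have "\<forall>x\<in>T. \<forall>y. mset y = mset x \<longrightarrow> y \<in> T" using T(2) unfolding fam.simps mem_Collect_eq ..
    ultimately have "replicate i a @ b # replicate j a @ [b] \<in> T" using T(6) by blast
    then have "replicate p a @ (replicate i a @ b # replicate j a @ [b]) @ replicate q a \<in> S"
      by (intro T(7)[THEN bspec]) auto
    then have "replicate n a @ b # replicate j a @ b # replicate q a \<in> S"
      by (simp add: replicate_add T(5)[symmetric])
    moreover obtain j' where "j = Suc j'" using T(4) by (cases j) auto
    ultimately show False using T(3) unfolding mem by auto
  qed
  moreover have "lists ?W \<in> fam F_CIRC ?W" using al by (intro lists_self_fam) auto
  ultimately show ?thesis
    using witness_not_subset[of ?W "fam F_CIRC" S m "fam F_COMM"] al S by blast
qed

section \<open>A non-counting language that is not a union of ordered languages\<close>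

text \<open>Disjointness of \<open>P\<close> and \<open>Q\<close> lets the letters themselves show
  the cut into pairs. Membership thus depends only on the ends of the word and on adjacent letters:
  the language is locally testable.\<close>

lemma kstar_pairs_iff:
  assumes B: "B \<subseteq> P \<times> Q" and PQ: "P \<inter> Q = {}"
  shows "w \<in> kstar {[x, y] | x y. (x, y) \<in> B} \<longleftrightarrow>
    (w = [] \<or> hd w \<in> P \<and> last w \<in> Q) \<and> successively (\<lambda>x y. (x, y) \<in> B \<or> x \<in> Q \<and> y \<in> P) w"
    (is "w \<in> ?K \<longleftrightarrow> ?ok w")
proof
  assume "w \<in> ?K"
  then show "?ok w"
  proof (induction rule: kstar_induct)
    case (append p w)
    then obtain x y where "p = [x, y]" "(x, y) \<in> B" by blast
    then show ?case using append.IH B by (cases w) auto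
  qed simp
next
  show "?ok w \<Longrightarrow> w \<in> ?K"
  proof (induction w rule: induct_list012)
    case (2 x) then show ?case using PQ by auto
  next
    case (3 x y w)
    then have xy: "(x, y) \<in> B" using PQ by auto
    then have "y \<in> Q" using B by auto
    then have "w = [] \<or> hd w \<in> P" using 3(3) B PQ by (cases w) auto
    then have "?ok w" using 3(3) by (cases w) auto
    then have "w \<in> ?K" by (rule 3(1))
    then show ?case using kstar_append[of "[x, y]" "{[x, y] | x y. (x, y) \<in> B}" w] xy by auto
  qed simp
qed

text \<open>The square \<open>y @ y\<close> already shows the junction of \<open>y\<close> with
  itself, so a third copy creates no new adjacent letters. Hence the exponent 2.\<close>

lemma kstar_pairs_NC:
  assumes B: "B \<subseteq> P \<times> Q" "P \<inter> Q = {}"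
  shows "x @ wpow y 2 @ z \<in> kstar {[x, y] | x y. (x, y) \<in> B} \<longleftrightarrow>
    x @ wpow y 3 @ z \<in> kstar {[x, y] | x y. (x, y) \<in> B}"
proof (cases "y = []")
  case False
  have "wpow y 2 = y @ y" "wpow y 3 = y @ y @ y" by (simp_all add: wpow_def numeral_eq_Suc)
  then show ?thesis using False
    by (simp only: kstar_pairs_iff[OF B]) (auto simp: successively_append_iff hd_append last_append)
qed (simp add: wpow_def)

lemma NC_not_ORD: "\<not> EC (fam F_NC) \<subseteq> (EC (fam F_ORD) :: 'a::infinite list set set)"
proof -
  obtain g :: "nat \<Rightarrow> 'a" where g: "inj g" using infinite_countable_subset[OF infinite_UNIV] by blast
  \<comment> \<open>The letters \<open>g 0\<close>, \<open>g 1\<close>, \<open>g 2\<close> have the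
    primed copies \<open>g 3\<close>, \<open>g 4\<close>, \<open>g 5\<close>, and \<open>g 6\<close>
    is the marker.\<close>
  define B where "B = {(g i, g (3 + j)) | i j. i < 3 \<and> j < 3 \<and> i \<noteq> j}"
  define P where "P = g ` {..<3}"
  define Q where "Q = g ` {3..<6}"
  define W where "W = P \<union> Q"
  define S where "S = kstar {[x, y] | x y. (x, y) \<in> B}"
  have BPQ: "B \<subseteq> P \<times> Q" by (auto simp: B_def P_def Q_def)
  have PQ: "P \<inter> Q = {}" using g by (auto simp: P_def Q_def inj_eq)
  have m: "g 6 \<notin> W" using g by (auto simp: W_def P_def Q_def inj_eq)
  have al: "alphabet W" by (auto simp: alphabet_def W_def P_def Q_def)
  have pairs: "{[x, y] | x y. (x, y) \<in> B} = (\<lambda>(x, y). [x, y]) ` B" by auto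
  have "finite B" using BPQ by (rule finite_subset) (simp add: P_def Q_def)
  then have "regular W {[x, y] | x y. (x, y) \<in> B}"
    unfolding pairs using BPQ by (intro regular_finite) (auto simp: W_def)
  then have reg: "regular W S" unfolding S_def by (rule regular_kstar)
  then have S: "S \<subseteq> lists W" by (rule regular_lists)
  have "\<exists>k\<ge>1. \<forall>x\<in>lists W. \<forall>y\<in>lists W. \<forall>z\<in>lists W.
      x @ wpow y k @ z \<in> S \<longleftrightarrow> x @ wpow y (k + 1) @ z \<in> S"
    using kstar_pairs_NC[OF BPQ PQ] by (intro exI[of _ 2]) (simp add: S_def)
  then have NC: "S \<in> fam F_NC W" using reg unfolding fam.simps by blast
  have lists: "lists W \<in> fam F_NC W" using al by (intro lists_self_fam) auto

  have S_Nil: "[] \<in> S" by (simp add: S_def)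
  have S_append: "x @ y \<in> S" if "x \<in> S" "y \<in> S" for x y
    using that unfolding S_def by (rule kstar_append_kstar)
  have pair: "[g i, g (3 + j)] \<in> S" if "i < 3" "j < 3" "i \<noteq> j" for i j
    unfolding S_def using that by (intro kstar_subset) (auto simp: B_def)
  define dead where "dead w \<longleftrightarrow> (\<forall>t. w @ t \<notin> S)" for w
  have dead_append: "dead (w @ t)" if "dead w" for w t using that by (simp add: dead_def)
  have dead_pair: "dead (w @ [g i, g (3 + i)])" if "i < 3" for w i
  proof -
    have "(g i, g (3 + i)) \<notin> B" using g by (auto simp: B_def inj_eq)
    moreover have "g i \<notin> Q" using g that by (auto simp: Q_def inj_eq)
    ultimately show ?thesis unfolding dead_def S_def kstar_pairs_iff[OF BPQ PQ]
      by (auto simp: successively_append_iff)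
  qed

  have "marked (g 6) W S \<notin> EC (fam F_ORD)"
  proof
    assume L: "marked (g 6) W S \<in> EC (fam F_ORD)"
    obtain R N where R: "finite R"
      "\<And>T u v. (T, u, v) \<in> R \<Longrightarrow> \<exists>U. alphabet U \<and> T \<in> fam F_ORD U"
      "\<And>T u v. (T, u, v) \<in> R \<Longrightarrow> length u + length v \<le> N"
      "\<And>T u v x. (T, u, v) \<in> R \<Longrightarrow> x \<in> T \<Longrightarrow> x \<in> lists W \<Longrightarrow> u @ x @ v \<in> S"
      "\<And>y. y \<in> S \<Longrightarrow> length y > N \<Longrightarrow> \<exists>T u v x. (T, u, v) \<in> R \<and> x \<in> T \<and> y = u @ x @ v"
      by (rule marked_EC_cover[OF L m S]) blast
    \<comment> \<open>Choose a word \<open>w\<close> of \<open>S\<close> with as few rules alive as possible; a rule alive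
      at \<open>w\<close> then stays alive at every extension of \<open>w\<close> within \<open>S\<close>.\<close>
    define alive where "alive \<rho> w \<longleftrightarrow> (\<exists>z. \<exists>x \<in> fst \<rho>. x \<in> lists W \<and> w @ z = fst (snd \<rho>) @ x)"
      for \<rho> :: "'a list set \<times> 'a list \<times> 'a list" and w
    define A where "A w = {\<rho> \<in> R. alive \<rho> w}" for w
    have A_mono: "A (w @ z) \<subseteq> A w" for w z by (auto simp: A_def alive_def)
    have finA: "finite (A w)" for w using R(1) by (simp add: A_def)
    \<comment> \<open>This word is longer than all contexts. Attached after a word it contains the
      right context, so the rule has to cover that word; attached at the end of \<open>w0\<close> it
      makes sure that the left context is finished.\<close>
    define long where "long = wpow [g 0, g 4] (Suc N)"
    have long: "long \<in> S" "length long > N"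
    proof -
      have "[g 0, g 4] \<in> S" using pair[of 0 1] by simp
      then have "wpow [g 0, g 4] n \<in> S" for n
        by (induction n) (auto simp: wpow_Suc S_Nil dest: S_append)
      then show "long \<in> S" by (simp add: long_def)
      have "length (wpow [g 0, g 4] n) = 2 * n" for n by (induction n) (auto simp: wpow_Suc)
      then show "length long > N" by (simp add: long_def)
    qed
    have A_nonempty: "A w \<noteq> {}" if w: "w \<in> S" for w
    proof -
      have "w @ long \<in> S" "length (w @ long) > N" using w long S_append by auto
      then obtain T u v x where T: "(T, u, v) \<in> R" "x \<in> T" "w @ long = u @ x @ v" using R(5) by blast
      have "x \<in> lists W" using \<open>w @ long \<in> S\<close> S unfolding T(3) by auto
      have "length (u @ x) \<ge> length w"
        using arg_cong[OF T(3), of length] R(3)[OF T(1)] long(2) by simp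
      then have "u @ x = w @ drop (length w) (u @ x)"
        using T(3) by (metis append_eq_append_conv_if append_assoc append_take_drop_id)
      then have "alive (T, u, v) w" unfolding alive_def using T(2) \<open>x \<in> lists W\<close> by (metis fst_conv snd_conv)
      then show ?thesis using T(1) by (auto simp: A_def)
    qed
    obtain w0 where w0: "w0 \<in> S" "\<And>w. w \<in> S \<Longrightarrow> card (A w0) \<le> card (A w)"
      using ex_has_least_nat[of "\<lambda>w. w \<in> S" "[]" "\<lambda>w. card (A w)"] S_Nil by blast
    define w where "w = w0 @ long"
    have w: "w \<in> S" "length w > N" using w0(1) long S_append by (auto simp: w_def)
    obtain T u v where \<rho>: "(T, u, v) \<in> A w" using A_nonempty[OF w(1)] by (metis equals0I surj_pair)
    then have TR: "(T, u, v) \<in> R" by (simp add: A_def)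
    have "A (w @ z) = A w" if "z \<in> S" for z
    proof (rule card_subset_eq[OF finA A_mono])
      have "card (A w) \<le> card (A w0)" unfolding w_def by (rule card_mono[OF finA A_mono])
      moreover have "card (A w0) \<le> card (A (w @ z))" using w0(2) S_append[OF w(1) that] by blast
      moreover have "card (A (w @ z)) \<le> card (A w)" by (rule card_mono[OF finA A_mono])
      ultimately show "card (A (w @ z)) = card (A w)" by simp
    qed
    then have alive: "alive (T, u, v) (w @ z)" if "z \<in> S" for z using \<rho> that by (auto simp: A_def)
    have "\<exists>x z. w @ z = u @ x" using alive[OF S_Nil] by (auto simp: alive_def)
    then obtain w' where w': "w = u @ w'"
      using w(2) R(3)[OF TR] by (auto simp: append_eq_append_conv2)
    have alive': "\<exists>t. w' @ z @ t \<in> T \<and> w' @ z @ t \<in> lists W" if "z \<in> S" for z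
      using alive[OF that] unfolding alive_def w' by auto
    obtain U where U: "alphabet U" "T \<in> fam F_ORD U" using R(2)[OF TR] by blast
    then have "ordered U T" by simp
    obtain f :: "'a list \<Rightarrow> nat" and M where f: "\<And>w. w \<in> lists U \<Longrightarrow> f w \<le> M"
      and f_mono: "\<And>w w' t. w \<in> lists U \<Longrightarrow> w' \<in> lists U \<Longrightarrow> t \<in> lists U \<Longrightarrow> f w \<le> f w' \<Longrightarrow>
        f (w @ t) \<le> f (w' @ t)"
      and TU: "T \<subseteq> lists U"
      and sat: "\<And>w w'. w \<in> T \<Longrightarrow> w' \<in> lists U \<Longrightarrow> f w = f w' \<Longrightarrow> w' \<in> T"
      using orderedE[OF \<open>ordered U T\<close>] by blast
    have zU: "w' \<in> lists U \<and> z \<in> lists U" if "z \<in> S" for z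
      using alive'[OF that] TU by (meson append_in_lists_conv subsetD)
    \<comment> \<open>Every letter of \<open>W\<close> occurs in a pair belonging to
      \<open>S\<close>, and \<open>T\<close> must be able to read that pair; \<open>k\<close> is any
      index different from that of the letter.\<close>
    have "W \<subseteq> U"
    proof
      fix x assume "x \<in> W"
      then obtain i where "i \<in> {..<3} \<union> {3..<6}" "x = g i" unfolding W_def P_def Q_def by blast
      then have i: "i < 6" "x = g i" by auto
      define k where "k = (if i mod 3 = 0 then 1 else 0 :: nat)"
      have "x \<in> set [g (i mod 3), g (3 + k)] \<or> x \<in> set [g k, g (3 + (i mod 3))]"
      proof (cases "i < 3")
        case False
        then have "i = 3 + i mod 3" using i(1) by presburger
        then show ?thesis using i(2) by auto
      qed (use i in auto)
      moreover have "i mod 3 < 3" "k < 3" "i mod 3 \<noteq> k" by (auto simp: k_def)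
      ultimately show "x \<in> U"
        using zU[OF pair[of "i mod 3" k]] zU[OF pair[of k "i mod 3"]] by (auto simp: in_lists_conv_set)
    qed
    then have WU: "z \<in> lists U" if "z \<in> lists W" for z using that lists_mono by blast
    have w'U: "w' \<in> lists U" using zU[OF S_Nil] by blast
    have w'W: "w' \<in> lists W" using w(1) S w' by auto
    \<comment> \<open>\<open>w'\<close> is what remains of \<open>w\<close> without the left
      context, so \<open>h z\<close> is the state of the automaton for \<open>T\<close> after
      \<open>w @ z\<close>.\<close>
    define h where "h z = f (w' @ z)" for z
    have h_mono: "h (x @ t) \<le> h (y @ t)" if "h x \<le> h y" "x \<in> lists W" "y \<in> lists W" "t \<in> lists W" for x y t
      using f_mono[of "w' @ x" "w' @ y" t] that WU w'U by (simp add: h_def del: in_lists_conv_set)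
    \<comment> \<open>If the states agreed, a completion of \<open>z\<close> in \<open>T\<close>
      would also complete \<open>D\<close>, and the rule would turn it into an extension of a dead
      word inside \<open>S\<close>.\<close>
    have h_neq: "h z \<noteq> h D" if z: "z \<in> S" and D: "D \<in> lists W" "dead (w @ D)" for z D
    proof
      assume eq: "h z = h D"
      obtain t where t: "w' @ z @ t \<in> T" "w' @ z @ t \<in> lists W" using alive'[OF z] by blast
      then have tW: "t \<in> lists W" "z \<in> lists W" by auto
      have "h (z @ t) = h (D @ t)" using h_mono[of z D t] h_mono[of D z t] eq tW D by simp
      then have "w' @ D @ t \<in> T"
        using sat[OF t(1), of "w' @ D @ t"] WU w'U tW D by (simp add: h_def del: in_lists_conv_set)
      then have "u @ (w' @ D @ t) @ v \<in> S" using TR tW D w'W by (intro R(4)) auto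
      then show False using D(2) unfolding dead_def w' by simp
    qed
    \<comment> \<open>A chain of alternating live and dead states; it can be lengthened at will.\<close>
    define alt where "alt = rec_nat (\<lambda>z. True) (\<lambda>n P z. \<exists>y D. y \<in> S \<and> P y \<and> D \<in> lists W \<and>
      dead (w @ D) \<and> h y \<le> h D \<and> h D \<le> h z)"
    have alt_0: "alt 0 z" for z by (simp add: alt_def)
    have alt_Suc: "alt (Suc n) z \<longleftrightarrow> (\<exists>y D. y \<in> S \<and> alt n y \<and> D \<in> lists W \<and>
      dead (w @ D) \<and> h y \<le> h D \<and> h D \<le> h z)" for n z by (simp add: alt_def)
    have SW: "z \<in> lists W" if "z \<in> S" for z using that S by blast
    \<comment> \<open>The whole chain may be prolonged by one word of \<open>S\<close>: live words
      stay in \<open>S\<close>, dead words stay dead, and the order of the states is kept.\<close>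
    have alt_append: "alt n (z @ s)" if "alt n z" "z \<in> S" "s \<in> S" for n z s
      using that
    proof (induction n arbitrary: z)
      case (Suc n)
      then obtain y D where yD: "y \<in> S" "alt n y" "D \<in> lists W" "dead (w @ D)" "h y \<le> h D" "h D \<le> h z"
        by (auto simp: alt_Suc)
      have "alt n (y @ s)" using Suc.IH yD(1,2) \<open>s \<in> S\<close> by blast
      moreover have "dead (w @ D @ s)" using dead_append[OF yD(4), of s] by simp
      moreover have "h (y @ s) \<le> h (D @ s)" "h (D @ s) \<le> h (z @ s)"
        using h_mono yD SW Suc.prems by blast+
      moreover have "y @ s \<in> S" "D @ s \<in> lists W" using yD S_append SW \<open>s \<in> S\<close> by auto
      ultimately show ?case unfolding alt_Suc by blast
    qed (simp add: alt_0)
    have alt_bound: "n \<le> h z" if "alt n z" "z \<in> S" for n z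
      using that
    proof (induction n arbitrary: z)
      case (Suc n)
      then obtain y D where yD: "y \<in> S" "alt n y" "D \<in> lists W" "dead (w @ D)" "h y \<le> h D" "h D \<le> h z"
        by (auto simp: alt_Suc)
      then have "h y \<noteq> h D" "n \<le> h y" using h_neq Suc.IH by blast+
      then show ?case using yD(5,6) by simp
    qed simp
    have "\<exists>z \<in> S. alt n z" for n
    proof (induction n)
      case 0 then show ?case using S_Nil alt_0 by blast
    next
      case (Suc n)
      then obtain z where z: "z \<in> S" "alt n z" by blast
      \<comment> \<open>After \<open>g (3 + j)\<close>, the old chain continues below the lower live
        word, the dead middle state lies above that word, and the upper live word becomes the new
        top.\<close>
      have "\<exists>i j k. i < 3 \<and> j < 3 \<and> k < (3::nat) \<and> i \<noteq> j \<and> k \<noteq> j \<and>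
          h (z @ [g i]) \<le> h (z @ [g j]) \<and> h (z @ [g j]) \<le> h (z @ [g k])"
      proof -
        let ?h = "\<lambda>i. h (z @ [g i])"
        have "(?h 0 \<le> ?h 1 \<and> ?h 1 \<le> ?h 2) \<or> (?h 2 \<le> ?h 1 \<and> ?h 1 \<le> ?h 0) \<or>
          (?h 1 \<le> ?h 0 \<and> ?h 0 \<le> ?h 2) \<or> (?h 2 \<le> ?h 0 \<and> ?h 0 \<le> ?h 1) \<or>
          (?h 0 \<le> ?h 2 \<and> ?h 2 \<le> ?h 1) \<or> (?h 1 \<le> ?h 2 \<and> ?h 2 \<le> ?h 0)" by linarith
        moreover have "(0::nat) < 3" "(1::nat) < 3" "(2::nat) < 3"
          "(0::nat) \<noteq> 1" "(0::nat) \<noteq> 2" "(1::nat) \<noteq> 2" by auto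
        ultimately show ?thesis by metis
      qed
      then obtain i j k where ijk: "i < 3" "j < 3" "k < (3::nat)" "i \<noteq> j" "k \<noteq> j"
        "h (z @ [g i]) \<le> h (z @ [g j])" "h (z @ [g j]) \<le> h (z @ [g k])" by blast
      have gW: "[g i'] \<in> lists W" "[g (3 + i')] \<in> lists W" if "i' < 3" for i'
        using that by (auto simp: W_def P_def Q_def)
      let ?t = "[g (3 + j)]"
      have "h ((z @ [g i]) @ ?t) \<le> h ((z @ [g j]) @ ?t)" "h ((z @ [g j]) @ ?t) \<le> h ((z @ [g k]) @ ?t)"
        using ijk gW SW[OF z(1)] by (intro h_mono; simp)+
      then have "h (z @ [g i, g (3 + j)]) \<le> h (z @ [g j, g (3 + j)])"
        "h (z @ [g j, g (3 + j)]) \<le> h (z @ [g k, g (3 + j)])" by simp_all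
      moreover have "z @ [g i, g (3 + j)] \<in> S" "alt n (z @ [g i, g (3 + j)])"
        "z @ [g k, g (3 + j)] \<in> S"
        using z ijk pair S_append alt_append by auto
      moreover have "z @ [g j, g (3 + j)] \<in> lists W" using gW[OF ijk(2)] SW[OF z(1)] by simp
      moreover have "dead (w @ z @ [g j, g (3 + j)])" using dead_pair[OF ijk(2), of "w @ z"] by simp
      ultimately have "alt (Suc n) (z @ [g k, g (3 + j)])" unfolding alt_Suc by blast
      then show ?case using \<open>z @ [g k, g (3 + j)] \<in> S\<close> by blast
    qed
    then obtain z where z: "z \<in> S" "alt (Suc M) z" by blast
    have "h z \<le> M" unfolding h_def using zU[OF z(1)] by (intro f) simp
    then show False using alt_bound[OF z(2,1)] by simp
  qed
  then show ?thesis
    using witness_not_subset[of W "fam F_NC" S "g 6" "fam F_ORD"] al lists NC S by blast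
qed

section \<open>The hierarchy\<close>

text \<open>The reflexive and transitive closure of the edges, written out so that statements about
  all pairs of nodes can be evaluated. The last clause serves \<open>F_REG\<close> and the names
  that are no nodes.\<close>

fun above :: "family_name \<Rightarrow> family_name set" where
  "above F_FIN = hierarchy_nodes"
| "above F_MON = hierarchy_nodes - {F_FIN}"
| "above F_NIL = {F_NIL, F_DEF, F_COMM, F_ORD, F_SYDEF, F_NC, F_PS, F_CIRC, F_REG}"
| "above F_COMB = {F_COMB, F_DEF, F_ORD, F_SYDEF, F_NC, F_PS, F_REG}"
| "above F_INF = {F_INF, F_SUF, F_PRE, F_PS, F_REG}"
| "above F_STAR = {F_STAR, F_REG}"
| "above F_DEF = {F_DEF, F_ORD, F_SYDEF, F_NC, F_PS, F_REG}"
| "above F_COMM = {F_COMM, F_CIRC, F_REG}"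
| "above F_ORD = {F_ORD, F_NC, F_PS, F_REG}"
| "above F_SYDEF = {F_SYDEF, F_PS, F_REG}"
| "above F_NC = {F_NC, F_PS, F_REG}"
| "above F_SUF = {F_SUF, F_PS, F_REG}"
| "above F_PRE = {F_PRE, F_PS, F_REG}"
| "above F_PS = {F_PS, F_REG}"
| "above F_CIRC = {F_CIRC, F_REG}"
| "above X = {X}"

text \<open>Every other non-inclusion between nodes follows from one of these by enlarging the left
  family or shrinking the right one.\<close>

definition separations :: "(family_name \<times> family_name) list" where
  "separations =
    [(F_MON, F_FIN), (F_NIL, F_COMB), (F_NIL, F_SUF), (F_NIL, F_PRE), (F_NIL, F_STAR),
     (F_COMB, F_SUF), (F_COMB, F_PRE), (F_COMB, F_STAR), (F_COMB, F_CIRC),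
     (F_INF, F_NC), (F_INF, F_SYDEF), (F_INF, F_STAR), (F_INF, F_CIRC),
     (F_STAR, F_PS), (F_STAR, F_CIRC), (F_COMM, F_PS), (F_ORD, F_SYDEF), (F_SYDEF, F_NC),
     (F_NC, F_ORD), (F_SUF, F_PRE), (F_PRE, F_SUF), (F_CIRC, F_COMM)]"

text \<open>Proved from the top of the diagram downwards, so that each node only joins the sets of
  its direct successors.\<close>

lemma above_rtrancl: "above X \<subseteq> {Y. (X, Y) \<in> proper_inclusions\<^sup>*}"
proof -
  define R where "R X = {Y. (X, Y) \<in> proper_inclusions\<^sup>*}" for X
  have self: "X \<in> R X" for X by (simp add: R_def)
  have step: "R Y \<subseteq> R X" if "(X, Y) \<in> proper_inclusions" for X Y
    using that by (auto simp: R_def intro: converse_rtrancl_into_rtrancl)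
  have up: "above Y \<subseteq> R X" if "above Y \<subseteq> R Y" "(X, Y) \<in> proper_inclusions" for X Y
    using that step by blast
  note edge = proper_inclusions_def
  have REG: "above F_REG \<subseteq> R F_REG"
    using self[of F_REG]  by (simp add: edge)
  have PS: "above F_PS \<subseteq> R F_PS"
    using self[of F_PS] up[OF REG, of F_PS] by (simp add: edge)
  have STAR: "above F_STAR \<subseteq> R F_STAR"
    using self[of F_STAR] up[OF REG, of F_STAR] by (simp add: edge)
  have CIRC: "above F_CIRC \<subseteq> R F_CIRC"
    using self[of F_CIRC] up[OF REG, of F_CIRC] by (simp add: edge)
  have COMM: "above F_COMM \<subseteq> R F_COMM"
    using self[of F_COMM] up[OF CIRC, of F_COMM] by (simp add: edge)
  have NC: "above F_NC \<subseteq> R F_NC"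
    using self[of F_NC] up[OF PS, of F_NC] by (simp add: edge)
  have SYDEF: "above F_SYDEF \<subseteq> R F_SYDEF"
    using self[of F_SYDEF] up[OF PS, of F_SYDEF] by (simp add: edge)
  have ORD: "above F_ORD \<subseteq> R F_ORD"
    using self[of F_ORD] up[OF NC, of F_ORD] by (simp add: edge)
  have DEF: "above F_DEF \<subseteq> R F_DEF"
    using self[of F_DEF] up[OF ORD, of F_DEF] up[OF SYDEF, of F_DEF] by (simp add: edge)
  have SUF: "above F_SUF \<subseteq> R F_SUF"
    using self[of F_SUF] up[OF PS, of F_SUF] by (simp add: edge)
  have PRE: "above F_PRE \<subseteq> R F_PRE"
    using self[of F_PRE] up[OF PS, of F_PRE] by (simp add: edge)
  have INF: "above F_INF \<subseteq> R F_INF"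
    using self[of F_INF] up[OF SUF, of F_INF] up[OF PRE, of F_INF] by (simp add: edge)
  have COMB: "above F_COMB \<subseteq> R F_COMB"
    using self[of F_COMB] up[OF DEF, of F_COMB] by (simp add: edge)
  have NIL: "above F_NIL \<subseteq> R F_NIL"
    using self[of F_NIL] up[OF DEF, of F_NIL] up[OF COMM, of F_NIL] by (simp add: edge)
  have MON: "above F_MON \<subseteq> R F_MON"
    using self[of F_MON] up[OF NIL, of F_MON] up[OF COMB, of F_MON] up[OF INF, of F_MON] up[OF STAR, of F_MON] by (simp add: edge hierarchy_nodes_def)
  have FIN: "above F_FIN \<subseteq> R F_FIN"
    using self[of F_FIN] up[OF MON, of F_FIN] by (simp add: edge hierarchy_nodes_def)
  have "above X \<subseteq> R X"
    using REG PS STAR CIRC COMM NC SYDEF ORD DEF SUF PRE INF COMB NIL MON FIN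
    by (cases X) (simp_all only:, simp_all add: self)
  then show ?thesis by (simp add: R_def)
qed

lemma EC_inclusion:
  "(X, Y) \<in> proper_inclusions \<Longrightarrow> EC (fam X) \<subseteq> (EC (fam Y) :: 'a list set set)"
  unfolding proper_inclusions_def
  by (elim insertE emptyE Pair_inject; hypsubst)
    (rule EC_FIN_MON EC_MON_COMB EC_COMB_DEF EC_NIL_DEF EC_NIL_COMM EC_DEF_ORD EC_DEF_SYDEF EC_ORD_NC
      EC_NC_PS EC_SYDEF_PS EC_INF_SUF EC_INF_PRE EC_SUF_PS EC_PRE_PS EC_fam_REG EC_COMM_CIRC
      | rule EC_MON_subset, simp)+

lemma EC_above: "Y \<in> above X \<Longrightarrow> EC (fam X) \<subseteq> (EC (fam Y) :: 'a list set set)"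
proof -
  assume "Y \<in> above X"
  then have "(X, Y) \<in> proper_inclusions\<^sup>*" using above_rtrancl by blast
  then show ?thesis
    by (induction rule: rtrancl_induct) (use EC_inclusion in \<open>blast+\<close>)
qed

lemma EC_separation:
  "(X, Y) \<in> set separations \<Longrightarrow> \<not> EC (fam X) \<subseteq> (EC (fam Y) :: 'a::infinite list set set)"
  by (auto simp: separations_def MON_not_FIN NIL_not COMB_not INF_not even_powers_not_PS STAR_not_CIRC
    ORD_not_SYDEF SYDEF_not_NC NC_not_ORD SUF_not_PRE PRE_not_SUF CIRC_not_COMM)

text \<open>An inclusion would place \<open>EC (fam X0)\<close> below \<open>EC (fam X)\<close>,
  \<open>EC (fam Y)\<close> and \<open>EC (fam Y0)\<close> in turn, against the separation of
  \<open>X0\<close> from \<open>Y0\<close>. That every pair has a suitable separation is a finite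
  check.\<close>

lemma EC_not_above:
  assumes "X \<in> hierarchy_nodes" "Y \<in> hierarchy_nodes" "Y \<notin> above X"
  shows "\<not> EC (fam X) \<subseteq> (EC (fam Y) :: 'a::infinite list set set)"
proof -
  have "\<forall>X\<in>hierarchy_nodes. \<forall>Y\<in>hierarchy_nodes. Y \<in> above X \<or>
      (\<exists>(X0, Y0) \<in> set separations. X \<in> above X0 \<and> Y0 \<in> above Y)"
    by code_simp
  then have "\<exists>(X0, Y0) \<in> set separations. X \<in> above X0 \<and> Y0 \<in> above Y" using assms by blast
  then obtain X0 Y0 where "(X0, Y0) \<in> set separations" "X \<in> above X0" "Y0 \<in> above Y" by blast
  then show ?thesis using EC_separation[of X0 Y0] EC_above[of X X0] EC_above[of Y0 Y] by blast
qed

theorem theorem24: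
  "(EC (fam F_REG) :: 'a::infinite list set set) = EC (fam F_UF) \<and>
   (EC (fam F_UF) :: 'a list set set) = EC (fam F_LCOM) \<and>
   (EC (fam F_LCOM) :: 'a list set set) = EC (fam F_RCOM) \<and>
   (EC (fam F_RCOM) :: 'a list set set) = EC (fam F_2COM) \<and>
   (\<forall>(X, Y) \<in> proper_inclusions. (EC (fam X) :: 'a list set set) \<subset> EC (fam Y)) \<and>
   (\<forall>X \<in> hierarchy_nodes. \<forall>Y \<in> hierarchy_nodes.
      X \<noteq> Y \<and> (X, Y) \<notin> proper_inclusions\<^sup>* \<and> (Y, X) \<notin> proper_inclusions\<^sup>* \<longrightarrow>
      \<not> (EC (fam X) :: 'a list set set) \<subseteq> EC (fam Y) \<and>
      \<not> (EC (fam Y) :: 'a list set set) \<subseteq> EC (fam X))"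
proof (intro conjI ballI impI)
  show "(EC (fam F_REG) :: 'a list set set) = EC (fam F_UF)" by (simp only: EC_UF)
  show "(EC (fam F_UF) :: 'a list set set) = EC (fam F_LCOM)" by (simp only: EC_UF EC_LCOM)
  show "(EC (fam F_LCOM) :: 'a list set set) = EC (fam F_RCOM)" by (simp only: EC_LCOM EC_RCOM)
  show "(EC (fam F_RCOM) :: 'a list set set) = EC (fam F_2COM)" by (simp only: EC_RCOM EC_2COM)
next
  fix p :: "family_name \<times> family_name"
  assume p: "p \<in> proper_inclusions"
  obtain X Y where XY: "p = (X, Y)" by (cases p)
  \<comment> \<open>The diagram has no cycle, so the reverse of an edge is again a pair settled by
    the separations; this gives properness.\<close>
  have "X \<in> hierarchy_nodes" "Y \<in> hierarchy_nodes" "X \<notin> above Y"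
    using p unfolding XY proper_inclusions_def hierarchy_nodes_def by auto
  then have "\<not> EC (fam Y) \<subseteq> (EC (fam X) :: 'a list set set)" by (intro EC_not_above)
  moreover have "EC (fam X) \<subseteq> (EC (fam Y) :: 'a list set set)" using p XY by (intro EC_inclusion) simp
  ultimately show "case p of (X, Y) \<Rightarrow> (EC (fam X) :: 'a list set set) \<subset> EC (fam Y)"
    unfolding XY by auto
next
  fix X Y
  assume nodes: "X \<in> hierarchy_nodes" "Y \<in> hierarchy_nodes"
    and inc: "X \<noteq> Y \<and> (X, Y) \<notin> proper_inclusions\<^sup>* \<and> (Y, X) \<notin> proper_inclusions\<^sup>*"
  have "Y \<notin> above X" "X \<notin> above Y" using inc above_rtrancl by blast+
  then show "\<not> (EC (fam X) :: 'a list set set) \<subseteq> EC (fam Y)"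
    "\<not> (EC (fam Y) :: 'a list set set) \<subseteq> EC (fam X)"
    by (simp_all add: EC_not_above nodes)
qed

end
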